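(* Let $\alpha\geq 2$ be a computable ordinal and let $\mathcal{A}$ be a countable structure for a computable language. If $\mathcal{A}$ has a Scott sentence that is computable $\Pi_\alpha$ and a Scott sentence that is computable $\Sigma_\alpha$, then $\mathcal{A}$ has a Scott sentence that is computable $d$-$\Sigma_{<\alpha}$, i.e. computable $d$-$\Sigma_\beta$ for some $\beta<\alpha$.
   Context: Structures are countably infinite with universe $\omega$. Computable infinitary formulas are formulas of $L_{\omega_1\omega}$ (with finitely many free variables) in which the infinite disjunctions and conjunctions are over c.e. sets. Precisely, for a computable ordinal $\alpha$ one fixes a notation for $\alpha$ in Kleene's $\mathcal{O}$, ordinals $\beta<\alpha$ being represented by the notations below it. A formula is computable $\Sigma_0$ and computable $\Pi_0$ if it is finitary quantifier-free. For $\alpha>0$, a computable $\Sigma_\alpha$ formula $\varphi(\bar x)$ is the disjunction of a c.e. set (a c.e. set of indices) of formulas $(\exists\bar u)\psi(\bar x,\bar u)$, where each $\psi$ is computable $\Pi_\beta$ for some $\beta<\alpha$; a computable $\Pi_\alpha$ formula $\varphi(\bar x)$ is the conjunction of a c.e. set of formulas $(\forall\bar u)\psi(\bar x,\bar u)$, where each $\psi$ is computable $\Sigma_\beta$ for some $\beta<\alpha$. Here an index of a computable $\Sigma_\alpha$ (resp. $\Pi_\alpha$) formula records $\Sigma$ (resp. $\Pi$), the notation, the tuple of free variables, and a c.e. index for the set of pairs (index of $\psi$, tuple $\bar u$). A formula is computable $d$-$\Sigma_\beta$ if it is the conjunction of a computable $\Sigma_\beta$ formula and a computable $\Pi_\beta$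 formula. A Scott sentence for $\mathcal{A}$ is a sentence of $L_{\omega_1\omega}$ whose countable models are exactly the isomorphic copies of $\mathcal{A}$. *)

theory Defs
  imports Main "HOL-Library.Nat_Bijection"
begin

unbundle cardinal_syntax

section \<open>Partial computable functions and c.e. sets\<close>

text \<open>
  Programs for unary partial functions on the natural numbers; functions of several arguments are
  coded with the pairing function \<^const>\<open>prod_encode\<close>.
\<close>

datatype prog =
    Zero | Succ | Fst | Snd
  | Pair prog prog | Comp prog prog | Prec prog prog | Mu prog

inductive eval :: "prog \<Rightarrow> nat \<Rightarrow> nat \<Rightarrow> bool" where
  "eval Zero n 0"
| "eval Succ n (Suc n)"
| "eval Fst (prod_encode (m, n)) m"
| "eval Snd (prod_encode (m, n)) n"
| "eval p n y \<Longrightarrow> eval q n z \<Longrightarrow> eval (Pair p q) n (prod_encode (y, z))"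
| "eval q n y \<Longrightarrow> eval p y z \<Longrightarrow> eval (Comp p q) n z"
| "eval p x y \<Longrightarrow> eval (Prec p q) (prod_encode (x, 0)) y"
| "eval (Prec p q) (prod_encode (x, n)) y \<Longrightarrow>
   eval q (prod_encode (x, prod_encode (n, y))) z \<Longrightarrow>
   eval (Prec p q) (prod_encode (x, Suc n)) z"
| "eval p (prod_encode (x, n)) 0 \<Longrightarrow>
   (\<forall>m<n. \<exists>y. eval p (prod_encode (x, m)) (Suc y)) \<Longrightarrow>
   eval (Mu p) x n"

primrec prog_code :: "prog \<Rightarrow> nat" where
  "prog_code Zero = prod_encode (0, 0)"
| "prog_code Succ = prod_encode (1, 0)"
| "prog_code Fst = prod_encode (2, 0)"
| "prog_code Snd = prod_encode (3, 0)"
| "prog_code (Pair p q) = prod_encode (4, prod_encode (prog_code p, prog_code q))"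
| "prog_code (Comp p q) = prod_encode (5, prod_encode (prog_code p, prog_code q))"
| "prog_code (Prec p q) = prod_encode (6, prod_encode (prog_code p, prog_code q))"
| "prog_code (Mu p) = prod_encode (7, prog_code p)"

lemma prog_code_inject: "prog_code p = prog_code q \<longleftrightarrow> p = q"
proof (induction p arbitrary: q)
  case (Pair p1 p2) then show ?case by (cases q) auto
next
  case (Comp p1 p2) then show ?case by (cases q) auto
next
  case (Prec p1 p2) then show ?case by (cases q) auto
qed (case_tac q; auto)+

text \<open>The \<open>e\<close>-th partial computable function (nowhere defined if \<open>e\<close> codes no program).\<close>

definition phi :: "nat \<Rightarrow> nat \<Rightarrow> nat \<Rightarrow> bool" where
  "phi e n m \<longleftrightarrow> (\<exists>p. prog_code p = e \<and> eval p n m)"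

definition W :: "nat \<Rightarrow> nat set" where
  "W e = {n. \<exists>m. phi e n m}"

definition computable_fun :: "(nat \<Rightarrow> nat) \<Rightarrow> bool" where
  "computable_fun f \<longleftrightarrow> (\<exists>e. \<forall>n. phi e n (f n))"

section \<open>Kleene's system of ordinal notations\<close>

inductive kleene_O :: "nat \<Rightarrow> bool"
  and kleene_less :: "nat \<Rightarrow> nat \<Rightarrow> bool"  (infix "<\<^sub>O" 50)
where
  zero: "kleene_O 1"
| succ: "kleene_O a \<Longrightarrow> kleene_O (2 ^ a)"
| limit: "(\<forall>n. phi e n (s n) \<and> kleene_O (s n) \<and> s n <\<^sub>O s (Suc n)) \<Longrightarrow> kleene_O (3 * 5 ^ e)"
| less_succ: "kleene_O a \<Longrightarrow> a <\<^sub>O 2 ^ a"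
| less_limit: "(\<forall>n. phi e n (s n) \<and> kleene_O (s n) \<and> s n <\<^sub>O s (Suc n)) \<Longrightarrow> s k <\<^sub>O 3 * 5 ^ e"
| less_trans: "a <\<^sub>O b \<Longrightarrow> b <\<^sub>O c \<Longrightarrow> a <\<^sub>O c"

text \<open>
  The ordinal denoted by \<open>a\<close> is the order type of the notations below \<open>a\<close>. It is represented
  by the corresponding reflexive well-order relation, as usual for ordinals in HOL.
\<close>

definition ordinal_of :: "nat \<Rightarrow> nat rel" where
  "ordinal_of a = {(b, c). b <\<^sub>O a \<and> c <\<^sub>O a \<and> (b = c \<or> b <\<^sub>O c)}"

section \<open>Languages and structures\<close>

text \<open>
  Symbols are natural numbers; \<open>rel_arity L R = Some k\<close> means that \<open>R\<close> is a \<open>k\<close>-ary relation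
  symbol of \<open>L\<close>. Constants are function symbols of arity \<open>0\<close>.
\<close>

record language =
  rel_arity :: "nat \<Rightarrow> nat option"
  fun_arity :: "nat \<Rightarrow> nat option"

definition computable_language :: "language \<Rightarrow> bool" where
  "computable_language L \<longleftrightarrow>
     computable_fun (\<lambda>R. case rel_arity L R of None \<Rightarrow> 0 | Some k \<Rightarrow> Suc k) \<and>
     computable_fun (\<lambda>f. case fun_arity L f of None \<Rightarrow> 0 | Some k \<Rightarrow> Suc k)"

text \<open>
  Structures with universe \<open>\<omega>\<close>. Every such record is a structure for every language: the values
  at symbols outside the language and at argument lists of the wrong length are irrelevant.
\<close>

record struct =
  rel_int :: "nat \<Rightarrow> nat list \<Rightarrow> bool"
  fun_int :: "nat \<Rightarrow> nat list \<Rightarrow> nat"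

definition isomorphic :: "language \<Rightarrow> struct \<Rightarrow> struct \<Rightarrow> bool" where
  "isomorphic L A B \<longleftrightarrow>
     (\<exists>h :: nat \<Rightarrow> nat. bij h \<and>
        (\<forall>R k xs. rel_arity L R = Some k \<and> length xs = k \<longrightarrow>
           (rel_int A R xs \<longleftrightarrow> rel_int B R (map h xs))) \<and>
        (\<forall>f k xs. fun_arity L f = Some k \<and> length xs = k \<longrightarrow>
           h (fun_int A f xs) = fun_int B f (map h xs)))"

section \<open>Terms and finitary quantifier-free formulas\<close>

datatype tm = Var nat | Fn nat "tm list"

datatype qf =
    Verum | Rel nat "tm list" | Eq tm tm
  | QNeg qf | QAnd qf qf | QOr qf qf

primrec tm_fv :: "tm \<Rightarrow> nat set" where
  "tm_fv (Var x) = {x}"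
| "tm_fv (Fn f ts) = \<Union> (set (map tm_fv ts))"

primrec tm_wf :: "language \<Rightarrow> tm \<Rightarrow> bool" where
  "tm_wf L (Var x) \<longleftrightarrow> True"
| "tm_wf L (Fn f ts) \<longleftrightarrow> fun_arity L f = Some (length ts) \<and> list_all id (map (tm_wf L) ts)"

primrec tm_val :: "struct \<Rightarrow> (nat \<Rightarrow> nat) \<Rightarrow> tm \<Rightarrow> nat" where
  "tm_val A v (Var x) = v x"
| "tm_val A v (Fn f ts) = fun_int A f (map (tm_val A v) ts)"

primrec tm_code :: "tm \<Rightarrow> nat" where
  "tm_code (Var x) = prod_encode (0, x)"
| "tm_code (Fn f ts) = prod_encode (1, prod_encode (f, list_encode (map tm_code ts)))"

primrec qf_fv :: "qf \<Rightarrow> nat set" where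
  "qf_fv Verum = {}"
| "qf_fv (Rel R ts) = \<Union> (tm_fv ` set ts)"
| "qf_fv (Eq s t) = tm_fv s \<union> tm_fv t"
| "qf_fv (QNeg \<phi>) = qf_fv \<phi>"
| "qf_fv (QAnd \<phi> \<psi>) = qf_fv \<phi> \<union> qf_fv \<psi>"
| "qf_fv (QOr \<phi> \<psi>) = qf_fv \<phi> \<union> qf_fv \<psi>"

primrec qf_wf :: "language \<Rightarrow> qf \<Rightarrow> bool" where
  "qf_wf L Verum \<longleftrightarrow> True"
| "qf_wf L (Rel R ts) \<longleftrightarrow> rel_arity L R = Some (length ts) \<and> list_all (tm_wf L) ts"
| "qf_wf L (Eq s t) \<longleftrightarrow> tm_wf L s \<and> tm_wf L t"
| "qf_wf L (QNeg \<phi>) \<longleftrightarrow> qf_wf L \<phi>"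
| "qf_wf L (QAnd \<phi> \<psi>) \<longleftrightarrow> qf_wf L \<phi> \<and> qf_wf L \<psi>"
| "qf_wf L (QOr \<phi> \<psi>) \<longleftrightarrow> qf_wf L \<phi> \<and> qf_wf L \<psi>"

primrec qf_sat :: "struct \<Rightarrow> (nat \<Rightarrow> nat) \<Rightarrow> qf \<Rightarrow> bool" where
  "qf_sat A v Verum \<longleftrightarrow> True"
| "qf_sat A v (Rel R ts) \<longleftrightarrow> rel_int A R (map (tm_val A v) ts)"
| "qf_sat A v (Eq s t) \<longleftrightarrow> tm_val A v s = tm_val A v t"
| "qf_sat A v (QNeg \<phi>) \<longleftrightarrow> \<not> qf_sat A v \<phi>"
| "qf_sat A v (QAnd \<phi> \<psi>) \<longleftrightarrow> qf_sat A v \<phi> \<and> qf_sat A v \<psi>"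
| "qf_sat A v (QOr \<phi> \<psi>) \<longleftrightarrow> qf_sat A v \<phi> \<or> qf_sat A v \<psi>"

primrec qf_code :: "qf \<Rightarrow> nat" where
  "qf_code Verum = prod_encode (0, 0)"
| "qf_code (Rel R ts) = prod_encode (1, prod_encode (R, list_encode (map tm_code ts)))"
| "qf_code (Eq s t) = prod_encode (2, prod_encode (tm_code s, tm_code t))"
| "qf_code (QNeg \<phi>) = prod_encode (3, qf_code \<phi>)"
| "qf_code (QAnd \<phi> \<psi>) = prod_encode (4, prod_encode (qf_code \<phi>, qf_code \<psi>))"
| "qf_code (QOr \<phi> \<psi>) = prod_encode (5, prod_encode (qf_code \<phi>, qf_code \<psi>))"

section \<open>The infinitary logic \<open>L\<^sub>\<omega>\<^sub>1\<^sub>\<omega>\<close>\<close>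

text \<open>
  \<open>Conj I F\<close> and \<open>Disj I F\<close> are the conjunction and the disjunction of the countable family
  \<open>F i\<close>, \<open>i \<in> I\<close>; the values of \<open>F\<close> outside \<open>I\<close> play no role.
\<close>

datatype fm =
    Qf qf
  | Neg fm
  | Conj "nat set" "nat \<Rightarrow> fm"
  | Disj "nat set" "nat \<Rightarrow> fm"
  | Ex nat fm
  | All nat fm

primrec fv :: "fm \<Rightarrow> nat set" where
  "fv (Qf \<theta>) = qf_fv \<theta>"
| "fv (Neg \<phi>) = fv \<phi>"
| "fv (Conj I F) = (\<Union>i\<in>I. fv (F i))"
| "fv (Disj I F) = (\<Union>i\<in>I. fv (F i))"
| "fv (Ex x \<phi>) = fv \<phi> - {x}"
| "fv (All x \<phi>) = fv \<phi> - {x}"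

primrec fm_wf :: "language \<Rightarrow> fm \<Rightarrow> bool" where
  "fm_wf L (Qf \<theta>) \<longleftrightarrow> qf_wf L \<theta>"
| "fm_wf L (Neg \<phi>) \<longleftrightarrow> fm_wf L \<phi>"
| "fm_wf L (Conj I F) \<longleftrightarrow> (\<forall>i\<in>I. fm_wf L (F i))"
| "fm_wf L (Disj I F) \<longleftrightarrow> (\<forall>i\<in>I. fm_wf L (F i))"
| "fm_wf L (Ex x \<phi>) \<longleftrightarrow> fm_wf L \<phi>"
| "fm_wf L (All x \<phi>) \<longleftrightarrow> fm_wf L \<phi>"

primrec sat :: "struct \<Rightarrow> fm \<Rightarrow> (nat \<Rightarrow> nat) \<Rightarrow> bool" where
  "sat A (Qf \<theta>) = (\<lambda>v. qf_sat A v \<theta>)"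
| "sat A (Neg \<phi>) = (\<lambda>v. \<not> sat A \<phi> v)"
| "sat A (Conj I F) = (\<lambda>v. \<forall>i\<in>I. sat A (F i) v)"
| "sat A (Disj I F) = (\<lambda>v. \<exists>i\<in>I. sat A (F i) v)"
| "sat A (Ex x \<phi>) = (\<lambda>v. \<exists>c. sat A \<phi> (v(x := c)))"
| "sat A (All x \<phi>) = (\<lambda>v. \<forall>c. sat A \<phi> (v(x := c)))"

definition And :: "fm \<Rightarrow> fm \<Rightarrow> fm" where
  "And \<phi> \<psi> = Conj {0, 1} (\<lambda>i. if i = 0 then \<phi> else \<psi>)"

definition Ex_tuple :: "nat list \<Rightarrow> fm \<Rightarrow> fm" where
  "Ex_tuple us \<phi> = foldr Ex us \<phi>"

definition All_tuple :: "nat list \<Rightarrow> fm \<Rightarrow> fm" where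
  "All_tuple us \<phi> = foldr All us \<phi>"

definition sentence :: "language \<Rightarrow> fm \<Rightarrow> bool" where
  "sentence L \<phi> \<longleftrightarrow> fm_wf L \<phi> \<and> fv \<phi> = {}"

definition models :: "struct \<Rightarrow> fm \<Rightarrow> bool" where
  "models A \<phi> \<longleftrightarrow> (\<forall>v. sat A \<phi> v)"

definition scott_sentence :: "language \<Rightarrow> struct \<Rightarrow> fm \<Rightarrow> bool" where
  "scott_sentence L A \<phi> \<longleftrightarrow>
     sentence L \<phi> \<and> (\<forall>B. models B \<phi> \<longleftrightarrow> isomorphic L A B)"

section \<open>Computable infinitary formulas\<close>

datatype polarity = Sigma_pol | Pi_pol

primrec pol_code :: "polarity \<Rightarrow> nat" where
  "pol_code Sigma_pol = 0"
| "pol_code Pi_pol = 1"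

definition mk_index :: "polarity \<Rightarrow> nat \<Rightarrow> nat list \<Rightarrow> nat \<Rightarrow> nat" where
  "mk_index k a xs e =
     prod_encode (pol_code k, prod_encode (a, prod_encode (list_encode xs, e)))"

text \<open>
  \<open>indexes L k a xs i \<phi>\<close>: the number \<open>i\<close> is an index of \<open>\<phi>\<close> as a computable \<open>\<Sigma>\<^sub>a\<close> or \<open>\<Pi>\<^sub>a\<close>
  formula (according to \<open>k\<close>) in the tuple of variables \<open>xs\<close>, where \<open>a\<close> is an ordinal notation.
  At notation \<open>1\<close> (the ordinal \<open>0\<close>) the last component codes a quantifier-free formula; above,
  it is a c.e. index of a set all of whose elements are pairs (index of \<open>\<psi>(xs, us)\<close>, \<open>us\<close>).
\<close>

inductive indexes ::
  "language \<Rightarrow> polarity \<Rightarrow> nat \<Rightarrow> nat list \<Rightarrow> nat \<Rightarrow> fm \<Rightarrow> bool"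
  for L :: language
where
  quantifier_free:
    "distinct xs \<Longrightarrow> qf_wf L \<theta> \<Longrightarrow> qf_fv \<theta> \<subseteq> set xs \<Longrightarrow>
     indexes L k 1 xs (mk_index k 1 xs (qf_code \<theta>)) (Qf \<theta>)"
| Sigma:
    "kleene_O a \<Longrightarrow> a \<noteq> 1 \<Longrightarrow> distinct xs \<Longrightarrow>
     (\<forall>p\<in>W e. \<exists>j us b \<psi>. p = prod_encode (j, list_encode us) \<and> b <\<^sub>O a \<and>
        indexes L Pi_pol b (xs @ us) j \<psi> \<and> F p = Ex_tuple us \<psi>) \<Longrightarrow>
     indexes L Sigma_pol a xs (mk_index Sigma_pol a xs e) (Disj (W e) F)"
| Pi:
    "kleene_O a \<Longrightarrow> a \<noteq> 1 \<Longrightarrow> distinct xs \<Longrightarrow>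
     (\<forall>p\<in>W e. \<exists>j us b \<psi>. p = prod_encode (j, list_encode us) \<and> b <\<^sub>O a \<and>
        indexes L Sigma_pol b (xs @ us) j \<psi> \<and> F p = All_tuple us \<psi>) \<Longrightarrow>
     indexes L Pi_pol a xs (mk_index Pi_pol a xs e) (Conj (W e) F)"

definition computable_Sigma :: "language \<Rightarrow> nat \<Rightarrow> nat list \<Rightarrow> fm \<Rightarrow> bool" where
  "computable_Sigma L a xs \<phi> \<longleftrightarrow> (\<exists>i. indexes L Sigma_pol a xs i \<phi>)"

definition computable_Pi :: "language \<Rightarrow> nat \<Rightarrow> nat list \<Rightarrow> fm \<Rightarrow> bool" where
  "computable_Pi L a xs \<phi> \<longleftrightarrow> (\<exists>i. indexes L Pi_pol a xs i \<phi>)"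

definition computable_d_Sigma :: "language \<Rightarrow> nat \<Rightarrow> nat list \<Rightarrow> fm \<Rightarrow> bool" where
  "computable_d_Sigma L b xs \<chi> \<longleftrightarrow>
     (\<exists>\<phi> \<psi>. \<chi> = And \<phi> \<psi> \<and> computable_Sigma L b xs \<phi> \<and> computable_Pi L b xs \<psi>)"

end

theory Submission
  imports Defs "HOL-Library.Infinite_Set"
begin

text \<open>
  One disjunct \<open>\<exists>u. \<psi>(u)\<close> of the \<open>\<Sigma>\<^sub>a\<close> Scott sentence is realised in \<open>A\<close>, where \<open>\<psi>\<close> is \<open>\<Pi>\<^sub>b\<close>
  with \<open>b < a\<close>; the disjunct is then itself a Scott sentence. Force with finite conjunctions \<open>p(y)\<close>
  of computable formulas of low level realised in \<open>A\<close>, thought of as partial enumerations of a copy of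
  \<open>A\<close>. Every sufficiently generic copy satisfies the \<open>\<Pi>\<^sub>a\<close> Scott sentence, hence is isomorphic to
  \<open>A\<close>. If no \<open>p\<close> implied, in \<open>A\<close>, some disjunct \<open>\<psi>\<close> of the \<open>\<Sigma>\<^sub>a\<close> sentence at some tuple, then a generic
  copy would omit all these disjuncts, a contradiction. For an isolating \<open>p\<close> the sentence
  \<open>(\<exists>y. p(y)) \<and> (\<forall>y. p(y) \<longrightarrow> \<psi>(u))\<close>, with \<open>u\<close> among the \<open>y\<close>, is a Scott sentence of \<open>A\<close>. It is
  \<open>d-\<Sigma>\<^sub>c\<close> for some \<open>c < a\<close>, because \<open>\<psi>\<close> is a conjunction of formulas \<open>\<forall>v. \<chi>\<close> of lower level and
  \<open>\<not> p \<or> \<chi>\<close> can be computed from \<open>\<chi>\<close>. The recursion theorem provides the substitution and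
  negation of indices, and an enumeration of the notations below a given one provides the level of
  \<open>\<not> p \<or> \<chi>\<close>.
\<close>

section \<open>Closure properties of the computable functions\<close>

text \<open>Only the final sentence needs indices, and it is assembled from indices already at hand.
  The obstacle is the level. The final sentence is to have some level \<delta> < a, and both
  \<exists>y. p and \<not> p \<or> \<chi> fit there only if p lies strictly below \<delta>.
  Conditions therefore stay two steps below a, and a formula of level just below a cannot in general
  be imposed as a condition. It is decided all the same: if some enumeration in the condition has a
  witness for it, that witness has lower level and can be imposed; if none has, the condition
  settles the formula as it stands. Hence forcing reduces to truth in A for all enumerations in the
  condition, which a \<Pi> sentence can express. The bound 2 \<le> a leaves room for quantifier-free
  conditions.\<close>

abbreviation pair_code :: "nat \<Rightarrow> nat \<Rightarrow> nat"  ("\<langle>_,/ _\<rangle>") where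
  "\<langle>a, b\<rangle> \<equiv> prod_encode (a, b)"

definition p1 :: "nat \<Rightarrow> nat" where "p1 n = fst (prod_decode n)"
definition p2 :: "nat \<Rightarrow> nat" where "p2 n = snd (prod_decode n)"

lemma p1_pair [simp]: "p1 \<langle>a, b\<rangle> = a" and p2_pair [simp]: "p2 \<langle>a, b\<rangle> = b"
  by (simp_all add: p1_def p2_def)

lemma pair_p1_p2 [simp]: "\<langle>p1 n, p2 n\<rangle> = n"
  by (simp add: p1_def p2_def)

inductive_cases eval_ZeroE: "eval Zero n y"
inductive_cases eval_SuccE: "eval Succ n y"
inductive_cases eval_FstE: "eval Fst n y"
inductive_cases eval_SndE: "eval Snd n y"
inductive_cases eval_PairE: "eval (Pair p q) n y"
inductive_cases eval_CompE: "eval (Comp p q) n y"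
inductive_cases eval_PrecE: "eval (Prec p q) n y"
inductive_cases eval_MuE: "eval (Mu p) n y"

lemma eval_unique: "eval p n y \<Longrightarrow> eval p n z \<Longrightarrow> y = z"
proof (induction arbitrary: z rule: eval.induct)
  case (9 p x n)
  from \<open>eval (Mu p) x z\<close> have z: "eval p \<langle>x, z\<rangle> 0" "\<forall>m<z. \<exists>y. eval p \<langle>x, m\<rangle> (Suc y)"
    by (auto elim: eval_MuE)
  show ?case
  proof (rule linorder_cases[of n z])
    assume "n < z"
    then show ?thesis using z 9 by (metis nat.distinct(1))
  next
    assume "z < n"
    then show ?thesis using z 9 by (metis nat.distinct(1))
  qed
next
  case (5 p n y q z z')
  from 5(5) show ?case by (rule eval_PairE) (use 5(3,4) in auto)
next
  case (6 q n y p z z')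
  from 6(5) show ?case by (rule eval_CompE) (use 6(3,4) in auto)
next
  case (7 p x y q z)
  from 7(3) show ?case by (rule eval_PrecE) (use 7(2) in auto)
next
  case (8 p q x n y z z')
  from 8(5) show ?case by (rule eval_PrecE) (use 8(3,4) in auto)
qed (auto elim: eval_ZeroE eval_SuccE eval_FstE eval_SndE)

lemma computable_fun_iff: "computable_fun f \<longleftrightarrow> (\<exists>p. \<forall>n. eval p n (f n))"
  unfolding computable_fun_def phi_def by (metis prog_code_inject)

named_theorems comp

lemma computable_funI: "(\<And>n. eval p n (f n)) \<Longrightarrow> computable_fun f"
  unfolding computable_fun_iff by blast

lemma computable_id [comp]: "computable_fun (\<lambda>n. n)"
proof (rule computable_funI)
  show "eval (Pair Fst Snd) n n" for n
    using eval.intros(5)[OF eval.intros(3)[of "p1 n" "p2 n"] eval.intros(4)] by simp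
qed

lemma computable_compose:
  assumes "computable_fun f" "computable_fun g"
  shows "computable_fun (\<lambda>n. f (g n))"
proof -
  from assms obtain p q where "\<And>n. eval p n (f n)" "\<And>n. eval q n (g n)"
    unfolding computable_fun_iff by blast
  then have "eval (Comp p q) n (f (g n))" for n
    by (auto intro: eval.intros(6))
  then show ?thesis by (rule computable_funI)
qed

lemma computable_pair [comp]:
  assumes "computable_fun f" "computable_fun g"
  shows "computable_fun (\<lambda>n. \<langle>f n, g n\<rangle>)"
proof -
  from assms obtain p q where "\<And>n. eval p n (f n)" "\<And>n. eval q n (g n)"
    unfolding computable_fun_iff by blast
  then have "eval (Pair p q) n \<langle>f n, g n\<rangle>" for n
    by (auto intro: eval.intros(5))
  then show ?thesis by (rule computable_funI)
qed

lemma computable_p1 [comp]: "computable_fun f \<Longrightarrow> computable_fun (\<lambda>n. p1 (f n))"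
proof (rule computable_compose[of p1])
  show "computable_fun p1"
    by (rule computable_funI) (use eval.intros(3)[of "p1 n" "p2 n" for n] in simp)
qed

lemma computable_p2 [comp]: "computable_fun f \<Longrightarrow> computable_fun (\<lambda>n. p2 (f n))"
proof (rule computable_compose[of p2])
  show "computable_fun p2"
    by (rule computable_funI) (use eval.intros(4)[of "p1 n" "p2 n" for n] in simp)
qed

lemma computable_Suc [comp]: "computable_fun f \<Longrightarrow> computable_fun (\<lambda>n. Suc (f n))"
  by (rule computable_compose[of Suc, OF computable_funI[OF eval.intros(2)]])

lemma computable_const [comp]: "computable_fun (\<lambda>n. k)"
proof (induction k)
  case 0 show ?case by (rule computable_funI[OF eval.intros(1)])
qed (rule computable_Suc)

lemma computable_rec_aux:
  assumes "computable_fun g" "computable_fun h"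
  shows "computable_fun (\<lambda>n. rec_nat (g (p1 n)) (\<lambda>i r. h \<langle>p1 n, \<langle>i, r\<rangle>\<rangle>) (p2 n))"
proof -
  obtain p q where p: "\<And>n. eval p n (g n)" and q: "\<And>n. eval q n (h n)"
    using assms unfolding computable_fun_iff by blast
  have "eval (Prec p q) \<langle>x, k\<rangle> (rec_nat (g x) (\<lambda>i r. h \<langle>x, \<langle>i, r\<rangle>\<rangle>) k)" for x k
    by (induction k) (auto intro: eval.intros(7,8) p q)
  from this[of "p1 n" "p2 n" for n] show ?thesis by (intro computable_funI) simp
qed

text \<open>The whole input \<open>n\<close> is kept as the parameter of the recursion, so that
  base, step and number of rounds may all depend on it.\<close>

lemma computable_rec [comp]:
  assumes "computable_fun g" "computable_fun (\<lambda>z. h (p1 z) (p1 (p2 z)) (p2 (p2 z)))" "computable_fun k"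
  shows "computable_fun (\<lambda>n. rec_nat (g n) (h n) (k n))"
  using computable_compose[OF computable_rec_aux[OF assms(1,2)] computable_pair[OF computable_id assms(3)]]
  by simp

lemma computable_2:
  assumes "computable_fun (\<lambda>z. F (p1 z) (p2 z))" "computable_fun f" "computable_fun g"
  shows "computable_fun (\<lambda>n. F (f n) (g n))"
  using computable_compose[OF assms(1) computable_pair[OF assms(2,3)]] by simp

lemma computable_3:
  assumes "computable_fun (\<lambda>z. F (p1 z) (p1 (p2 z)) (p2 (p2 z)))"
    "computable_fun f" "computable_fun g" "computable_fun h"
  shows "computable_fun (\<lambda>n. F (f n) (g n) (h n))"
  using computable_compose[OF assms(1) computable_pair[OF assms(2) computable_pair[OF assms(3,4)]]]
  by simp

lemma computable_eqI: "computable_fun g \<Longrightarrow> (\<And>n. f n = g n) \<Longrightarrow> computable_fun f"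
  by (metis ext)

lemma computable_pred [comp]:
  assumes "computable_fun f"
  shows "computable_fun (\<lambda>n. f n - Suc 0)"
proof (rule computable_eqI)
  show "computable_fun (\<lambda>n. rec_nat 0 (\<lambda>i r. i) (f n))"
    by (intro comp assms)
  show "f n - Suc 0 = rec_nat 0 (\<lambda>i r. i) (f n)" for n
    by (cases "f n") auto
qed

lemma computable_diff [comp]:
  assumes "computable_fun f" "computable_fun g"
  shows "computable_fun (\<lambda>n. f n - g n)"
proof (rule computable_eqI)
  show "computable_fun (\<lambda>n. rec_nat (f n) (\<lambda>i r. r - Suc 0) (g n))"
    by (intro comp assms)
  show "f n - g n = rec_nat (f n) (\<lambda>i r. r - Suc 0) (g n)" for n
    proof -
      have "a - b = rec_nat a (\<lambda>i r. r - Suc 0) b" for a b :: nat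
      proof (induction b)
        case (Suc b)
        have "a - Suc b = a - b - Suc 0" by arith
        then show ?case unfolding Suc.IH by simp
      qed simp
      then show ?thesis .
    qed
qed

lemma computable_plus [comp]:
  assumes "computable_fun f" "computable_fun g"
  shows "computable_fun (\<lambda>n. f n + g n)"
proof (rule computable_eqI)
  show "computable_fun (\<lambda>n. rec_nat (f n) (\<lambda>i r. Suc r) (g n))"
    by (intro comp assms)
  show "f n + g n = rec_nat (f n) (\<lambda>i r. Suc r) (g n)" for n
    proof -
      have "a + b = rec_nat a (\<lambda>i r. Suc r) b" for a b :: nat by (induction b) auto
      then show ?thesis .
    qed
qed

lemma computable_times [comp]:
  assumes "computable_fun f" "computable_fun g"
  shows "computable_fun (\<lambda>n. f n * g n)"
proof (rule computable_eqI)
  show "computable_fun (\<lambda>n. rec_nat 0 (\<lambda>i r. f n + r) (g n))"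
    by (intro comp assms(2) computable_compose[OF assms(1)])
  show "f n * g n = rec_nat 0 (\<lambda>i r. f n + r) (g n)" for n
    proof -
      have "a * b = rec_nat 0 (\<lambda>i r. a + r) b" for a b :: nat by (induction b) auto
      then show ?thesis .
    qed
qed

lemma computable_power [comp]:
  assumes "computable_fun f" "computable_fun g"
  shows "computable_fun (\<lambda>n. f n ^ g n)"
proof (rule computable_eqI)
  show "computable_fun (\<lambda>n. rec_nat 1 (\<lambda>i r. f n * r) (g n))"
    by (intro comp assms(2) computable_compose[OF assms(1)])
  show "f n ^ g n = rec_nat 1 (\<lambda>i r. f n * r) (g n)" for n
    proof -
      have "a ^ b = rec_nat 1 (\<lambda>i r. a * r) b" for a b :: nat by (induction b) auto
      then show ?thesis .
    qed
qed

section \<open>Decidable predicates\<close>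

definition dec :: "(nat \<Rightarrow> bool) \<Rightarrow> bool" where
  "dec P \<longleftrightarrow> computable_fun (\<lambda>n. of_bool (P n))"

lemma computable_if [comp]:
  assumes "dec P" "computable_fun f" "computable_fun g"
  shows "computable_fun (\<lambda>n. if P n then f n else g n)"
proof (rule computable_eqI)
  \<comment> \<open>A recursion of zero or one rounds; the round, if made, discards the base
    value.\<close>
  show "computable_fun (\<lambda>n. rec_nat (g n) (\<lambda>i r. f n) (of_bool (P n)))"
    by (intro comp assms(3) assms(1)[unfolded dec_def] computable_compose[OF assms(2)])
  show "(if P n then f n else g n) = rec_nat (g n) (\<lambda>i r. f n) (of_bool (P n))" for n
    by simp
qed

lemma dec_eq_0:
  assumes "computable_fun f"
  shows "dec (\<lambda>n. f n = 0)"
  unfolding dec_def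
proof (rule computable_eqI)
  show "computable_fun (\<lambda>n. rec_nat 1 (\<lambda>i r. 0) (f n))"
    by (intro comp assms)
  show "of_bool (f n = 0) = rec_nat 1 (\<lambda>i r. 0) (f n)" for n
    by (cases "f n") auto
qed

lemma dec_not [comp]: "dec P \<Longrightarrow> dec (\<lambda>n. \<not> P n)"
  using dec_eq_0[of "\<lambda>n. of_bool (P n)"] unfolding dec_def by simp

lemma dec_conj [comp]: "dec P \<Longrightarrow> dec Q \<Longrightarrow> dec (\<lambda>n. P n \<and> Q n)"
  using computable_times[of "\<lambda>n. of_bool (P n)" "\<lambda>n. of_bool (Q n)"] unfolding dec_def
  by (simp add: of_bool_conj)

lemma dec_disj [comp]: "dec P \<Longrightarrow> dec Q \<Longrightarrow> dec (\<lambda>n. P n \<or> Q n)"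
  using dec_not[OF dec_conj[OF dec_not dec_not], of P Q] by simp

lemma dec_le [comp]: "computable_fun f \<Longrightarrow> computable_fun g \<Longrightarrow> dec (\<lambda>n. f n \<le> g n)"
  using dec_eq_0[OF computable_diff, of f g] by simp

lemma dec_eq [comp]: "computable_fun f \<Longrightarrow> computable_fun g \<Longrightarrow> dec (\<lambda>n. f n = g n)"
  using dec_conj[OF dec_le dec_le, of f g g f] by (simp add: order_eq_iff)

lemma dec_compose: "dec P \<Longrightarrow> computable_fun f \<Longrightarrow> dec (\<lambda>n. P (f n))"
  unfolding dec_def using computable_compose[of "\<lambda>n. of_bool (P n)" f] by simp

subsection \<open>Coded lists\<close>

definition computable_list :: "(nat \<Rightarrow> nat list) \<Rightarrow> bool" where
  "computable_list f \<longleftrightarrow> computable_fun (\<lambda>n. list_encode (f n))"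

lemma computable_list_encode [comp]:
  "computable_list f \<Longrightarrow> computable_fun (\<lambda>n. list_encode (f n))"
  by (simp add: computable_list_def)

lemma computable_list_decode [comp]:
  "computable_fun f \<Longrightarrow> computable_list (\<lambda>n. list_decode (f n))"
  by (simp add: computable_list_def)

lemma computable_list_const [comp]: "computable_list (\<lambda>n. xs)"
  unfolding computable_list_def by (rule computable_const)

lemma computable_list_Cons [comp]:
  "computable_fun f \<Longrightarrow> computable_list g \<Longrightarrow> computable_list (\<lambda>n. f n # g n)"
  unfolding computable_list_def list_encode.simps by (intro computable_Suc computable_pair)

lemma length_le_list_encode: "length xs \<le> list_encode xs"
proof (induction xs)
  case (Cons x xs)
  then show ?case using le_prod_encode_2[of "list_encode xs" x] by simp
qed simp

text \<open>Makes \<open>Suc (list_encode ys)\<close> a variable beyond all those in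
  \<open>ys\<close>; fresh variables start there.\<close>

lemma mem_less_list_encode: "x \<in> set xs \<Longrightarrow> x < list_encode xs"
proof (induction xs)
  case (Cons y xs)
  then show ?case
    using le_prod_encode_2[of "list_encode xs" y] le_prod_encode_1[of y "list_encode xs"]
    by (auto simp: less_Suc_eq_le)
qed simp

text \<open>A loop whose state pairs the code of the remaining list with the accumulator. Since
  \<open>0\<close> codes the empty list and the step then leaves the state alone, too many rounds do
  no harm, and the code of the list is a large enough number of them.\<close>

lemma computable_foldl [comp]:
  assumes f: "computable_fun (\<lambda>z. f (p1 z) (p1 (p2 z)) (p2 (p2 z)))"
    and i: "computable_fun i" and l: "computable_list l"
  shows "computable_fun (\<lambda>n. foldl (f n) (i n) (l n))"
proof -
  define st where "st n s = (if p1 s = 0 then s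
    else \<langle>p2 (p1 s - 1), f n (p2 s) (p1 (p1 s - 1))\<rangle>)" for n s
  have iter: "rec_nat \<langle>list_encode xs, a\<rangle> (\<lambda>_. st n) k = \<langle>0, foldl (f n) a xs\<rangle>"
    if "length xs \<le> k" for n xs a k
    using that
  proof (induction xs arbitrary: a k)
    case Nil
    show ?case by (induction k) (auto simp: st_def)
  next
    case (Cons x xs)
    then obtain k' where k: "k = Suc k'" by (cases k) auto
    have shift: "rec_nat s (\<lambda>_. st n) (Suc m) = rec_nat (st n s) (\<lambda>_. st n) m" for s m
      by (induction m) auto
    have "st n \<langle>list_encode (x # xs), a\<rangle> = \<langle>list_encode xs, f n a x\<rangle>" by (simp add: st_def)
    then show ?case using Cons.IH[of k' "f n a x"] Cons.prems unfolding k shift by simp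
  qed
  have c: "computable_fun (\<lambda>n. p2 (rec_nat \<langle>list_encode (l n), i n\<rangle> (\<lambda>_. st n) (list_encode (l n))))"
    unfolding st_def
    by (intro comp i l computable_3[OF f])
  then show ?thesis by (simp add: iter[OF length_le_list_encode])
qed

lemma computable_list_foldl [comp]:
  assumes "computable_list (\<lambda>z. f (p1 z) (list_decode (p1 (p2 z))) (p2 (p2 z)))"
    and "computable_list i" and "computable_list l"
  shows "computable_list (\<lambda>n. foldl (f n) (i n) (l n))"
  unfolding computable_list_def
proof (rule computable_eqI)
  show "computable_fun (\<lambda>n. foldl (\<lambda>a x. list_encode (f n (list_decode a) x)) (list_encode (i n)) (l n))"
    by (intro comp assms)
  have "list_encode (foldl g a xs) = foldl (\<lambda>a x. list_encode (g (list_decode a) x)) (list_encode a) xs"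
    for g a and xs :: "nat list"
    by (induction xs arbitrary: a) auto
  then show "list_encode (foldl (f n) (i n) (l n)) =
    foldl (\<lambda>a x. list_encode (f n (list_decode a) x)) (list_encode (i n)) (l n)" for n .
qed

lemma computable_list_eqI: "computable_list g \<Longrightarrow> (\<And>n. f n = g n) \<Longrightarrow> computable_list f"
  by (metis ext)

lemma foldl_Cons_eq: "foldl (\<lambda>a x. f x # a) acc xs = rev (map f xs) @ acc"
  by (induction xs arbitrary: acc) auto

lemma computable_list_rev [comp]:
  assumes "computable_list f"
  shows "computable_list (\<lambda>n. rev (f n))"
proof (rule computable_list_eqI)
  show "computable_list (\<lambda>n. foldl (\<lambda>a x. x # a) [] (f n))"
    by (intro comp assms)
qed (simp add: foldl_Cons_eq[of "\<lambda>x. x"])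

lemma computable_list_append [comp]:
  assumes "computable_list f" "computable_list g"
  shows "computable_list (\<lambda>n. f n @ g n)"
proof (rule computable_list_eqI)
  show "computable_list (\<lambda>n. foldl (\<lambda>a x. x # a) (g n) (rev (f n)))"
    by (intro comp assms)
qed (simp add: foldl_Cons_eq[of "\<lambda>x. x"])

lemma computable_list_map [comp]:
  assumes "computable_fun (\<lambda>z. h (p1 z) (p2 z))" "computable_list f"
  shows "computable_list (\<lambda>n. map (h n) (f n))"
proof (rule computable_list_eqI)
  show "computable_list (\<lambda>n. rev (foldl (\<lambda>a x. h n x # a) [] (f n)))"
    by (intro comp assms computable_2[OF assms(1)])
qed (simp add: foldl_Cons_eq)

lemma computable_length [comp]:
  assumes "computable_list f"
  shows "computable_fun (\<lambda>n. length (f n))"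
proof (rule computable_eqI)
  show "computable_fun (\<lambda>n. foldl (\<lambda>a x. Suc a) 0 (f n))"
    by (intro comp assms)
  have "foldl (\<lambda>a x. Suc a) k xs = k + length xs" for k and xs :: "nat list"
    by (induction xs arbitrary: k) auto
  then show "length (f n) = foldl (\<lambda>a x. Suc a) 0 (f n)" for n by simp
qed

lemma computable_list_upt [comp]:
  assumes "computable_fun f" "computable_fun g"
  shows "computable_list (\<lambda>n. [f n..<g n])"
proof (rule computable_list_eqI)
  have "computable_fun (\<lambda>n. rec_nat 0 (\<lambda>i r. Suc \<langle>f n + i, r\<rangle>) (g n - f n))"
    by (intro comp assms computable_compose[OF assms(1)])
  then show "computable_list (\<lambda>n. rev (list_decode (rec_nat 0 (\<lambda>i r. Suc \<langle>f n + i, r\<rangle>) (g n - f n))))"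
    by (intro computable_list_rev computable_list_decode)
  have "rec_nat 0 (\<lambda>i r. Suc \<langle>a + i, r\<rangle>) k = list_encode (rev [a..<a + k])" for a k
    by (induction k) auto
  then show "[f n..<g n] = rev (list_decode (rec_nat 0 (\<lambda>i r. Suc \<langle>f n + i, r\<rangle>) (g n - f n)))" for n
    by (cases "f n \<le> g n") auto
qed

lemma computable_list_drop [comp]:
  assumes "computable_fun f" "computable_list g"
  shows "computable_list (\<lambda>n. drop (f n) (g n))"
proof (rule computable_list_eqI)
  \<comment> \<open>The code of a nonempty list is the successor of the pair of its head and the
    code of its tail, so one round takes the tail.\<close>
  have "computable_fun (\<lambda>n. rec_nat (list_encode (g n)) (\<lambda>i r. if r = 0 then 0 else p2 (r - 1)) (f n))"
    by (intro comp assms)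
  then show "computable_list (\<lambda>n. list_decode (rec_nat (list_encode (g n)) (\<lambda>i r. if r = 0 then 0 else p2 (r - 1)) (f n)))"
    by (rule computable_list_decode)
  have "rec_nat (list_encode xs) (\<lambda>i r. if r = 0 then 0 else p2 (r - 1)) k = list_encode (drop k xs)" for xs k
  proof (induction k)
    case (Suc k)
    show ?case
    proof (cases "drop k xs")
      case (Cons y ys)
      then have "drop (Suc k) xs = ys" by (metis drop_Suc list.sel(3) tl_drop)
      with Cons Suc show ?thesis by simp
    next
      case Nil
      then have "drop (Suc k) xs = []" by simp
      with Nil Suc show ?thesis by simp
    qed
  qed simp
  then show "drop (f n) (g n) = list_decode (rec_nat (list_encode (g n)) (\<lambda>i r. if r = 0 then 0 else p2 (r - 1)) (f n))" for n
    by simp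
qed

text \<open>Total indexing, with value \<open>0\<close> beyond the end of the list.\<close>

definition nth0 :: "nat list \<Rightarrow> nat \<Rightarrow> nat" where
  "nth0 xs i = (if i < length xs then xs ! i else 0)"

lemma computable_nth0 [comp]:
  assumes "computable_list f" "computable_fun g"
  shows "computable_fun (\<lambda>n. nth0 (f n) (g n))"
proof (rule computable_eqI)
  show "computable_fun (\<lambda>n. p1 (list_encode (drop (g n) (f n)) - 1))"
    by (intro comp assms)
  \<comment> \<open>Beyond the end the code is \<open>0\<close>, truncated subtraction keeps it
    \<open>0\<close>, and its first projection is the default value of \<open>nth0\<close>.\<close>
  have "p1 0 = 0" by (metis le_prod_encode_1 le_zero_eq pair_p1_p2)
  then have "nth0 xs i = p1 (list_encode (drop i xs) - 1)" for xs i
    by (cases "i < length xs") (simp_all add: nth0_def Cons_nth_drop_Suc[symmetric])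
  then show "nth0 (f n) (g n) = p1 (list_encode (drop (g n) (f n)) - 1)" for n .
qed

text \<open>
  Course-of-values recursion: the third argument of \<open>F\<close> is the list of the earlier values,
  the most recent one first.
\<close>

lemma computable_course_of_values:
  assumes F: "computable_fun (\<lambda>z. F (p1 z) (p1 (p2 z)) (list_decode (p2 (p2 z))))"
    and f: "\<And>x n. f x n = F x n (map (f x) (rev [0..<n]))"
    and g: "computable_fun g" and h: "computable_fun h"
  shows "computable_fun (\<lambda>n. f (g n) (h n))"
proof (rule computable_eqI)
  define H where "H x n = rec_nat 0 (\<lambda>i r. Suc \<langle>F x i (list_decode r), r\<rangle>) n" for x n
  have H: "H x n = list_encode (map (f x) (rev [0..<n]))" for x n
    unfolding H_def by (induction n) (simp_all add: f[symmetric])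
  show "computable_fun (\<lambda>n. F (g n) (h n) (list_decode (H (g n) (h n))))"
    unfolding H_def
    by (intro comp g h computable_3[OF F] computable_compose[OF g] computable_compose[OF h])
  show "f (g n) (h n) = F (g n) (h n) (list_decode (H (g n) (h n)))" for n
    by (subst f) (simp add: H)
qed

text \<open>The history starts with the value at \<open>n - 1\<close>, hence the reversed
  position.\<close>

lemma nth0_history:
  "m < n \<Longrightarrow> nth0 (map f (rev [0..<n])) (n - Suc m) = f m"
  by (simp add: nth0_def rev_nth)

section \<open>A universal machine\<close>

text \<open>The machine below runs on every number, whereas \<open>phi e\<close> is empty unless
  \<open>e\<close> codes a program. This test separates the two cases.\<close>

definition is_code :: "nat \<Rightarrow> bool" where
  "is_code e \<longleftrightarrow> (\<exists>p. prog_code p = e)"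

text \<open>Turns recursion on programs into recursion on their codes, the form needed for deciding
  \<open>is_code\<close> by course-of-values recursion.\<close>

lemma is_code_unfold:
  "is_code e \<longleftrightarrow>
    (if p1 e \<le> 3 then p2 e = 0
     else if p1 e \<le> 6 then is_code (p1 (p2 e)) \<and> is_code (p2 (p2 e))
     else p1 e = 7 \<and> is_code (p2 e))" (is "_ \<longleftrightarrow> ?R")
proof
  assume "is_code e"
  then obtain p where "e = prog_code p" by (auto simp: is_code_def)
  then show ?R by (cases p) (auto simp: is_code_def)
next
  assume R: ?R
  obtain t c where e: "e = \<langle>t, c\<rangle>" by (metis pair_p1_p2)
  obtain c1 c2 where c: "c = \<langle>c1, c2\<rangle>" by (metis pair_p1_p2)
  consider "t = 0" | "t = 1" | "t = 2" | "t = 3" | "t = 4" | "t = 5" | "t = 6" | "t \<ge> 7" by linarith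
  then show "is_code e"
  proof cases
    case 5
    with R obtain p q where "prog_code p = c1" "prog_code q = c2" by (auto simp: e c is_code_def)
    then have "prog_code (Pair p q) = e" using 5 by (simp add: e c)
    then show ?thesis unfolding is_code_def by blast
  next
    case 6
    with R obtain p q where "prog_code p = c1" "prog_code q = c2" by (auto simp: e c is_code_def)
    then have "prog_code (Comp p q) = e" using 6 by (simp add: e c)
    then show ?thesis unfolding is_code_def by blast
  next
    case 7
    with R obtain p q where "prog_code p = c1" "prog_code q = c2" by (auto simp: e c is_code_def)
    then have "prog_code (Prec p q) = e" using 7 by (simp add: e c)
    then show ?thesis unfolding is_code_def by blast
  next
    case 8
    with R have t: "t = 7" and "is_code c" by (auto simp: e split: if_splits)
    then obtain p where "prog_code p = c" by (auto simp: is_code_def)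
    then have "prog_code (Mu p) = e" using t by (simp add: e)
    then show ?thesis unfolding is_code_def by blast
  qed (use R in \<open>auto simp: e is_code_def intro: exI[of _ Zero] exI[of _ Succ] exI[of _ Fst] exI[of _ Snd]\<close>)
qed

text \<open>The code of (m, n) is \<open>triangle (m + n) + m\<close>, which exceeds n once m is
  positive. Recursions on codes descend for this reason.\<close>

lemma p2_less: "p1 e \<noteq> 0 \<Longrightarrow> p2 e < e"
proof -
  assume "p1 e \<noteq> 0"
  moreover have "n < \<langle>m, n\<rangle>" if "m \<noteq> 0" for m n
  proof -
    have "k \<le> triangle k" for k by (induction k) auto
    from this[of "m + n"] that show ?thesis by (simp add: prod_encode_def)
  qed
  from this[of "p1 e" "p2 e"] calculation show ?thesis by simp
qed

lemma p1_le: "p1 e \<le> e" and p2_le: "p2 e \<le> e"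
  using le_prod_encode_1[of "p1 e" "p2 e"] le_prod_encode_2[of "p2 e" "p1 e"] by simp_all

lemma dec_is_code [comp]:
  assumes "computable_fun f"
  shows "dec (\<lambda>n. is_code (f n))"
proof -
  define h where "h n l m = nth0 l (n - Suc m)" for n l and m :: nat
  define F where "F x n l =
    (if p1 n \<le> 3 then of_bool (p2 n = 0)
     else if p1 n \<le> 6 then of_bool (h n l (p1 (p2 n)) = 1 \<and> h n l (p2 (p2 n)) = 1)
     else of_bool (p1 n = 7 \<and> h n l (p2 n) = 1) :: nat)" for x n :: nat and l
  have "computable_fun (\<lambda>n. of_bool (is_code (f n)))"
  proof (rule computable_course_of_values[where F = F and f = "\<lambda>x e. of_bool (is_code e)" and g = "\<lambda>n. 0"])
    show "computable_fun (\<lambda>z. F (p1 z) (p1 (p2 z)) (list_decode (p2 (p2 z))))"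
      unfolding F_def h_def by (intro comp dec_def[THEN iffD1])
    show "of_bool (is_code n) = F x n (map (\<lambda>e. of_bool (is_code e)) (rev [0..<n]))" for x n
    proof -
      have "p1 n > 3 \<Longrightarrow> p2 n < n" by (rule p2_less) simp
      then have "p1 n > 3 \<Longrightarrow> p1 (p2 n) < n" "p1 n > 3 \<Longrightarrow> p2 (p2 n) < n"
        using p1_le[of "p2 n"] p2_le[of "p2 n"] by linarith+
      with \<open>p1 n > 3 \<Longrightarrow> p2 n < n\<close> show ?thesis
        unfolding F_def h_def
        by (subst is_code_unfold) (auto simp: nth0_history)
    qed
  qed (intro comp assms)+
  then show ?thesis by (simp add: dec_def)
qed

text \<open>
  A stack machine. A state is either \<open>EV e n K\<close> (run the program coded by \<open>e\<close> on \<open>n\<close>) or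
  \<open>RT y K\<close> (return \<open>y\<close> to the topmost frame of \<open>K\<close>); a frame \<open>FR t x y z\<close> records with its
  tag \<open>t\<close> which part of which program is being evaluated.
\<close>

abbreviation EV :: "nat \<Rightarrow> nat \<Rightarrow> nat \<Rightarrow> nat" where "EV e n K \<equiv> \<langle>0, \<langle>e, \<langle>n, K\<rangle>\<rangle>\<rangle>"
abbreviation RT :: "nat \<Rightarrow> nat \<Rightarrow> nat" where "RT y K \<equiv> \<langle>Suc 0, \<langle>y, K\<rangle>\<rangle>"
abbreviation FR :: "nat \<Rightarrow> nat \<Rightarrow> nat \<Rightarrow> nat \<Rightarrow> nat \<Rightarrow> nat" where
  "FR t x y z K \<equiv> Suc \<langle>\<langle>t, \<langle>x, \<langle>y, z\<rangle>\<rangle>\<rangle>, K\<rangle>"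

definition ev_step :: "nat \<Rightarrow> nat \<Rightarrow> nat \<Rightarrow> nat" where
  "ev_step e n K = (let t = p1 e; c = p2 e in
     if t = 0 then RT 0 K
     else if t = Suc 0 then RT (Suc n) K
     else if t = 2 then RT (p1 n) K
     else if t = 3 then RT (p2 n) K
     else if t = 4 then EV (p1 c) n (FR 0 (p2 c) n 0 K)
     else if t = 5 then EV (p2 c) n (FR 2 (p1 c) 0 0 K)
     else if t = 6 then (if p2 n = 0 then EV (p1 c) (p1 n) K
       else EV e \<langle>p1 n, p2 n - 1\<rangle> (FR 3 (p2 c) (p1 n) (p2 n - 1) K))
     else EV c \<langle>n, 0\<rangle> (FR 4 c n 0 K))"

text \<open>Tag 0 waits for the first component of a pair, 1 for the second, 2 for the inner value
  of a composition, 3 for the preceding value of a primitive recursion, 4 for the current value of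
  an unbounded search. With the empty stack \<open>0\<close> the state is final and repeats
  itself.\<close>

definition rt_step :: "nat \<Rightarrow> nat \<Rightarrow> nat" where
  "rt_step v K0 = (if K0 = 0 then RT v K0 else
     let f = p1 (K0 - 1); K = p2 (K0 - 1); t = p1 f; x = p1 (p2 f); y = p1 (p2 (p2 f)); z = p2 (p2 (p2 f)) in
     if t = 0 then EV x y (FR (Suc 0) v 0 0 K)
     else if t = Suc 0 then RT \<langle>x, v\<rangle> K
     else if t = 2 then EV x v K
     else if t = 3 then EV x \<langle>y, \<langle>z, v\<rangle>\<rangle> K
     else if v = 0 then RT z K
     else EV x \<langle>y, Suc z\<rangle> (FR 4 x y (Suc z) K))"

definition machine_step :: "nat \<Rightarrow> nat" where
  "machine_step s = (if p1 s = 0 then ev_step (p1 (p2 s)) (p1 (p2 (p2 s))) (p2 (p2 (p2 s)))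
     else rt_step (p1 (p2 s)) (p2 (p2 s)))"

lemma computable_machine_step: "computable_fun machine_step"
  unfolding machine_step_def ev_step_def rt_step_def Let_def by (intro comp)

lemma machine_step_ev [simp]:
  "machine_step (EV (prog_code Zero) n K) = RT 0 K"
  "machine_step (EV (prog_code Succ) n K) = RT (Suc n) K"
  "machine_step (EV (prog_code Fst) n K) = RT (p1 n) K"
  "machine_step (EV (prog_code Snd) n K) = RT (p2 n) K"
  "machine_step (EV (prog_code (Pair p q)) n K) = EV (prog_code p) n (FR 0 (prog_code q) n 0 K)"
  "machine_step (EV (prog_code (Comp p q)) n K) = EV (prog_code q) n (FR 2 (prog_code p) 0 0 K)"
  "machine_step (EV (prog_code (Prec p q)) \<langle>x, 0\<rangle> K) = EV (prog_code p) x K"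
  "machine_step (EV (prog_code (Prec p q)) \<langle>x, Suc n\<rangle> K) =
     EV (prog_code (Prec p q)) \<langle>x, n\<rangle> (FR 3 (prog_code q) x n K)"
  "machine_step (EV (prog_code (Mu p)) n K) = EV (prog_code p) \<langle>n, 0\<rangle> (FR 4 (prog_code p) n 0 K)"
  by (simp_all add: machine_step_def ev_step_def Let_def)

lemma machine_step_rt [simp]:
  "machine_step (RT v 0) = RT v 0"
  "machine_step (RT v (FR 0 x y z K)) = EV x y (FR (Suc 0) v 0 0 K)"
  "machine_step (RT v (FR (Suc 0) x y z K)) = RT \<langle>x, v\<rangle> K"
  "machine_step (RT v (FR 2 x y z K)) = EV x v K"
  "machine_step (RT v (FR 3 x y z K)) = EV x \<langle>y, \<langle>z, v\<rangle>\<rangle> K"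
  "machine_step (RT 0 (FR 4 x y z K)) = RT z K"
  "machine_step (RT (Suc w) (FR 4 x y z K)) = EV x \<langle>y, Suc z\<rangle> (FR 4 x y (Suc z) K)"
  by (simp_all add: machine_step_def rt_step_def Let_def)

definition runs :: "nat \<Rightarrow> nat \<Rightarrow> bool" where
  "runs s t \<longleftrightarrow> (\<exists>k. (machine_step ^^ k) s = t)"

lemma runs_refl: "runs s s" unfolding runs_def by (metis funpow_0)
lemma runs_step: "runs (machine_step s) t \<Longrightarrow> runs s t"
  unfolding runs_def by (metis funpow_Suc_right o_apply)
lemma runs_trans: "runs s t \<Longrightarrow> runs t u \<Longrightarrow> runs s u"
  unfolding runs_def by (metis funpow_add o_apply)

section \<open>Correctness of the stack machine\<close>

text \<open>The stack is arbitrary because subprograms are run on top of pending frames.\<close>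

lemma eval_runs: "eval p n y \<Longrightarrow> runs (EV (prog_code p) n K) (RT y K)"
proof (induction arbitrary: K rule: eval.induct)
  case (5 p n y q z)
  show ?case
    by (rule runs_step, simp del: prog_code.simps, rule runs_trans[OF 5(3)], rule runs_step,
        simp del: prog_code.simps, rule runs_trans[OF 5(4)], rule runs_step, simp add: runs_refl)
next
  case (6 q n y p z)
  show ?case
    by (rule runs_step, simp del: prog_code.simps, rule runs_trans[OF 6(3)], rule runs_step,
        simp del: prog_code.simps, rule 6(4))
next
  case (7 p x y q)
  show ?case by (rule runs_step, simp del: prog_code.simps, rule 7(2))
next
  case (8 p q x n y z)
  show ?case
    by (rule runs_step, simp del: prog_code.simps, rule runs_trans[OF 8(3)], rule runs_step,
        simp del: prog_code.simps, rule 8(4))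
next
  case (9 p x n)
  \<comment> \<open>Backward induction from the value \<open>n\<close> of the search: started at any
    \<open>m \<le> n\<close>, the search ends at \<open>n\<close>.\<close>
  have "runs (EV (prog_code p) \<langle>x, m\<rangle> (FR 4 (prog_code p) x m K)) (RT n K)" if "m \<le> n" for m
    using that
  proof (induction m rule: inc_induct)
    case base
    show ?case
      by (rule runs_trans[OF 9(2)], rule runs_step, simp add: runs_refl)
  next
    case (step m)
    from 9(3) step(2) obtain y where "\<And>K. runs (EV (prog_code p) \<langle>x, m\<rangle> K) (RT (Suc y) K)" by blast
    then show ?case
      by (rule runs_trans, intro runs_step[of "RT _ _"]) (simp add: step.IH)
  qed
  from this[of 0] show ?case by (intro runs_step[of "EV _ _ _"]) (simp del: prog_code.simps)
qed (rule runs_step, simp add: runs_refl del: prog_code.simps)+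

text \<open>A run that halts with the empty stack must at some point have returned a value to
  \<open>K\<close>. Counting steps makes the remaining run strictly shorter, so that strong
  induction applies to the subprograms started from the frames.\<close>

lemma runs_eval:
  assumes "(machine_step ^^ k) (EV (prog_code p) n K) = RT v 0"
  shows "\<exists>y j. eval p n y \<and> j < k \<and> (machine_step ^^ j) (RT y K) = RT v 0"
  using assms
proof (induction k arbitrary: p n K rule: less_induct)
  case (less k)
  from less.prems obtain k' where k: "k = Suc k'" by (cases k) auto
  with less.prems have run: "(machine_step ^^ k') (machine_step (EV (prog_code p) n K)) = RT v 0"
    by (simp add: funpow_Suc_right del: funpow.simps)
  note IH = less.IH
  show ?case
  proof (cases p)
    case Zero
    then show ?thesis using run k by (auto intro: eval.intros simp del: prog_code.simps)
  next
    case Succ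
    then show ?thesis using run k by (auto intro: eval.intros simp del: prog_code.simps)
  next
    case Fst
    then show ?thesis using run k eval.intros(3)[of "p1 n" "p2 n"] by (auto simp del: prog_code.simps)
  next
    case Snd
    then show ?thesis using run k eval.intros(4)[of "p1 n" "p2 n"] by (auto simp del: prog_code.simps)
  next
    case (Pair q r)
    with run have "(machine_step ^^ k') (EV (prog_code q) n (FR 0 (prog_code r) n 0 K)) = RT v 0"
      by (simp del: prog_code.simps)
    from IH[OF _ this] k obtain y j where y: "eval q n y" and j: "j < k'"
      "(machine_step ^^ j) (RT y (FR 0 (prog_code r) n 0 K)) = RT v 0" by auto
    \<comment> \<open>The stack is nonempty, so the state is not yet final and at least one more
      step pops the frame.\<close>
    from j(2) obtain j' where j': "j = Suc j'" by (cases j) auto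
    with j(2) have "(machine_step ^^ j') (EV (prog_code r) n (FR (Suc 0) y 0 0 K)) = RT v 0"
      by (simp add: funpow_Suc_right del: funpow.simps)
    from IH[OF _ this] k j(1) j' obtain z i where z: "eval r n z" and i: "i < j'"
      "(machine_step ^^ i) (RT z (FR (Suc 0) y 0 0 K)) = RT v 0" by auto
    from i(2) obtain i' where i': "i = Suc i'" by (cases i) auto
    with i(2) have "(machine_step ^^ i') (RT \<langle>y, z\<rangle> K) = RT v 0"
      by (simp add: funpow_Suc_right del: funpow.simps)
    then show ?thesis using eval.intros(5)[OF y z] Pair k j(1) j' i(1) i'
      by (intro exI[of _ "\<langle>y, z\<rangle>"] exI[of _ i']) auto
  next
    case (Comp q r)
    with run have "(machine_step ^^ k') (EV (prog_code r) n (FR 2 (prog_code q) 0 0 K)) = RT v 0"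
      by (simp del: prog_code.simps)
    from IH[OF _ this] k obtain y j where y: "eval r n y" and j: "j < k'"
      "(machine_step ^^ j) (RT y (FR 2 (prog_code q) 0 0 K)) = RT v 0" by auto
    from j(2) obtain j' where j': "j = Suc j'" by (cases j) auto
    with j(2) have "(machine_step ^^ j') (EV (prog_code q) y K) = RT v 0"
      by (simp add: funpow_Suc_right del: funpow.simps)
    from IH[OF _ this] k j(1) j' obtain z i where z: "eval q y z" and i: "i < j'"
      "(machine_step ^^ i) (RT z K) = RT v 0" by auto
    then show ?thesis using eval.intros(6)[OF y z] Comp k j(1) j' i(1)
      by (intro exI[of _ z] exI[of _ i]) auto
  next
    case (Prec q r)
    obtain x m where n: "n = \<langle>x, m\<rangle>" by (metis pair_p1_p2)
    show ?thesis
    proof (cases m)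
      case 0
      with run Prec n have "(machine_step ^^ k') (EV (prog_code q) x K) = RT v 0"
        by (simp del: prog_code.simps)
      from IH[OF _ this] k obtain y j where y: "eval q x y" and j: "j < k'"
        "(machine_step ^^ j) (RT y K) = RT v 0" by auto
      then show ?thesis using eval.intros(7)[OF y] Prec n 0 k
        by (intro exI[of _ y] exI[of _ j]) auto
    next
      case (Suc m')
      with run Prec n have
        "(machine_step ^^ k') (EV (prog_code (Prec q r)) \<langle>x, m'\<rangle> (FR 3 (prog_code r) x m' K)) = RT v 0"
        by (simp del: prog_code.simps)
      from IH[OF _ this] k obtain y j where y: "eval (Prec q r) \<langle>x, m'\<rangle> y" and j: "j < k'"
        "(machine_step ^^ j) (RT y (FR 3 (prog_code r) x m' K)) = RT v 0" by auto
      from j(2) obtain j' where j': "j = Suc j'" by (cases j) auto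
      with j(2) have "(machine_step ^^ j') (EV (prog_code r) \<langle>x, \<langle>m', y\<rangle>\<rangle> K) = RT v 0"
        by (simp add: funpow_Suc_right del: funpow.simps)
      from IH[OF _ this] k j(1) j' obtain z i where z: "eval r \<langle>x, \<langle>m', y\<rangle>\<rangle> z" and i: "i < j'"
        "(machine_step ^^ i) (RT z K) = RT v 0" by auto
      then show ?thesis using eval.intros(8)[OF y z] Prec n Suc k j(1) j' i(1)
        by (intro exI[of _ z] exI[of _ i]) auto
    qed
  next
    case (Mu q)
    \<comment> \<open>An inner induction over the rounds of the search; \<open>k0 < k\<close> lets
      the outer hypothesis handle each single round.\<close>
    have search: "\<exists>N j. m \<le> N \<and> eval q \<langle>n, N\<rangle> 0 \<and> (\<forall>l\<in>{m..<N}. \<exists>y. eval q \<langle>n, l\<rangle> (Suc y)) \<and>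
        j < k0 \<and> (machine_step ^^ j) (RT N K) = RT v 0"
      if "k0 < k" "(machine_step ^^ k0) (EV (prog_code q) \<langle>n, m\<rangle> (FR 4 (prog_code q) n m K)) = RT v 0"
      for k0 m
      using that
    proof (induction k0 arbitrary: m rule: less_induct)
      case (less k0)
      from IH[OF less.prems] obtain y j where y: "eval q \<langle>n, m\<rangle> y" and j: "j < k0"
        "(machine_step ^^ j) (RT y (FR 4 (prog_code q) n m K)) = RT v 0" by auto
      from j(2) obtain j' where j': "j = Suc j'" by (cases j) auto
      show ?case
      proof (cases y)
        case 0
        with j(2) j' have "(machine_step ^^ j') (RT m K) = RT v 0"
          by (simp add: funpow_Suc_right del: funpow.simps)
        then show ?thesis using y 0 j(1) j' by (intro exI[of _ m] exI[of _ j']) auto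
      next
        case (Suc y')
        with j(2) j' have "(machine_step ^^ j') (EV (prog_code q) \<langle>n, Suc m\<rangle> (FR 4 (prog_code q) n (Suc m) K)) = RT v 0"
          by (simp add: funpow_Suc_right del: funpow.simps)
        from less.IH[OF _ _ this] j(1) j' less.prems(1) obtain N i where
          N: "Suc m \<le> N" "eval q \<langle>n, N\<rangle> 0" "\<forall>l\<in>{Suc m..<N}. \<exists>y. eval q \<langle>n, l\<rangle> (Suc y)"
            "i < j'" "(machine_step ^^ i) (RT N K) = RT v 0" by auto
        have "\<exists>y. eval q \<langle>n, l\<rangle> (Suc y)" if "l \<in> {m..<N}" for l
          using that N(3) y Suc by (cases "l = m") auto
        then show ?thesis using N j(1) j' by (intro exI[of _ N] exI[of _ i]) auto
      qed
    qed
    from Mu run have "(machine_step ^^ k') (EV (prog_code q) \<langle>n, 0\<rangle> (FR 4 (prog_code q) n 0 K)) = RT v 0"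
      by (simp del: prog_code.simps)
    from search[OF _ this] k obtain N j where N: "eval q \<langle>n, N\<rangle> 0"
      "\<forall>l\<in>{0..<N}. \<exists>y. eval q \<langle>n, l\<rangle> (Suc y)" "j < k'" "(machine_step ^^ j) (RT N K) = RT v 0" by auto
    then have "eval (Mu q) n N" by (intro eval.intros(9)) auto
    then show ?thesis using Mu N k by (intro exI[of _ N] exI[of _ j]) auto
  qed
qed

definition phi_within :: "nat \<Rightarrow> nat \<Rightarrow> nat \<Rightarrow> nat \<Rightarrow> bool" where
  "phi_within e n m s \<longleftrightarrow> is_code e \<and> rec_nat (EV e n 0) (\<lambda>_. machine_step) s = RT m 0"

text \<open>Kleene's normal form: the graph of the universal function is the projection of a
  decidable relation.\<close>

lemma phi_iff_within: "phi e n m \<longleftrightarrow> (\<exists>s. phi_within e n m s)"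
proof -
  have rec: "rec_nat s (\<lambda>_. machine_step) k = (machine_step ^^ k) s" for s k
    by (induction k) auto
  have "runs (EV (prog_code p) n 0) (RT m 0) \<longleftrightarrow> eval p n m" for p
  proof
    assume "runs (EV (prog_code p) n 0) (RT m 0)"
    then obtain k where "(machine_step ^^ k) (EV (prog_code p) n 0) = RT m 0" by (auto simp: runs_def)
    from runs_eval[OF this] obtain y j where "eval p n y" "(machine_step ^^ j) (RT y 0) = RT m 0" by auto
    moreover have "(machine_step ^^ j) (RT y 0) = RT y 0" for j by (induction j) auto
    ultimately show "eval p n m" by simp
  qed (rule eval_runs)
  then show ?thesis unfolding phi_def phi_within_def is_code_def rec runs_def by metis
qed

lemma dec_phi_within [comp]:
  assumes "computable_fun e" "computable_fun n" "computable_fun m" "computable_fun s"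
  shows "dec (\<lambda>x. phi_within (e x) (n x) (m x) (s x))"
  unfolding phi_within_def
  by (intro comp assms computable_compose[OF computable_machine_step])

section \<open>Computably enumerable predicates\<close>

text \<open>The projection form of enumerability: closure under conjunction, disjunction and
  existential quantification is mere pairing of witnesses. \<open>ce_imp_W\<close> converts it to
  c.e. indices.\<close>

definition ce :: "(nat \<Rightarrow> bool) \<Rightarrow> bool" where
  "ce P \<longleftrightarrow> (\<exists>Q. dec (\<lambda>z. Q (p1 z) (p2 z)) \<and> (\<forall>n. P n \<longleftrightarrow> (\<exists>s. Q n s)))"

named_theorems ce

lemma ceI: "dec (\<lambda>z. Q (p1 z) (p2 z)) \<Longrightarrow> (\<And>n. P n \<longleftrightarrow> (\<exists>s. Q n s)) \<Longrightarrow> ce P"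
  unfolding ce_def by blast

lemma dec_2:
  assumes "dec (\<lambda>z. Q (p1 z) (p2 z))" "computable_fun f" "computable_fun g"
  shows "dec (\<lambda>n. Q (f n) (g n))"
  using dec_compose[OF assms(1) computable_pair[OF assms(2,3)]] by simp

lemma ce_dec: "dec P \<Longrightarrow> ce P"
  by (rule ceI[of "\<lambda>n s. P n"]) (simp_all add: dec_compose[of P] computable_p1 computable_id)

lemma ce_compose:
  assumes "ce P" "computable_fun f"
  shows "ce (\<lambda>n. P (f n))"
proof -
  obtain Q where Q: "dec (\<lambda>z. Q (p1 z) (p2 z))" "\<And>n. P n \<longleftrightarrow> (\<exists>s. Q n s)"
    using assms(1) unfolding ce_def by blast
  show ?thesis
    by (rule ceI[of "\<lambda>n s. Q (f n) s"])
      (intro dec_2[OF Q(1)] comp computable_compose[OF assms(2)], simp add: Q(2))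
qed

lemma ce_conj [ce]:
  assumes "ce P" "ce Q"
  shows "ce (\<lambda>n. P n \<and> Q n)"
proof -
  obtain P' where P': "dec (\<lambda>z. P' (p1 z) (p2 z))" "\<And>n. P n \<longleftrightarrow> (\<exists>s. P' n s)"
    using assms(1) unfolding ce_def by blast
  obtain Q' where Q': "dec (\<lambda>z. Q' (p1 z) (p2 z))" "\<And>n. Q n \<longleftrightarrow> (\<exists>s. Q' n s)"
    using assms(2) unfolding ce_def by blast
  show ?thesis
  proof (rule ceI[of "\<lambda>n s. P' n (p1 s) \<and> Q' n (p2 s)"])
    show "(P n \<and> Q n) = (\<exists>s. P' n (p1 s) \<and> Q' n (p2 s))" for n
      unfolding P'(2) Q'(2) by (metis p1_pair p2_pair)
  qed (intro dec_2[OF P'(1)] dec_2[OF Q'(1)] comp)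
qed

lemma ce_disj [ce]:
  assumes "ce P" "ce Q"
  shows "ce (\<lambda>n. P n \<or> Q n)"
proof -
  obtain P' where P': "dec (\<lambda>z. P' (p1 z) (p2 z))" "\<And>n. P n \<longleftrightarrow> (\<exists>s. P' n s)"
    using assms(1) unfolding ce_def by blast
  obtain Q' where Q': "dec (\<lambda>z. Q' (p1 z) (p2 z))" "\<And>n. Q n \<longleftrightarrow> (\<exists>s. Q' n s)"
    using assms(2) unfolding ce_def by blast
  show ?thesis
    by (rule ceI[of "\<lambda>n s. P' n s \<or> Q' n s"])
      (intro dec_2[OF P'(1)] dec_2[OF Q'(1)] comp, auto simp: P'(2) Q'(2))
qed

lemma ce_ex [ce]:
  assumes "ce (\<lambda>z. P (p1 z) (p2 z))"
  shows "ce (\<lambda>n. \<exists>x. P n x)"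
proof -
  obtain Q where Q: "dec (\<lambda>z. Q (p1 z) (p2 z))" "\<And>n. P (p1 n) (p2 n) \<longleftrightarrow> (\<exists>s. Q n s)"
    using assms(1) unfolding ce_def by blast
  show ?thesis
  proof (rule ceI[of "\<lambda>n s. Q \<langle>n, p1 s\<rangle> (p2 s)"])
    show "(\<exists>x. P n x) = (\<exists>s. Q \<langle>n, p1 s\<rangle> (p2 s))" for n
      using Q(2)[of "\<langle>n, _\<rangle>"] by (metis p1_pair p2_pair)
  qed (intro dec_2[OF Q(1)] comp)
qed

lemma ce_phi [ce]:
  assumes "computable_fun e" "computable_fun n" "computable_fun m"
  shows "ce (\<lambda>x. phi (e x) (n x) (m x))"
  by (rule ceI[of "\<lambda>x s. phi_within (e x) (n x) (m x) s"])
    (intro comp computable_compose[OF assms(1)] computable_compose[OF assms(2)]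
      computable_compose[OF assms(3)], simp add: phi_iff_within)

lemma ce_W [ce]:
  assumes "computable_fun e" "computable_fun n"
  shows "ce (\<lambda>x. n x \<in> W (e x))"
  unfolding W_def mem_Collect_eq
  by (intro ce comp computable_compose[OF assms(1)] computable_compose[OF assms(2)])

text \<open>An unbounded search for a witness halts exactly when there is one.\<close>

lemma ce_imp_W:
  assumes "ce P"
  shows "\<exists>e. \<forall>n. n \<in> W e \<longleftrightarrow> P n"
proof -
  obtain Q where Q: "dec (\<lambda>z. Q (p1 z) (p2 z))" "\<And>n. P n \<longleftrightarrow> (\<exists>s. Q n s)"
    using assms(1) unfolding ce_def by blast
  \<comment> \<open>\<open>Mu\<close> searches for the value \<open>0\<close>, so the characteristic
    function is negated.\<close>
  from dec_not[OF Q(1)] obtain p where p: "\<And>z. eval p z (of_bool (\<not> Q (p1 z) (p2 z)))"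
    unfolding dec_def computable_fun_iff by blast
  have "(\<exists>m. eval (Mu p) n m) \<longleftrightarrow> P n" for n
  proof
    assume "\<exists>m. eval (Mu p) n m"
    then obtain m where "eval p \<langle>n, m\<rangle> 0" by (auto elim: eval_MuE)
    with p[of "\<langle>n, m\<rangle>"] have "of_bool (\<not> Q n m) = (0::nat)" using eval_unique by fastforce
    then show "P n" unfolding Q(2) by (auto split: if_splits)
  next
    assume "P n"
    then have ex: "\<exists>s. Q n s" by (simp add: Q(2))
    define s where "s = (LEAST s. Q n s)"
    have s: "Q n s" "\<And>t. t < s \<Longrightarrow> \<not> Q n t"
      unfolding s_def using LeastI_ex[OF ex] not_less_Least by blast+
    have "eval (Mu p) n s"
    proof (rule eval.intros(9))
      show "eval p \<langle>n, s\<rangle> 0" using p[of "\<langle>n, s\<rangle>"] s(1) by simp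
      show "\<forall>m<s. \<exists>y. eval p \<langle>n, m\<rangle> (Suc y)" using p[of "\<langle>n, _\<rangle>"] s(2) by (metis One_nat_def of_bool_eq(2) p1_pair p2_pair)
    qed
    then show "\<exists>m. eval (Mu p) n m" ..
  qed
  then have "n \<in> W (prog_code (Mu p)) \<longleftrightarrow> P n" for n
    unfolding W_def phi_def mem_Collect_eq prog_code_inject by blast
  then show ?thesis by blast
qed

section \<open>The s-m-n function and the recursion theorem\<close>

definition const_code :: "nat \<Rightarrow> nat" where
  "const_code k = rec_nat (prog_code Zero) (\<lambda>i r. \<langle>5, \<langle>prog_code Succ, r\<rangle>\<rangle>) k"

text \<open>The code of \<open>Comp t (Pair c (Pair Fst Snd))\<close> with \<open>c\<close> the
  constant program for \<open>z\<close>; 5 and 4 are the tags of \<open>Comp\<close> and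
  \<open>Pair\<close>, and \<open>Pair Fst Snd\<close> is the identity.\<close>

definition smn :: "nat \<Rightarrow> nat \<Rightarrow> nat" where
  "smn t z = \<langle>5, \<langle>t, \<langle>4, \<langle>const_code z, prog_code (Pair Fst Snd)\<rangle>\<rangle>\<rangle>\<rangle>"

lemma computable_smn [comp]:
  assumes "computable_fun f" "computable_fun g"
  shows "computable_fun (\<lambda>n. smn (f n) (g n))"
  unfolding smn_def const_code_def by (intro comp assms)

text \<open>Covers also a \<open>t\<close> that codes no program: then \<open>smn t z\<close> codes
  none either, and both sides are false.\<close>

lemma W_smn: "n \<in> W (smn t z) \<longleftrightarrow> \<langle>z, n\<rangle> \<in> W t"
proof -
  have "\<exists>c. prog_code c = const_code k \<and> (\<forall>n. eval c n k)" for k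
  proof (induction k)
    case 0
    show ?case by (rule exI[of _ Zero]) (auto simp: const_code_def intro: eval.intros)
  next
    case (Suc k)
    then obtain c where "prog_code c = const_code k" "\<forall>n. eval c n k" by blast
    then show ?case
      by (intro exI[of _ "Comp Succ c"]) (auto simp: const_code_def intro: eval.intros)
  qed
  then obtain c where c: "prog_code c = const_code z" "\<And>n. eval c n z" by blast
  have id: "eval (Pair Fst Snd) n n" for n
    using eval.intros(5)[OF eval.intros(3)[of "p1 n" "p2 n"] eval.intros(4)] by simp
  define q where "q = Pair c (Pair Fst Snd)"
  have q: "eval q n \<langle>z, n\<rangle>" for n
    unfolding q_def by (intro eval.intros(5) c id)
  have code: "smn t z = \<langle>5, \<langle>t, prog_code q\<rangle>\<rangle>"
    by (simp add: smn_def q_def c)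
  show ?thesis
  proof
    assume "n \<in> W (smn t z)"
    then obtain p m where p: "prog_code p = \<langle>5, \<langle>t, prog_code q\<rangle>\<rangle>" "eval p n m"
      by (auto simp: W_def phi_def code)
    then obtain r where r: "p = Comp r q" "prog_code r = t"
      by (cases p) (auto simp: prog_code_inject)
    with p q show "\<langle>z, n\<rangle> \<in> W t"
      by (auto simp: W_def phi_def elim!: eval_CompE dest: eval_unique[OF q])
  next
    assume "\<langle>z, n\<rangle> \<in> W t"
    then obtain r m where r: "prog_code r = t" "eval r \<langle>z, n\<rangle> m" by (auto simp: W_def phi_def)
    then have "eval (Comp r q) n m" using q by (auto intro: eval.intros)
    moreover have "prog_code (Comp r q) = smn t z" by (simp add: code r)
    ultimately show "n \<in> W (smn t z)" unfolding W_def phi_def by blast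
  qed
qed

text \<open>
  The fixed point is \<open>smn e e\<close>, where \<open>e\<close> enumerates \<open>R\<close> with \<open>smn t t\<close> in place of \<open>t\<close>.
\<close>

lemma recursion_theorem:
  assumes "ce (\<lambda>x. R (p1 x) (p1 (p2 x)) (p2 (p2 x)))"
  shows "\<exists>t. \<forall>z n. n \<in> W (smn t z) \<longleftrightarrow> R t z n"
proof -
  have "ce (\<lambda>x. R (smn (p1 x) (p1 x)) (p1 (p2 x)) (p2 (p2 x)))"
    using ce_compose[OF assms, of "\<lambda>x. \<langle>smn (p1 x) (p1 x), p2 x\<rangle>"]
    by (simp add: computable_pair computable_smn computable_p1 computable_p2 computable_id)
  from ce_imp_W[OF this] obtain e where
    e: "\<And>x. x \<in> W e \<longleftrightarrow> R (smn (p1 x) (p1 x)) (p1 (p2 x)) (p2 (p2 x))" by blast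
  have "n \<in> W (smn (smn e e) z) \<longleftrightarrow> R (smn e e) z n" for z n
    by (simp add: W_smn e)
  then show ?thesis by blast
qed

section \<open>Renaming variables in terms and quantifier-free formulas\<close>

primrec tm_ren :: "(nat \<Rightarrow> nat) \<Rightarrow> tm \<Rightarrow> tm" where
  "tm_ren r (Var x) = Var (r x)"
| "tm_ren r (Fn f ts) = Fn f (map (tm_ren r) ts)"

primrec qf_ren :: "(nat \<Rightarrow> nat) \<Rightarrow> qf \<Rightarrow> qf" where
  "qf_ren r Verum = Verum"
| "qf_ren r (Rel R ts) = Rel R (map (tm_ren r) ts)"
| "qf_ren r (Eq s t) = Eq (tm_ren r s) (tm_ren r t)"
| "qf_ren r (QNeg \<phi>) = QNeg (qf_ren r \<phi>)"
| "qf_ren r (QAnd \<phi> \<psi>) = QAnd (qf_ren r \<phi>) (qf_ren r \<psi>)"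
| "qf_ren r (QOr \<phi> \<psi>) = QOr (qf_ren r \<phi>) (qf_ren r \<psi>)"

lemma tm_val_ren: "(\<And>x. x \<in> tm_fv t \<Longrightarrow> v (r x) = w x) \<Longrightarrow> tm_val A v (tm_ren r t) = tm_val A w t"
proof (induction t)
  case (Fn f ts)
  then have "map (tm_val A v \<circ> tm_ren r) ts = map (tm_val A w) ts" by (intro map_cong) auto
  then show ?case by (simp only: tm_ren.simps tm_val.simps map_map)
qed simp

lemma tm_fv_ren: "tm_fv (tm_ren r t) = r ` tm_fv t"
  by (induction t) auto

lemma tm_wf_ren: "tm_wf L t \<Longrightarrow> tm_wf L (tm_ren r t)"
  by (induction t) (auto simp: list_all_iff)

lemma qf_sat_ren: "(\<And>x. x \<in> qf_fv \<theta> \<Longrightarrow> v (r x) = w x) \<Longrightarrow> qf_sat A v (qf_ren r \<theta>) = qf_sat A w \<theta>"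
proof (induction \<theta>)
  case (Rel R ts)
  then have "map (tm_val A v \<circ> tm_ren r) ts = map (tm_val A w) ts"
    by (intro map_cong) (auto intro!: tm_val_ren)
  then show ?case by (simp only: qf_ren.simps qf_sat.simps map_map)
next
  case (Eq s t)
  then show ?case using tm_val_ren[of s v r w A] tm_val_ren[of t v r w A] by simp
qed simp_all

lemma qf_fv_ren: "qf_fv (qf_ren r \<theta>) = r ` qf_fv \<theta>"
  by (induction \<theta>) (auto simp: tm_fv_ren)

lemma qf_wf_ren: "qf_wf L \<theta> \<Longrightarrow> qf_wf L (qf_ren r \<theta>)"
  by (induction \<theta>) (auto simp: list_all_iff tm_wf_ren)

text \<open>Finite renamings are given by lists of coded pairs; earlier pairs take precedence.\<close>

definition lookup :: "nat list \<Rightarrow> nat \<Rightarrow> nat" where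
  "lookup \<rho> x = foldl (\<lambda>y e. if p1 e = x then p2 e else y) 0 (rev \<rho>)"

lemma lookup_Cons: "lookup (e # \<rho>) x = (if p1 e = x then p2 e else lookup \<rho> x)"
  by (simp add: lookup_def)

lemma lookup_append_in: "distinct (map p1 ps) \<Longrightarrow> e \<in> set ps \<Longrightarrow> lookup (ps @ \<rho>) (p1 e) = p2 e"
  by (induction ps) (auto simp: lookup_Cons)

lemma lookup_append_notin: "x \<notin> p1 ` set ps \<Longrightarrow> lookup (ps @ \<rho>) x = lookup \<rho> x"
  by (induction ps) (auto simp: lookup_Cons)

lemma computable_lookup [comp]:
  assumes "computable_list f" "computable_fun g"
  shows "computable_fun (\<lambda>n. lookup (f n) (g n))"
  unfolding lookup_def by (intro comp assms computable_compose[OF assms(2)])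

text \<open>
  The code \<open>n\<close> is renamed simultaneously as the code of a term, of a list of terms and of a
  quantifier-free formula; \<open>h m\<close> is the result for a smaller code \<open>m\<close>.
\<close>

definition ren_step :: "nat list \<Rightarrow> nat \<Rightarrow> (nat \<Rightarrow> nat) \<Rightarrow> nat" where
  "ren_step \<rho> n h =
    \<langle>if p1 n = 0 then \<langle>0, lookup \<rho> (p2 n)\<rangle> else \<langle>1, \<langle>p1 (p2 n), p1 (p2 (h (p2 (p2 n))))\<rangle>\<rangle>,
     \<langle>if n = 0 then 0 else Suc \<langle>p1 (h (p1 (n - 1))), p1 (p2 (h (p2 (n - 1))))\<rangle>,
      if p1 n = 0 then n
      else if p1 n = 1 then \<langle>1, \<langle>p1 (p2 n), p1 (p2 (h (p2 (p2 n))))\<rangle>\<rangle>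
      else if p1 n = 2 then \<langle>2, \<langle>p1 (h (p1 (p2 n))), p1 (h (p2 (p2 n)))\<rangle>\<rangle>
      else if p1 n = 3 then \<langle>3, p2 (p2 (h (p2 n)))\<rangle>
      else \<langle>p1 n, \<langle>p2 (p2 (h (p1 (p2 n)))), p2 (p2 (h (p2 (p2 n))))\<rangle>\<rangle>\<rangle>\<rangle>"

text \<open>The recursive calls go through the list of earlier values so that the equation has
  literally the form required by \<open>computable_course_of_values\<close>.
  \<open>ren_code_unfold\<close> gives back ordinary calls on smaller codes.\<close>

function ren_code :: "nat list \<Rightarrow> nat \<Rightarrow> nat" where
  "ren_code \<rho> n = ren_step \<rho> n (\<lambda>m. nth0 (map (\<lambda>k. ren_code \<rho> k) (rev [0..<n])) (n - Suc m))"
  by auto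
termination by (relation "measure snd") auto

declare ren_code.simps [simp del]

lemma ren_code_unfold:
  "ren_code \<rho> n = ren_step \<rho> n (\<lambda>m. if m < n then ren_code \<rho> m
     else nth0 (map (\<lambda>k. ren_code \<rho> k) (rev [0..<n])) 0)"
  by (subst ren_code.simps, rule arg_cong[where f = "ren_step \<rho> n"]) (auto simp: nth0_history fun_eq_iff)

lemma pair_less: "m \<noteq> 0 \<Longrightarrow> n < \<langle>m, n\<rangle>"
  using p2_less[of "\<langle>m, n\<rangle>"] by simp

lemma ren_code_list:
  assumes "\<And>t. t \<in> set ts \<Longrightarrow> p1 (ren_code \<rho> (tm_code t)) = tm_code (tm_ren (lookup \<rho>) t)"
  shows "p1 (p2 (ren_code \<rho> (list_encode (map tm_code ts)))) = list_encode (map tm_code (map (tm_ren (lookup \<rho>)) ts))"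
  using assms
proof (induction ts)
  case Nil
  show ?case by (subst ren_code_unfold) (simp add: ren_step_def)
next
  case (Cons t ts)
  have "tm_code t < Suc \<langle>tm_code t, list_encode (map tm_code ts)\<rangle>"
    "list_encode (map tm_code ts) < Suc \<langle>tm_code t, list_encode (map tm_code ts)\<rangle>"
    using le_prod_encode_1 le_prod_encode_2 by (simp_all add: less_Suc_eq_le)
  with Cons show ?case by (subst ren_code_unfold) (simp add: ren_step_def)
qed

lemma ren_code_tm: "p1 (ren_code \<rho> (tm_code t)) = tm_code (tm_ren (lookup \<rho>) t)"
proof (induction t)
  case (Var x)
  show ?case by (subst ren_code_unfold) (simp add: ren_step_def)
next
  case (Fn f ts)
  have "list_encode (map tm_code ts) < \<langle>1, \<langle>f, list_encode (map tm_code ts)\<rangle>\<rangle>"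
    using pair_less[of 1 "\<langle>f, list_encode (map tm_code ts)\<rangle>"] le_prod_encode_2[of "list_encode (map tm_code ts)" f]
    by simp
  with ren_code_list[OF Fn] show ?case
    by (subst ren_code_unfold) (simp add: ren_step_def)
qed

lemma ren_code_qf: "p2 (p2 (ren_code \<rho> (qf_code \<theta>))) = qf_code (qf_ren (lookup \<rho>) \<theta>)"
proof -
  have less: "a < \<langle>m, \<langle>a, b\<rangle>\<rangle>" "b < \<langle>m, \<langle>a, b\<rangle>\<rangle>" if "m \<noteq> 0" for m a b
    using pair_less[OF that, of "\<langle>a, b\<rangle>"] le_prod_encode_1[of a b] le_prod_encode_2[of b a] by linarith+
  show ?thesis
  proof (induction \<theta>)
    case Verum
    show ?case by (subst ren_code_unfold) (simp add: ren_step_def)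
  next
    case (Rel R ts)
    show ?case using ren_code_list[of ts \<rho>, OF ren_code_tm]
      by (subst ren_code_unfold) (simp add: ren_step_def less)
  next
    case (Eq s t)
    show ?case by (subst ren_code_unfold) (simp add: ren_step_def less ren_code_tm)
  next
    case (QNeg \<theta>)
    then show ?case by (subst ren_code_unfold) (simp add: ren_step_def pair_less)
  next
    case (QAnd \<theta>1 \<theta>2)
    then show ?case by (subst ren_code_unfold) (simp add: ren_step_def less)
  next
    case (QOr \<theta>1 \<theta>2)
    then show ?case by (subst ren_code_unfold) (simp add: ren_step_def less)
  qed
qed

lemma computable_ren_code [comp]:
  assumes "computable_list f" "computable_fun g"
  shows "computable_fun (\<lambda>n. ren_code (f n) (g n))"
proof -
  have "computable_fun (\<lambda>n. ren_code (list_decode (list_encode (f n))) (g n))"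
  proof (rule computable_course_of_values[where f = "\<lambda>x. ren_code (list_decode x)" and
      F = "\<lambda>x n l. ren_step (list_decode x) n (\<lambda>m. nth0 l (n - Suc m))"])
    show "computable_fun (\<lambda>z. ren_step (list_decode (p1 z)) (p1 (p2 z))
        (\<lambda>m. nth0 (list_decode (p2 (p2 z))) (p1 (p2 z) - Suc m)))"
      unfolding ren_step_def by (intro comp)
  qed (simp add: ren_code.simps[of _ "_ :: nat"], intro comp assms, intro assms)
  then show ?thesis by simp
qed

section \<open>Indices of computable infinitary formulas\<close>

lemma tm_code_inject: "tm_code s = tm_code t \<Longrightarrow> s = t"
proof (induction s arbitrary: t)
  case (Fn f ts)
  then obtain us where t: "t = Fn f us" "map tm_code ts = map tm_code us"
    by (cases t) (auto simp: list_encode_eq)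
  have "ts = us"
    using t(2) Fn.IH by (intro list.inj_map_strong[of ts us tm_code tm_code]) auto
  with t show ?case by simp
qed (case_tac t; simp)

lemma qf_code_inject: "qf_code \<theta> = qf_code \<eta> \<Longrightarrow> \<theta> = \<eta>"
proof (induction \<theta> arbitrary: \<eta>)
  case (Rel R ts)
  then obtain us where \<eta>: "\<eta> = Rel R us" "map tm_code ts = map tm_code us"
    by (cases \<eta>) (auto simp: list_encode_eq)
  have "ts = us"
    using \<eta>(2) tm_code_inject by (intro list.inj_map_strong[of ts us tm_code tm_code]) auto
  with \<eta> show ?case by simp
qed (case_tac \<eta>; auto dest: tm_code_inject)+

lemma mk_index_inject [simp]:
  "mk_index k a xs e = mk_index k' a' xs' e' \<longleftrightarrow> k = k' \<and> a = a' \<and> xs = xs' \<and> e = e'"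
  unfolding mk_index_def by (cases k; cases k') (auto simp: list_encode_eq)

text \<open>Speaking of valuations that agree off \<open>set us\<close> frees later arguments from
  the order and the repetitions in \<open>us\<close>.\<close>

lemma sat_Ex_tuple:
  "sat A (Ex_tuple us \<psi>) v \<longleftrightarrow> (\<exists>w. (\<forall>x. x \<notin> set us \<longrightarrow> w x = v x) \<and> sat A \<psi> w)"
proof (induction us arbitrary: v)
  case Nil
  have "(\<forall>x. w x = v x) \<longleftrightarrow> w = v" for w :: "nat \<Rightarrow> nat" by auto
  then show ?case by (simp add: Ex_tuple_def)
next
  case (Cons u us)
  have "sat A (Ex_tuple (u # us) \<psi>) v \<longleftrightarrow> (\<exists>c. sat A (Ex_tuple us \<psi>) (v(u := c)))"
    by (simp add: Ex_tuple_def)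
  also have "\<dots> \<longleftrightarrow> (\<exists>w. (\<forall>x. x \<notin> set (u # us) \<longrightarrow> w x = v x) \<and> sat A \<psi> w)" (is "?l \<longleftrightarrow> ?r")
  proof
    assume ?l
    then show ?r unfolding Cons by (metis fun_upd_other list.set_intros)
  next
    assume ?r
    then obtain w where w: "\<forall>x. x \<notin> set (u # us) \<longrightarrow> w x = v x" "sat A \<psi> w" by blast
    then have "\<forall>x. x \<notin> set us \<longrightarrow> w x = (v(u := w u)) x" by auto
    with w(2) show ?l unfolding Cons by blast
  qed
  finally show ?case .
qed

lemma sat_All_tuple:
  "sat A (All_tuple us \<psi>) v \<longleftrightarrow> (\<forall>w. (\<forall>x. x \<notin> set us \<longrightarrow> w x = v x) \<longrightarrow> sat A \<psi> w)"
proof -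
  have "sat A (All_tuple us \<psi>) v \<longleftrightarrow> \<not> sat A (Ex_tuple us (Neg \<psi>)) v" for v
    by (induction us arbitrary: v) (simp_all add: Ex_tuple_def All_tuple_def)
  then show ?thesis by (auto simp: sat_Ex_tuple)
qed

primrec dual :: "polarity \<Rightarrow> polarity" where
  "dual Sigma_pol = Pi_pol" | "dual Pi_pol = Sigma_pol"

lemma dual_dual [simp]: "dual (dual k) = k" by (cases k) auto
lemma dual_eq_Sigma [simp]: "dual k = Sigma_pol \<longleftrightarrow> k \<noteq> Sigma_pol" by (cases k) auto

section \<open>Validity and satisfaction in terms of indices\<close>

definition valid :: "language \<Rightarrow> polarity \<Rightarrow> nat \<Rightarrow> nat list \<Rightarrow> nat \<Rightarrow> bool" where
  "valid L k a xs i \<longleftrightarrow> (\<exists>\<phi>. indexes L k a xs i \<phi>)"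

text \<open>Polarity, notation and variables can be left out, since the index determines them, and
  the formula up to equivalence, by \<open>indexes_unique\<close>.\<close>

definition sat_index :: "language \<Rightarrow> struct \<Rightarrow> nat \<Rightarrow> (nat \<Rightarrow> nat) \<Rightarrow> bool" where
  "sat_index L A i v \<longleftrightarrow> (\<exists>k a xs \<phi>. indexes L k a xs i \<phi> \<and> sat A \<phi> v)"

text \<open>
  An index with \<open>witnessed L A k i v\<close> has a witness: a true disjunct if \<open>k\<close> is \<open>\<Sigma>\<close>, a false
  conjunct if \<open>k\<close> is \<open>\<Pi>\<close>. This makes all statements below symmetric in the two polarities.
\<close>

definition witnessed :: "language \<Rightarrow> struct \<Rightarrow> polarity \<Rightarrow> nat \<Rightarrow> (nat \<Rightarrow> nat) \<Rightarrow> bool" where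
  "witnessed L A k i v \<longleftrightarrow> (sat_index L A i v \<longleftrightarrow> k = Sigma_pol)"

inductive_cases indexes_E: "indexes L k a xs i \<phi>"

text \<open>The formula itself is not determined, because the family of a \<open>Disj\<close> or
  \<open>Conj\<close> is arbitrary outside \<open>W e\<close>; its satisfaction is.\<close>

lemma indexes_unique:
  "indexes L k a xs i \<phi> \<Longrightarrow> indexes L k' a' xs' i \<phi>' \<Longrightarrow> k = k' \<and> a = a' \<and> xs = xs' \<and> sat A \<phi> = sat A \<phi>'"
proof (induction arbitrary: k' a' xs' \<phi>' rule: indexes.induct)
  case (quantifier_free xs \<theta> k)
  from quantifier_free(4) show ?case
    by (rule indexes_E) (auto dest: qf_code_inject)
next
  case (Sigma a xs e F)
  from Sigma(5,2) obtain F' where eq: "k' = Sigma_pol" "a' = a" "xs' = xs" "\<phi>' = Disj (W e) F'"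
    and F': "\<forall>p\<in>W e. \<exists>j us b \<psi>. p = \<langle>j, list_encode us\<rangle> \<and> b <\<^sub>O a \<and>
        indexes L Pi_pol b (xs @ us) j \<psi> \<and> F' p = Ex_tuple us \<psi>"
    by (auto elim!: indexes_E)
  have "sat A (F p) v = sat A (F' p) v" if p: "p \<in> W e" for p v
  proof -
    from Sigma(4) p obtain j us b \<psi> where 1: "p = \<langle>j, list_encode us\<rangle>" "F p = Ex_tuple us \<psi>"
      "\<And>k' a' xs' \<phi>'. indexes L k' a' xs' j \<phi>' \<Longrightarrow> sat A \<psi> = sat A \<phi>'" by meson
    from F' p obtain j' us' b' \<psi>' where 2: "p = \<langle>j', list_encode us'\<rangle>" "F' p = Ex_tuple us' \<psi>'"
      "indexes L Pi_pol b' (xs @ us') j' \<psi>'" by meson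
    from 1(1) 2(1) have "j' = j" "us' = us" by (auto simp: list_encode_eq)
    with 1(3) 2(3) have "sat A \<psi> = sat A \<psi>'" by blast
    with \<open>us' = us\<close> show ?thesis by (simp add: 1(2) 2(2) sat_Ex_tuple)
  qed
  with eq show ?case by (auto simp: fun_eq_iff)
next
  case (Pi a xs e F)
  from Pi(5,2) obtain F' where eq: "k' = Pi_pol" "a' = a" "xs' = xs" "\<phi>' = Conj (W e) F'"
    and F': "\<forall>p\<in>W e. \<exists>j us b \<psi>. p = \<langle>j, list_encode us\<rangle> \<and> b <\<^sub>O a \<and>
        indexes L Sigma_pol b (xs @ us) j \<psi> \<and> F' p = All_tuple us \<psi>"
    by (auto elim!: indexes_E)
  have "sat A (F p) v = sat A (F' p) v" if p: "p \<in> W e" for p v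
  proof -
    from Pi(4) p obtain j us b \<psi> where 1: "p = \<langle>j, list_encode us\<rangle>" "F p = All_tuple us \<psi>"
      "\<And>k' a' xs' \<phi>'. indexes L k' a' xs' j \<phi>' \<Longrightarrow> sat A \<psi> = sat A \<phi>'" by meson
    from F' p obtain j' us' b' \<psi>' where 2: "p = \<langle>j', list_encode us'\<rangle>" "F' p = All_tuple us' \<psi>'"
      "indexes L Sigma_pol b' (xs @ us') j' \<psi>'" by meson
    from 1(1) 2(1) have "j' = j" "us' = us" by (auto simp: list_encode_eq)
    with 1(3) 2(3) have "sat A \<psi> = sat A \<psi>'" by blast
    with \<open>us' = us\<close> show ?thesis by (simp add: 1(2) 2(2) sat_All_tuple)
  qed
  with eq show ?case by (auto simp: fun_eq_iff)
qed

lemma sat_index_eq: "indexes L k a xs i \<phi> \<Longrightarrow> sat_index L A i v \<longleftrightarrow> sat A \<phi> v"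
  unfolding sat_index_def using indexes_unique by metis

lemma valid_qf:
  assumes "distinct xs" "qf_wf L \<theta>" "qf_fv \<theta> \<subseteq> set xs"
  shows "valid L k 1 xs (mk_index k 1 xs (qf_code \<theta>))"
    and "sat_index L A (mk_index k 1 xs (qf_code \<theta>)) v \<longleftrightarrow> qf_sat A v \<theta>"
  using indexes.quantifier_free[OF assms] sat_index_eq by (fastforce simp: valid_def)+

text \<open>The common premise of the rules for \<Sigma> and \<Pi> about the members of the c.e.
  set, with the polarity as a parameter.\<close>

definition elem_ok :: "language \<Rightarrow> polarity \<Rightarrow> nat \<Rightarrow> nat list \<Rightarrow> nat \<Rightarrow> bool" where
  "elem_ok L k a xs p \<longleftrightarrow>
    (\<exists>j us b. p = \<langle>j, list_encode us\<rangle> \<and> b <\<^sub>O a \<and> valid L (dual k) b (xs @ us) j)"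

lemma valid_intro:
  assumes "kleene_O a" "a \<noteq> 1" "distinct xs" "\<And>p. p \<in> W e \<Longrightarrow> elem_ok L k a xs p"
  shows "valid L k a xs (mk_index k a xs e)"
proof (cases k)
  case Sigma_pol
  have "\<forall>p\<in>W e. \<exists>\<phi> j us b \<psi>. p = \<langle>j, list_encode us\<rangle> \<and> b <\<^sub>O a \<and>
      indexes L Pi_pol b (xs @ us) j \<psi> \<and> \<phi> = Ex_tuple us \<psi>"
    using assms(4) unfolding Sigma_pol elem_ok_def valid_def dual.simps by blast
  from bchoice[OF this] obtain F where "\<forall>p\<in>W e. \<exists>j us b \<psi>. p = \<langle>j, list_encode us\<rangle> \<and> b <\<^sub>O a \<and>
      indexes L Pi_pol b (xs @ us) j \<psi> \<and> F p = Ex_tuple us \<psi>" by blast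
  from indexes.Sigma[OF assms(1-3) this] show ?thesis unfolding Sigma_pol valid_def by blast
next
  case Pi_pol
  have "\<forall>p\<in>W e. \<exists>\<phi> j us b \<psi>. p = \<langle>j, list_encode us\<rangle> \<and> b <\<^sub>O a \<and>
      indexes L Sigma_pol b (xs @ us) j \<psi> \<and> \<phi> = All_tuple us \<psi>"
    using assms(4) unfolding Pi_pol elem_ok_def valid_def dual.simps by blast
  from bchoice[OF this] obtain F where "\<forall>p\<in>W e. \<exists>j us b \<psi>. p = \<langle>j, list_encode us\<rangle> \<and> b <\<^sub>O a \<and>
      indexes L Sigma_pol b (xs @ us) j \<psi> \<and> F p = All_tuple us \<psi>" by blast
  from indexes.Pi[OF assms(1-3) this] show ?thesis unfolding Pi_pol valid_def by blast
qed

lemma valid_elim: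
  assumes "valid L k a xs i" "a \<noteq> 1"
  obtains e where "i = mk_index k a xs e" "kleene_O a" "distinct xs" "\<And>p. p \<in> W e \<Longrightarrow> elem_ok L k a xs p"
proof -
  from assms(1) obtain \<phi> where "indexes L k a xs i \<phi>" by (auto simp: valid_def)
  then show ?thesis
  proof (rule indexes_E, goal_cases)
    case 1
    with assms(2) show ?case by simp
  next
    case (2 e F)
    show ?case
    proof (rule that[of e])
      show "elem_ok L k a xs p" if "p \<in> W e" for p
        using 2(7) that unfolding elem_ok_def valid_def \<open>k = Sigma_pol\<close> dual.simps by blast
    qed (use 2 in simp_all)
  next
    case (3 e F)
    show ?case
    proof (rule that[of e])
      show "elem_ok L k a xs p" if "p \<in> W e" for p
        using 3(7) that unfolding elem_ok_def valid_def \<open>k = Pi_pol\<close> dual.simps by blast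
    qed (use 3 in simp_all)
  qed
qed

lemma valid_elem:
  assumes "valid L k a xs (mk_index k a xs e)" "a \<noteq> 1" "\<langle>j, list_encode us\<rangle> \<in> W e"
  shows "\<exists>b. b <\<^sub>O a \<and> valid L (dual k) b (xs @ us) j"
proof -
  obtain e' where "mk_index k a xs e = mk_index k a xs e'" "\<And>p. p \<in> W e' \<Longrightarrow> elem_ok L k a xs p"
    using valid_elim[OF assms(1,2)] by metis
  with assms(3) have "elem_ok L k a xs \<langle>j, list_encode us\<rangle>" by simp
  then show ?thesis unfolding elem_ok_def by (auto simp: list_encode_eq)
qed

lemma valid_qf_elim:
  assumes "valid L k 1 xs i"
  obtains \<theta> where "i = mk_index k 1 xs (qf_code \<theta>)" "distinct xs" "qf_wf L \<theta>" "qf_fv \<theta> \<subseteq> set xs"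
proof -
  from assms obtain \<phi> where "indexes L k 1 xs i \<phi>" by (auto simp: valid_def)
  then show ?thesis by (rule indexes_E) (auto intro: that)
qed

lemma valid_distinct: "valid L k a xs i \<Longrightarrow> distinct xs"
  unfolding valid_def by (auto elim: indexes_E)

text \<open>The clause that replaces both infinitary satisfaction clauses. A true disjunct has a
  true \<Pi> matrix and a false conjunct a false \<Sigma> matrix; in either case the matrix is not
  witnessed for its own polarity \<open>dual k\<close>.\<close>

lemma witnessed_iff:
  assumes "valid L k a xs (mk_index k a xs e)" "a \<noteq> 1"
  shows "witnessed L A k (mk_index k a xs e) v \<longleftrightarrow>
    (\<exists>j us w. \<langle>j, list_encode us\<rangle> \<in> W e \<and> (\<forall>x. x \<notin> set us \<longrightarrow> w x = v x) \<and> \<not> witnessed L A (dual k) j w)"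
proof -
  from assms(1) obtain \<phi> where ix: "indexes L k a xs (mk_index k a xs e) \<phi>" by (auto simp: valid_def)
  show ?thesis
  proof (cases k)
    case Sigma_pol
    with ix assms(2) obtain F where \<phi>: "\<phi> = Disj (W e) F" and F: "\<forall>p\<in>W e. \<exists>j us b \<psi>.
        p = \<langle>j, list_encode us\<rangle> \<and> b <\<^sub>O a \<and> indexes L Pi_pol b (xs @ us) j \<psi> \<and> F p = Ex_tuple us \<psi>"
      by (auto elim!: indexes_E)
    have "sat A (F \<langle>j, list_encode us\<rangle>) v \<longleftrightarrow> (\<exists>w. (\<forall>x. x \<notin> set us \<longrightarrow> w x = v x) \<and> sat_index L A j w)"
      if "\<langle>j, list_encode us\<rangle> \<in> W e" for j us
    proof -
      from F that obtain j' us' b \<psi> where *: "\<langle>j, list_encode us\<rangle> = \<langle>j', list_encode us'\<rangle>"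
        "indexes L Pi_pol b (xs @ us') j' \<psi>" "F \<langle>j, list_encode us\<rangle> = Ex_tuple us' \<psi>" by meson
      then show ?thesis by (simp add: sat_Ex_tuple sat_index_eq list_encode_eq)
    qed
    note elem = this
    have shape: "\<exists>j us. p = \<langle>j, list_encode us\<rangle>" if "p \<in> W e" for p using F that by meson
    have ex: "(\<exists>p\<in>W e. Q p) \<longleftrightarrow> (\<exists>j us. \<langle>j, list_encode us\<rangle> \<in> W e \<and> Q \<langle>j, list_encode us\<rangle>)" for Q
      using shape by fast
    show ?thesis
      unfolding witnessed_def sat_index_eq[OF ix]
      unfolding \<phi> Sigma_pol sat.simps ex using elem by (simp, blast)
  next
    case Pi_pol
    with ix assms(2) obtain F where \<phi>: "\<phi> = Conj (W e) F" and F: "\<forall>p\<in>W e. \<exists>j us b \<psi>.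
        p = \<langle>j, list_encode us\<rangle> \<and> b <\<^sub>O a \<and> indexes L Sigma_pol b (xs @ us) j \<psi> \<and> F p = All_tuple us \<psi>"
      by (auto elim!: indexes_E)
    have "sat A (F \<langle>j, list_encode us\<rangle>) v \<longleftrightarrow> (\<forall>w. (\<forall>x. x \<notin> set us \<longrightarrow> w x = v x) \<longrightarrow> sat_index L A j w)"
      if "\<langle>j, list_encode us\<rangle> \<in> W e" for j us
    proof -
      from F that obtain j' us' b \<psi> where *: "\<langle>j, list_encode us\<rangle> = \<langle>j', list_encode us'\<rangle>"
        "indexes L Sigma_pol b (xs @ us') j' \<psi>" "F \<langle>j, list_encode us\<rangle> = All_tuple us' \<psi>" by meson
      then show ?thesis by (simp add: sat_All_tuple sat_index_eq list_encode_eq)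
    qed
    note elem = this
    have shape: "\<exists>j us. p = \<langle>j, list_encode us\<rangle>" if "p \<in> W e" for p using F that by meson
    have ex: "(\<exists>p\<in>W e. Q p) \<longleftrightarrow> (\<exists>j us. \<langle>j, list_encode us\<rangle> \<in> W e \<and> Q \<langle>j, list_encode us\<rangle>)" for Q
      using shape by fast
    show ?thesis
      unfolding witnessed_def sat_index_eq[OF ix]
      unfolding \<phi> Pi_pol sat.simps using ex[of "\<lambda>p. \<not> sat A (F p) v"] elem by (simp, blast)
  qed
qed

lemma valid_induct [consumes 1, case_names qf step]:
  assumes "valid L k a xs i"
    and qf: "\<And>k xs \<theta>. distinct xs \<Longrightarrow> qf_wf L \<theta> \<Longrightarrow> qf_fv \<theta> \<subseteq> set xs \<Longrightarrow>
      P k 1 xs (mk_index k 1 xs (qf_code \<theta>))"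
    and step: "\<And>k a xs e. valid L k a xs (mk_index k a xs e) \<Longrightarrow> kleene_O a \<Longrightarrow> a \<noteq> 1 \<Longrightarrow> distinct xs \<Longrightarrow>
      (\<And>p. p \<in> W e \<Longrightarrow> \<exists>j us b. p = \<langle>j, list_encode us\<rangle> \<and> b <\<^sub>O a \<and>
        valid L (dual k) b (xs @ us) j \<and> P (dual k) b (xs @ us) j) \<Longrightarrow>
      P k a xs (mk_index k a xs e)"
  shows "P k a xs i"
proof -
  from assms(1) obtain \<phi> where "indexes L k a xs i \<phi>" by (auto simp: valid_def)
  then show ?thesis
  proof (induction rule: indexes.induct)
    case (quantifier_free xs \<theta> k)
    then show ?case by (intro qf)
  next
    case (Sigma a xs e F)
    have *: "\<exists>j us b. p = \<langle>j, list_encode us\<rangle> \<and> b <\<^sub>O a \<and> valid L (dual Sigma_pol) b (xs @ us) j \<and>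
        P (dual Sigma_pol) b (xs @ us) j" if "p \<in> W e" for p
      using Sigma(4) that unfolding valid_def dual.simps by meson
    have "elem_ok L Sigma_pol a xs p" if "p \<in> W e" for p
      using *[OF that] unfolding elem_ok_def by blast
    then show ?case using * by (intro step Sigma(1-3) valid_intro)
  next
    case (Pi a xs e F)
    have *: "\<exists>j us b. p = \<langle>j, list_encode us\<rangle> \<and> b <\<^sub>O a \<and> valid L (dual Pi_pol) b (xs @ us) j \<and>
        P (dual Pi_pol) b (xs @ us) j" if "p \<in> W e" for p
      using Pi(4) that unfolding valid_def dual.simps by meson
    have "elem_ok L Pi_pol a xs p" if "p \<in> W e" for p
      using *[OF that] unfolding elem_ok_def by blast
    then show ?case using * by (intro step Pi(1-3) valid_intro)
  qed
qed

section \<open>Renaming and negating computable formulas\<close>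

lemma ce_eq [ce]: "computable_fun f \<Longrightarrow> computable_fun g \<Longrightarrow> ce (\<lambda>n. f n = g n)"
  by (intro ce_dec comp)

lemma ce_neq [ce]: "computable_fun f \<Longrightarrow> computable_fun g \<Longrightarrow> ce (\<lambda>n. f n \<noteq> g n)"
  by (intro ce_dec comp)

section \<open>Fresh bound variables\<close>

definition fresh_vars :: "nat list \<Rightarrow> nat list \<Rightarrow> nat list" where
  "fresh_vars ys us = [Suc (list_encode ys)..<Suc (list_encode ys) + length us]"

definition fresh_pairs :: "nat list \<Rightarrow> nat list \<Rightarrow> nat list" where
  "fresh_pairs ys us = map (\<lambda>i. \<langle>nth0 us i, Suc (list_encode ys) + i\<rangle>) [0..<length us]"

lemma computable_list_fresh_vars [comp]:
  "computable_list f \<Longrightarrow> computable_list g \<Longrightarrow> computable_list (\<lambda>n. fresh_vars (f n) (g n))"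
  unfolding fresh_vars_def by (intro comp)

lemma computable_list_compose: "computable_list f \<Longrightarrow> computable_fun g \<Longrightarrow> computable_list (\<lambda>n. f (g n))"
  unfolding computable_list_def using computable_compose[of "\<lambda>n. list_encode (f n)" g] by simp

lemma computable_list_fresh_pairs [comp]:
  assumes "computable_list f" "computable_list g"
  shows "computable_list (\<lambda>n. fresh_pairs (f n) (g n))"
  unfolding fresh_pairs_def
  by (intro comp assms computable_list_compose[OF assms(1)] computable_list_compose[OF assms(2)])

lemma length_fresh_vars [simp]: "length (fresh_vars ys us) = length us"
  by (simp add: fresh_vars_def del: upt_Suc)

lemma nth_fresh_vars: "i < length us \<Longrightarrow> fresh_vars ys us ! i = Suc (list_encode ys) + i"
  by (simp add: fresh_vars_def del: upt_Suc)

lemma fresh_vars_notin: "y \<in> set (fresh_vars ys us) \<Longrightarrow> y \<notin> set ys"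
  using mem_less_list_encode[of y ys] by (auto simp: fresh_vars_def)

lemma distinct_append_fresh: "distinct ys \<Longrightarrow> distinct (ys @ fresh_vars ys us)"
  using fresh_vars_notin[of _ ys us] by (auto simp: fresh_vars_def simp del: upt_Suc)

lemma lookup_fresh_notin: "x \<notin> set us \<Longrightarrow> lookup (fresh_pairs ys us @ \<rho>) x = lookup \<rho> x"
  by (rule lookup_append_notin) (auto simp: fresh_pairs_def nth0_def)

lemma lookup_fresh_nth:
  assumes "distinct us" "i < length us"
  shows "lookup (fresh_pairs ys us @ \<rho>) (us ! i) = fresh_vars ys us ! i"
proof -
  have "map p1 (fresh_pairs ys us) = map ((!) us) [0..<length us]"
    by (simp add: fresh_pairs_def nth0_def)
  then have "distinct (map p1 (fresh_pairs ys us))" using assms(1) by (simp add: map_nth)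
  moreover have "\<langle>us ! i, Suc (list_encode ys) + i\<rangle> \<in> set (fresh_pairs ys us)"
    using assms(2) by (force simp: fresh_pairs_def nth0_def)
  ultimately show ?thesis
    using lookup_append_in[of "fresh_pairs ys us" "\<langle>us ! i, Suc (list_encode ys) + i\<rangle>" \<rho>]
      assms(2) by (simp add: nth_fresh_vars)
qed

lemma lookup_fresh_in:
  assumes "distinct us" "x \<in> set us"
  shows "lookup (fresh_pairs ys us @ \<rho>) x \<in> set (fresh_vars ys us)"
  using assms lookup_fresh_nth by (metis in_set_conv_nth length_fresh_vars)

text \<open>Transports the values of a bound tuple to the fresh tuple that replaces it, leaving all
  other variables alone.\<close>

lemma fresh_assignment:
  assumes "distinct us"
  shows "\<exists>v'. (\<forall>y. y \<notin> set (fresh_vars ys us) \<longrightarrow> v' y = v y) \<and>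
    (\<forall>x\<in>set us. v' (lookup (fresh_pairs ys us @ \<rho>) x) = w x)"
proof -
  \<comment> \<open>The first fresh variable, so that \<open>y - c\<close> is the position of the
    fresh variable \<open>y\<close>.\<close>
  define c where "c = Suc (list_encode ys)"
  define v' where "v' y = (if y \<in> set (fresh_vars ys us) then w (us ! (y - c)) else v y)" for y
  have "v' (lookup (fresh_pairs ys us @ \<rho>) x) = w x" if x: "x \<in> set us" for x
  proof -
    from x obtain i where i: "i < length us" "us ! i = x" by (auto simp: in_set_conv_nth)
    have "lookup (fresh_pairs ys us @ \<rho>) x = c + i"
      using lookup_fresh_nth[OF assms i(1), of ys \<rho>] i by (simp add: nth_fresh_vars c_def)
    moreover from this have "c + i \<in> set (fresh_vars ys us)" using lookup_fresh_in[OF assms x] by metis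
    ultimately show ?thesis using i by (simp add: v'_def)
  qed
  then show ?thesis by (intro exI[of _ v']) (auto simp: v'_def)
qed

text \<open>
  \<open>rename_at t i ys \<rho> s\<close> is the index in the tuple \<open>ys\<close> of the formula with index \<open>i\<close> renamed by
  \<open>\<rho>\<close>, and negated unless \<open>s = 0\<close>, provided that \<open>t\<close> is the fixed point \<open>rename_fix\<close> below.
\<close>

definition rename_at :: "nat \<Rightarrow> nat \<Rightarrow> nat list \<Rightarrow> nat list \<Rightarrow> nat \<Rightarrow> nat" where
  "rename_at t i ys \<rho> s =
    \<langle>if s = 0 then p1 i else 1 - p1 i, \<langle>p1 (p2 i), \<langle>list_encode ys,
      if p1 (p2 i) = 1 then
        (if s = 0 then p2 (p2 (ren_code \<rho> (p2 (p2 (p2 i))))) else \<langle>3, p2 (p2 (ren_code \<rho> (p2 (p2 (p2 i)))))\<rangle>)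
      else smn t \<langle>i, \<langle>list_encode ys, \<langle>list_encode \<rho>, s\<rangle>\<rangle>\<rangle>\<rangle>\<rangle>\<rangle>"

lemma computable_rename_at [comp]:
  assumes "computable_fun t" "computable_fun i" "computable_list ys" "computable_list \<rho>" "computable_fun s"
  shows "computable_fun (\<lambda>n. rename_at (t n) (i n) (ys n) (\<rho> n) (s n))"
  unfolding rename_at_def by (intro comp assms)

text \<open>Every bound tuple is moved beyond \<open>ys\<close>, which excludes capture; the new
  pairs stand in front of \<rho> and so override it on the bound variables.\<close>

definition rename_elem :: "nat \<Rightarrow> nat list \<Rightarrow> nat list \<Rightarrow> nat \<Rightarrow> nat \<Rightarrow> nat" where
  "rename_elem t ys \<rho> s p =
    \<langle>rename_at t (p1 p) (ys @ fresh_vars ys (list_decode (p2 p)))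
       (fresh_pairs ys (list_decode (p2 p)) @ \<rho>) s,
     list_encode (fresh_vars ys (list_decode (p2 p)))\<rangle>"

text \<open>Effective transfinite recursion: the set enumerated at one level contains indices
  \<open>smn t ...\<close> of lower level, where \<open>t\<close> is the procedure being defined.
  The parameter \<open>z\<close> packs the old index, \<open>ys\<close>, \<rho> and the sign
  \<open>s\<close>.\<close>

lemma rename_fix_ex:
  "\<exists>t. \<forall>z n. n \<in> W (smn t z) \<longleftrightarrow>
    (\<exists>p. p \<in> W (p2 (p2 (p2 (p1 z)))) \<and>
      n = rename_elem t (list_decode (p1 (p2 z))) (list_decode (p1 (p2 (p2 z)))) (p2 (p2 (p2 z))) p)"
  by (rule recursion_theorem) (unfold rename_elem_def, intro ce comp)

definition rename_fix :: nat where
  "rename_fix = (SOME t. \<forall>z n. n \<in> W (smn t z) \<longleftrightarrow>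
    (\<exists>p. p \<in> W (p2 (p2 (p2 (p1 z)))) \<and>
      n = rename_elem t (list_decode (p1 (p2 z))) (list_decode (p1 (p2 (p2 z)))) (p2 (p2 (p2 z))) p))"

abbreviation rename :: "nat \<Rightarrow> nat list \<Rightarrow> nat list \<Rightarrow> nat \<Rightarrow> nat" where
  "rename \<equiv> rename_at rename_fix"

lemma W_rename_fix:
  "n \<in> W (smn rename_fix \<langle>i, \<langle>list_encode ys, \<langle>list_encode \<rho>, s\<rangle>\<rangle>\<rangle>) \<longleftrightarrow>
    (\<exists>p\<in>W (p2 (p2 (p2 i))). n = rename_elem rename_fix ys \<rho> s p)"
  using someI_ex[OF rename_fix_ex, folded rename_fix_def] by (simp add: Bex_def)

definition dual_if :: "nat \<Rightarrow> polarity \<Rightarrow> polarity" where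
  "dual_if s k = (if s = 0 then k else dual k)"

lemma dual_dual_if: "dual (dual_if s k) = dual_if s (dual k)"
  by (simp add: dual_if_def)

text \<open>The prefixed \<open>3\<close> is the tag of \<open>QNeg\<close> in
  \<open>qf_code\<close>.\<close>

lemma rename_mk_index:
  "rename (mk_index k a xs e) ys \<rho> s = mk_index (dual_if s k) a ys
     (if a = 1 then (if s = 0 then p2 (p2 (ren_code \<rho> e)) else \<langle>3, p2 (p2 (ren_code \<rho> e))\<rangle>)
      else smn rename_fix \<langle>mk_index k a xs e, \<langle>list_encode ys, \<langle>list_encode \<rho>, s\<rangle>\<rangle>\<rangle>)"
  by (cases k) (simp_all add: rename_at_def mk_index_def dual_if_def)

text \<open>Validity and truth go through one induction, since the members of the new c.e. set are
  renamings known only through the induction hypothesis. The renaming may identify variables, which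
  \<open>condition_literal\<close> relies on. As negation flips both the formula and its polarity,
  being witnessed is preserved for either sign.\<close>

theorem rename_correct:
  assumes "valid L k a xs i" "distinct ys" "\<And>x. x \<in> set xs \<Longrightarrow> lookup \<rho> x \<in> set ys"
  shows "valid L (dual_if s k) a ys (rename i ys \<rho> s) \<and>
    (\<forall>A v w. (\<forall>x\<in>set xs. v (lookup \<rho> x) = w x) \<longrightarrow>
      witnessed L A (dual_if s k) (rename i ys \<rho> s) v = witnessed L A k i w)"
  using assms
proof (induction arbitrary: ys \<rho> rule: valid_induct)
  case (qf k xs \<theta>)
  define \<theta>' where "\<theta>' = (if s = 0 then qf_ren (lookup \<rho>) \<theta> else QNeg (qf_ren (lookup \<rho>) \<theta>))"
  have eq: "rename (mk_index k 1 xs (qf_code \<theta>)) ys \<rho> s = mk_index (dual_if s k) 1 ys (qf_code \<theta>')"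
    by (simp add: rename_mk_index ren_code_qf \<theta>'_def)
  have \<theta>': "qf_wf L \<theta>'" "qf_fv \<theta>' \<subseteq> set ys"
    using qf by (auto simp: \<theta>'_def qf_wf_ren qf_fv_ren)
  have "witnessed L A (dual_if s k) (mk_index (dual_if s k) 1 ys (qf_code \<theta>')) v =
      witnessed L A k (mk_index k 1 xs (qf_code \<theta>)) w"
    if vw: "\<forall>x\<in>set xs. v (lookup \<rho> x) = w x" for A v w
  proof -
    have "qf_sat A v (qf_ren (lookup \<rho>) \<theta>) = qf_sat A w \<theta>"
      using vw qf(3) by (intro qf_sat_ren) auto
    then show ?thesis
      unfolding witnessed_def valid_qf(2)[OF qf(4) \<theta>'] valid_qf(2)[OF qf(1-3)]
      by (auto simp: \<theta>'_def dual_if_def)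
  qed
  then show ?case unfolding eq using valid_qf(1)[OF qf(4) \<theta>'] by blast
next
  case (step k a xs e)
  define e' where "e' = smn rename_fix \<langle>mk_index k a xs e, \<langle>list_encode ys, \<langle>list_encode \<rho>, s\<rangle>\<rangle>\<rangle>"
  have eq: "rename (mk_index k a xs e) ys \<rho> s = mk_index (dual_if s k) a ys e'"
    using step(3) by (simp add: rename_mk_index e'_def)
  define j' where "j' j us = rename j (ys @ fresh_vars ys us) (fresh_pairs ys us @ \<rho>) s" for j us
  have elem: "\<exists>b. b <\<^sub>O a \<and> distinct us \<and> set us \<inter> set xs = {} \<and>
      valid L (dual_if s (dual k)) b (ys @ fresh_vars ys us) (j' j us) \<and>
      (\<forall>A v w. (\<forall>x\<in>set (xs @ us). v (lookup (fresh_pairs ys us @ \<rho>) x) = w x) \<longrightarrow>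
        witnessed L A (dual_if s (dual k)) (j' j us) v = witnessed L A (dual k) j w)"
    if p: "\<langle>j, list_encode us\<rangle> \<in> W e" for j us
  proof -
    from step(5)[OF p] obtain b where b: "b <\<^sub>O a" "valid L (dual k) b (xs @ us) j"
      and IH: "\<And>ys \<rho>. distinct ys \<Longrightarrow> (\<And>x. x \<in> set (xs @ us) \<Longrightarrow> lookup \<rho> x \<in> set ys) \<Longrightarrow>
        valid L (dual_if s (dual k)) b ys (rename j ys \<rho> s) \<and>
        (\<forall>A v w. (\<forall>x\<in>set (xs @ us). v (lookup \<rho> x) = w x) \<longrightarrow>
          witnessed L A (dual_if s (dual k)) (rename j ys \<rho> s) v = witnessed L A (dual k) j w)"
      by (auto simp: list_encode_eq)
    from valid_distinct[OF b(2)] have d: "distinct us" "set us \<inter> set xs = {}" by auto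
    have "lookup (fresh_pairs ys us @ \<rho>) x \<in> set (ys @ fresh_vars ys us)" if "x \<in> set (xs @ us)" for x
      using that step(7) lookup_fresh_in[OF d(1), of x ys \<rho>] lookup_fresh_notin[of x us ys \<rho>]
      by (cases "x \<in> set us") auto
    from IH[OF distinct_append_fresh[OF step(6)] this] b(1) d show ?thesis
      unfolding j'_def by blast
  qed
  have shape: "\<exists>j us. p = \<langle>j, list_encode us\<rangle>" if "p \<in> W e" for p
    using step(5)[OF that] by blast
  have W: "n \<in> W e' \<longleftrightarrow> (\<exists>j us. \<langle>j, list_encode us\<rangle> \<in> W e \<and> n = \<langle>j' j us, list_encode (fresh_vars ys us)\<rangle>)" for n
  proof
    assume "n \<in> W e'"
    then obtain p where p: "p \<in> W e" "n = rename_elem rename_fix ys \<rho> s p"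
      unfolding e'_def W_rename_fix by (auto simp: mk_index_def)
    from shape[OF p(1)] obtain j us where "p = \<langle>j, list_encode us\<rangle>" by blast
    with p show "\<exists>j us. \<langle>j, list_encode us\<rangle> \<in> W e \<and> n = \<langle>j' j us, list_encode (fresh_vars ys us)\<rangle>"
      unfolding rename_elem_def j'_def by auto
  next
    assume "\<exists>j us. \<langle>j, list_encode us\<rangle> \<in> W e \<and> n = \<langle>j' j us, list_encode (fresh_vars ys us)\<rangle>"
    then show "n \<in> W e'"
      unfolding e'_def W_rename_fix by (force simp: mk_index_def rename_elem_def j'_def)
  qed
  have valid: "valid L (dual_if s k) a ys (mk_index (dual_if s k) a ys e')"
  proof (rule valid_intro)
    show "elem_ok L (dual_if s k) a ys n" if "n \<in> W e'" for n
      using that elem unfolding W elem_ok_def dual_dual_if by blast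
  qed (use step in auto)
  have "witnessed L A (dual_if s k) (mk_index (dual_if s k) a ys e') v = witnessed L A k (mk_index k a xs e) w"
    if vw: "\<forall>x\<in>set xs. v (lookup \<rho> x) = w x" for A v w
    unfolding witnessed_iff[OF valid step(3)] witnessed_iff[OF step(1,3)] dual_dual_if
  proof (intro iffI; elim exE conjE)
    fix n vs v'
    assume n: "\<langle>n, list_encode vs\<rangle> \<in> W e'" and v': "\<forall>y. y \<notin> set vs \<longrightarrow> v' y = v y"
      and not: "\<not> witnessed L A (dual_if s (dual k)) n v'"
    from n obtain j us where p: "\<langle>j, list_encode us\<rangle> \<in> W e" "n = j' j us" "vs = fresh_vars ys us"
      unfolding W by (auto simp: list_encode_eq)
    \<comment> \<open>A witness for the renamed formula is pulled back along the renaming; the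
      converse direction pushes one forward with \<open>fresh_assignment\<close>.\<close>
    define w' where "w' x = (if x \<in> set us then v' (lookup (fresh_pairs ys us @ \<rho>) x) else w x)" for x
    have "v' (lookup (fresh_pairs ys us @ \<rho>) x) = w' x" if "x \<in> set (xs @ us)" for x
    proof (cases "x \<in> set us")
      case False
      with that have "lookup \<rho> x \<in> set ys" "x \<in> set xs" using step(7) by auto
      then have "v' (lookup \<rho> x) = v (lookup \<rho> x)" using v' fresh_vars_notin p(3) by blast
      with False \<open>x \<in> set xs\<close> vw show ?thesis by (simp add: w'_def lookup_fresh_notin)
    qed (simp add: w'_def)
    with elem[OF p(1)] not p(2) have "\<not> witnessed L A (dual k) j w'" by blast
    moreover have "\<forall>x. x \<notin> set us \<longrightarrow> w' x = w x" by (simp add: w'_def)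
    ultimately show "\<exists>j us w'. \<langle>j, list_encode us\<rangle> \<in> W e \<and> (\<forall>x. x \<notin> set us \<longrightarrow> w' x = w x) \<and>
        \<not> witnessed L A (dual k) j w'"
      using p(1) by blast
  next
    fix j us w'
    assume p: "\<langle>j, list_encode us\<rangle> \<in> W e" and w': "\<forall>x. x \<notin> set us \<longrightarrow> w' x = w x"
      and not: "\<not> witnessed L A (dual k) j w'"
    from elem[OF p] have d: "distinct us" "set us \<inter> set xs = {}" by auto
    from fresh_assignment[OF d(1), of ys v \<rho> w'] obtain v' where
      v': "\<forall>y. y \<notin> set (fresh_vars ys us) \<longrightarrow> v' y = v y"
        "\<forall>x\<in>set us. v' (lookup (fresh_pairs ys us @ \<rho>) x) = w' x" by blast
    have "v' (lookup (fresh_pairs ys us @ \<rho>) x) = w' x" if "x \<in> set (xs @ us)" for x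
    proof (cases "x \<in> set us")
      case False
      with that have "lookup \<rho> x \<in> set ys" "x \<in> set xs" using step(7) by auto
      then have "v' (lookup \<rho> x) = v (lookup \<rho> x)" using v'(1) fresh_vars_notin by blast
      with False \<open>x \<in> set xs\<close> vw w' show ?thesis by (simp add: lookup_fresh_notin)
    qed (use v'(2) in blast)
    with elem[OF p] not have "\<not> witnessed L A (dual_if s (dual k)) (j' j us) v'" by blast
    moreover have "\<langle>j' j us, list_encode (fresh_vars ys us)\<rangle> \<in> W e'" unfolding W using p by blast
    ultimately show "\<exists>n vs v'. \<langle>n, list_encode vs\<rangle> \<in> W e' \<and> (\<forall>y. y \<notin> set vs \<longrightarrow> v' y = v y) \<and>
        \<not> witnessed L A (dual_if s (dual k)) n v'"
      using v'(1) by blast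
  qed
  with valid show ?case unfolding eq by blast
qed

lemma rename_valid:
  assumes "valid L k a xs i" "distinct ys" "\<And>x. x \<in> set xs \<Longrightarrow> lookup \<rho> x \<in> set ys"
  shows "valid L k a ys (rename i ys \<rho> 0)" "valid L (dual k) a ys (rename i ys \<rho> 1)"
  using rename_correct[OF assms, of 0] rename_correct[OF assms, of 1] by (simp_all add: dual_if_def)

lemma rename_sat:
  assumes "valid L k a xs i" "distinct ys" "\<And>x. x \<in> set xs \<Longrightarrow> lookup \<rho> x \<in> set ys"
    and "\<And>x. x \<in> set xs \<Longrightarrow> v (lookup \<rho> x) = w x"
  shows "sat_index L A (rename i ys \<rho> 0) v \<longleftrightarrow> sat_index L A i w"
    and "sat_index L A (rename i ys \<rho> 1) v \<longleftrightarrow> \<not> sat_index L A i w"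
proof -
  have "witnessed L A (dual_if s k) (rename i ys \<rho> s) v = witnessed L A k i w" for s
    using rename_correct[OF assms(1-3), of s] assms(4) by blast
  from this[of 0] this[of 1]
  show "sat_index L A (rename i ys \<rho> 0) v \<longleftrightarrow> sat_index L A i w"
    and "sat_index L A (rename i ys \<rho> 1) v \<longleftrightarrow> \<not> sat_index L A i w"
    unfolding witnessed_def dual_if_def using dual_eq_Sigma[of k] by (auto split: if_splits)
qed

definition graph_list :: "(nat \<Rightarrow> nat) \<Rightarrow> nat list \<Rightarrow> nat list" where
  "graph_list f xs = map (\<lambda>x. \<langle>x, f x\<rangle>) xs"

lemma lookup_graph_list [simp]: "x \<in> set xs \<Longrightarrow> lookup (graph_list f xs) x = f x"
  by (induction xs) (auto simp: graph_list_def lookup_Cons)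

section \<open>Finite disjunctions and conjunctions\<close>

text \<open>A formula of level \<open>0\<close> contributes itself, as a \<open>\<Pi>\<close> formula behind an empty quantifier.\<close>

definition disj_elem :: "nat \<Rightarrow> nat \<Rightarrow> nat \<Rightarrow> bool" where
  "disj_elem zs j n \<longleftrightarrow>
    p1 (p2 j) = 1 \<and> n = \<langle>\<langle>1, \<langle>1, \<langle>zs, p2 (p2 (p2 j))\<rangle>\<rangle>\<rangle>, 0\<rangle> \<or> p1 (p2 j) \<noteq> 1 \<and> n \<in> W (p2 (p2 (p2 j)))"

text \<open>The recursion theorem serves as the s-m-n theorem here: the right-hand side does not
  mention \<open>t\<close>.\<close>

lemma disj_fix_ex:
  "\<exists>t. \<forall>z n. n \<in> W (smn t z) \<longleftrightarrow> disj_elem (p1 z) (p1 (p2 z)) n \<or> disj_elem (p1 z) (p2 (p2 z)) n"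
  by (rule recursion_theorem) (unfold disj_elem_def, intro ce comp)

definition disj_fix :: nat where
  "disj_fix = (SOME t. \<forall>z n. n \<in> W (smn t z) \<longleftrightarrow>
    disj_elem (p1 z) (p1 (p2 z)) n \<or> disj_elem (p1 z) (p2 (p2 z)) n)"

text \<open>At notation \<open>1\<close> the disjunction stays quantifier-free, and \<open>5\<close>
  is the tag of \<open>QOr\<close>. Above, the union of the two c.e. sets is taken, so the level
  does not rise.\<close>

definition disj_index :: "nat \<Rightarrow> nat list \<Rightarrow> nat \<Rightarrow> nat \<Rightarrow> nat" where
  "disj_index g zs i j =
    \<langle>0, \<langle>g, \<langle>list_encode zs, if g = 1 then \<langle>5, \<langle>p2 (p2 (p2 i)), p2 (p2 (p2 j))\<rangle>\<rangle>
      else smn disj_fix \<langle>list_encode zs, \<langle>i, j\<rangle>\<rangle>\<rangle>\<rangle>\<rangle>"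

lemma computable_disj_index [comp]:
  assumes "computable_fun g" "computable_list zs" "computable_fun i" "computable_fun j"
  shows "computable_fun (\<lambda>n. disj_index (g n) (zs n) (i n) (j n))"
  unfolding disj_index_def by (intro comp assms)

abbreviation le_O :: "nat \<Rightarrow> nat \<Rightarrow> bool"  (infix "\<le>\<^sub>O" 50) where
  "b \<le>\<^sub>O c \<equiv> b = c \<or> b <\<^sub>O c"

lemma W_disj_fix:
  "n \<in> W (smn disj_fix \<langle>zs, \<langle>i, j\<rangle>\<rangle>) \<longleftrightarrow> disj_elem zs i n \<or> disj_elem zs j n"
  using someI_ex[OF disj_fix_ex, folded disj_fix_def] by simp

lemma disj_elem_ok:
  assumes "valid L Sigma_pol b zs i" "b \<le>\<^sub>O g" "kleene_O g" "g \<noteq> 1" "disj_elem (list_encode zs) i n"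
  shows "elem_ok L Sigma_pol g zs n"
proof (cases "b = 1")
  case True
  with assms(1) obtain \<theta> where \<theta>: "i = mk_index Sigma_pol 1 zs (qf_code \<theta>)" "distinct zs"
    "qf_wf L \<theta>" "qf_fv \<theta> \<subseteq> set zs" by (metis valid_qf_elim)
  have "n = \<langle>mk_index Pi_pol 1 zs (qf_code \<theta>), list_encode []\<rangle>"
    using assms(5) \<theta>(1) by (simp add: disj_elem_def mk_index_def)
  moreover have "valid L Pi_pol 1 (zs @ []) (mk_index Pi_pol 1 zs (qf_code \<theta>))"
    using valid_qf(1)[OF \<theta>(2-4)] by simp
  moreover have "1 <\<^sub>O g" using assms(2,4) True by auto
  ultimately show ?thesis unfolding elem_ok_def by (metis dual.simps(1))
next
  case False
  from valid_elim[OF assms(1) False] obtain e where e: "i = mk_index Sigma_pol b zs e"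
    "\<And>p. p \<in> W e \<Longrightarrow> elem_ok L Sigma_pol b zs p" by metis
  have "n \<in> W e" using assms(5) e(1) False by (simp add: disj_elem_def mk_index_def)
  from e(2)[OF this] assms(2) show ?thesis
    unfolding elem_ok_def by (metis less_trans)
qed

lemma disj_elem_witnessed:
  assumes "valid L Sigma_pol b zs i"
  shows "sat_index L A i v \<longleftrightarrow> (\<exists>j us w. disj_elem (list_encode zs) i \<langle>j, list_encode us\<rangle> \<and>
    (\<forall>x. x \<notin> set us \<longrightarrow> w x = v x) \<and> sat_index L A j w)"
proof (cases "b = 1")
  case True
  with assms(1) obtain \<theta> where \<theta>: "i = mk_index Sigma_pol 1 zs (qf_code \<theta>)" "distinct zs"
    "qf_wf L \<theta>" "qf_fv \<theta> \<subseteq> set zs" by (metis valid_qf_elim)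
  have *: "disj_elem (list_encode zs) i \<langle>j, list_encode us\<rangle> \<longleftrightarrow>
      j = mk_index Pi_pol 1 zs (qf_code \<theta>) \<and> us = []" for j us
    using list_encode_eq[of us "[]"] unfolding \<theta>(1) by (simp add: disj_elem_def mk_index_def)
  have "w = v" if "\<forall>x. x \<notin> set [] \<longrightarrow> w x = v x" for w :: "nat \<Rightarrow> nat" using that by auto
  moreover have "sat_index L A i v \<longleftrightarrow> sat_index L A (mk_index Pi_pol 1 zs (qf_code \<theta>)) v"
    unfolding \<theta>(1) valid_qf(2)[OF \<theta>(2-4)] ..
  ultimately show ?thesis unfolding * by blast
next
  case False
  from valid_elim[OF assms(1) False] obtain e where e: "i = mk_index Sigma_pol b zs e" by metis
  have "disj_elem (list_encode zs) i n \<longleftrightarrow> n \<in> W e" for n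
    using False by (simp add: e disj_elem_def mk_index_def)
  with witnessed_iff[OF assms[unfolded e] False, of A v] show ?thesis
    by (simp add: witnessed_def e)
qed

lemma disj_correct:
  assumes "valid L Sigma_pol b zs i" "valid L Sigma_pol c zs j" "b \<le>\<^sub>O g" "c \<le>\<^sub>O g"
    "kleene_O g" "g = 1 \<Longrightarrow> b = 1 \<and> c = 1"
  shows "valid L Sigma_pol g zs (disj_index g zs i j)"
    and "sat_index L A (disj_index g zs i j) v \<longleftrightarrow> sat_index L A i v \<or> sat_index L A j v"
proof -
  have "valid L Sigma_pol g zs (disj_index g zs i j) \<and>
    (sat_index L A (disj_index g zs i j) v \<longleftrightarrow> sat_index L A i v \<or> sat_index L A j v)"
  proof (cases "g = 1")
    case True
    with assms(1,6) obtain \<theta> where \<theta>: "i = mk_index Sigma_pol 1 zs (qf_code \<theta>)" "distinct zs"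
      "qf_wf L \<theta>" "qf_fv \<theta> \<subseteq> set zs" by (metis valid_qf_elim)
    from True assms(2,6) obtain \<eta> where \<eta>: "j = mk_index Sigma_pol 1 zs (qf_code \<eta>)"
      "qf_wf L \<eta>" "qf_fv \<eta> \<subseteq> set zs" by (metis valid_qf_elim)
    have eq: "disj_index g zs i j = mk_index Sigma_pol 1 zs (qf_code (QOr \<theta> \<eta>))"
      by (simp add: disj_index_def mk_index_def \<theta>(1) \<eta>(1) True)
    show ?thesis
      using valid_qf(1)[of zs L "QOr \<theta> \<eta>" Sigma_pol] valid_qf(2)[of zs L "QOr \<theta> \<eta>" A Sigma_pol v] valid_qf(2)[of zs L \<theta> A Sigma_pol v]
        valid_qf(2)[of zs L \<eta> A Sigma_pol v] \<theta> \<eta>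
      unfolding eq unfolding \<theta>(1) \<eta>(1) True by simp
  next
    case False
    define e where "e = smn disj_fix \<langle>list_encode zs, \<langle>i, j\<rangle>\<rangle>"
    have eq: "disj_index g zs i j = mk_index Sigma_pol g zs e"
      using False by (simp add: disj_index_def mk_index_def e_def)
    have val: "valid L Sigma_pol g zs (mk_index Sigma_pol g zs e)"
    proof (rule valid_intro)
      show "elem_ok L Sigma_pol g zs p" if "p \<in> W e" for p
        using that disj_elem_ok[OF assms(1,3,5) False] disj_elem_ok[OF assms(2,4,5) False]
        unfolding e_def W_disj_fix by blast
    qed (use assms False valid_distinct in auto)
    have "sat_index L A (mk_index Sigma_pol g zs e) v \<longleftrightarrow> sat_index L A i v \<or> sat_index L A j v"
      using witnessed_iff[OF val False, of A v]
      unfolding witnessed_def e_def W_disj_fix disj_elem_witnessed[OF assms(1)] disj_elem_witnessed[OF assms(2)]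
      by (simp, blast)
    with val show ?thesis unfolding eq by blast
  qed
  then show "valid L Sigma_pol g zs (disj_index g zs i j)"
    and "sat_index L A (disj_index g zs i j) v \<longleftrightarrow> sat_index L A i v \<or> sat_index L A j v" by blast+
qed

text \<open>De Morgan: \<open>rename\<close> along the identity with sign \<open>1\<close> negates,
  before and after \<open>disj_index\<close>.\<close>

lemma conj_exists:
  assumes "valid L Pi_pol b zs i" "valid L Pi_pol c zs j" "b \<le>\<^sub>O g" "c \<le>\<^sub>O g"
    "kleene_O g" "g = 1 \<Longrightarrow> b = 1 \<and> c = 1"
  shows "\<exists>l. valid L Pi_pol g zs l \<and> (\<forall>A v. sat_index L A l v \<longleftrightarrow> sat_index L A i v \<and> sat_index L A j v)"
proof -
  note d = valid_distinct[OF assms(1)]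
  have neg: "valid L (dual k) b zs (rename i zs (graph_list (\<lambda>x. x) zs) 1) \<and>
      (\<forall>A v. sat_index L A (rename i zs (graph_list (\<lambda>x. x) zs) 1) v \<longleftrightarrow> \<not> sat_index L A i v)"
    if "valid L k b zs i" for k b i
    using rename_valid(2)[OF that d, of "graph_list (\<lambda>x. x) zs"]
      rename_sat(2)[OF that d, of "graph_list (\<lambda>x. x) zs"] by simp
  define l where "l = disj_index g zs (rename i zs (graph_list (\<lambda>x. x) zs) 1)
    (rename j zs (graph_list (\<lambda>x. x) zs) 1)"
  note i = neg[OF assms(1), unfolded dual.simps] and j = neg[OF assms(2), unfolded dual.simps]
  note l = disj_correct[OF conjunct1[OF i] conjunct1[OF j] assms(3-6), folded l_def]
  from neg[OF l(1)] l(2) i j show ?thesis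
    by (intro exI[of _ "rename l zs (graph_list (\<lambda>x. x) zs) 1"]) auto
qed

section \<open>Ordinal notations\<close>

lemma kleene_less_O: "x <\<^sub>O y \<Longrightarrow> kleene_O x \<and> kleene_O y"
proof -
  \<comment> \<open>The mutual induction rule wants a predicate for both relations; a trivial one
    serves for the other.\<close>
  have "(kleene_O x \<longrightarrow> True) \<and> (x <\<^sub>O y \<longrightarrow> kleene_O x \<and> kleene_O y)"
    by (rule kleene_O_kleene_less.induct) (auto intro: kleene_O_kleene_less.intros)
  then show "x <\<^sub>O y \<Longrightarrow> kleene_O x \<and> kleene_O y" by blast
qed

lemma odd_limit: "3 * 5 ^ e \<noteq> (2::nat) ^ c"
proof
  assume eq: "3 * 5 ^ e = (2::nat) ^ c"
  have "odd (3 * 5 ^ e :: nat)" by simp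
  with eq have "c = 0" by (metis even_power even_numeral neq0_conv)
  with eq show False by simp
qed

lemma limit_inject: "(3::nat) * 5 ^ e = 3 * 5 ^ f \<Longrightarrow> e = f"
  by simp

lemma kleene_O_cases:
  assumes "kleene_O x"
  shows "x = 1 \<or> (\<exists>a. x = 2 ^ a \<and> kleene_O a) \<or>
    (\<exists>e s. x = 3 * 5 ^ e \<and> (\<forall>n. phi e n (s n) \<and> kleene_O (s n) \<and> s n <\<^sub>O s (Suc n)))"
  using assms by (cases rule: kleene_O.cases) auto

lemma kleene_O_nonzero: "kleene_O x \<Longrightarrow> x \<noteq> 0"
  using kleene_O_cases by fastforce

text \<open>The exception \<open>c = 0\<close> occurs: \<open>2 ^ 0 = 1\<close> is the notation of
  zero, but \<open>0\<close> is not a notation.\<close>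

lemma kleene_O_power: "kleene_O (2 ^ c) \<Longrightarrow> c = 0 \<or> kleene_O c"
proof -
  assume "kleene_O (2 ^ c)"
  from kleene_O_cases[OF this] show ?thesis
    using odd_limit by (metis nat_power_eq_Suc_0_iff One_nat_def numeral_eq_one_iff one_less_numeral_iff
        power_inject_exp semiring_norm(76) semiring_norm(85))
qed

lemma kleene_O_limit:
  "kleene_O (3 * 5 ^ e) \<Longrightarrow> \<exists>s. \<forall>n. phi e n (s n) \<and> kleene_O (s n) \<and> s n <\<^sub>O s (Suc n)"
proof -
  assume "kleene_O (3 * 5 ^ e)"
  moreover have "3 * 5 ^ e \<noteq> (1::nat)" by simp
  moreover note odd_limit[of e]
  ultimately show ?thesis using kleene_O_cases[of "3 * 5 ^ e"] limit_inject by metis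
qed

lemma phi_unique: "phi e n x \<Longrightarrow> phi e n y \<Longrightarrow> x = y"
  unfolding phi_def using eval_unique prog_code_inject by metis

text \<open>Transitivity as a rule spoils plain inversion. Only the last step up to \<open>d\<close>
  matters, and everything before it is absorbed into \<open>\<le>\<^sub>O\<close>.\<close>

lemma kleene_less_cases:
  "b <\<^sub>O d \<Longrightarrow> (\<exists>c. d = 2 ^ c \<and> b \<le>\<^sub>O c) \<or> (\<exists>e n y. d = 3 * 5 ^ e \<and> phi e n y \<and> b \<le>\<^sub>O y)"
proof -
  have "(kleene_O b \<longrightarrow> True) \<and> (b <\<^sub>O d \<longrightarrow>
    (\<exists>c. d = 2 ^ c \<and> b \<le>\<^sub>O c) \<or> (\<exists>e n y. d = 3 * 5 ^ e \<and> phi e n y \<and> b \<le>\<^sub>O y))"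
  proof (rule kleene_O_kleene_less.induct, goal_cases)
    case (6 x y z)
    then show ?case using less_trans by metis
  qed blast+
  then show "b <\<^sub>O d \<Longrightarrow> ?thesis" by blast
qed

lemma less_power: "b <\<^sub>O 2 ^ c \<Longrightarrow> b \<le>\<^sub>O c"
  using kleene_less_cases[of b "2 ^ c"] odd_limit by (metis power_inject_exp one_less_numeral_iff semiring_norm(76))

lemma less_limit_cases: "b <\<^sub>O 3 * 5 ^ e \<Longrightarrow> \<exists>n y. phi e n y \<and> b \<le>\<^sub>O y"
  using kleene_less_cases[of b "3 * 5 ^ e"] odd_limit limit_inject by metis

lemma fundamental_sequence_mono:
  assumes "\<And>n. s n <\<^sub>O s (Suc n)" "m < n"
  shows "s m <\<^sub>O s n"
  using assms(2)
proof (induction n)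
  case (Suc n)
  then show ?case using assms(1)[of n] less_trans by (cases "m = n") auto
qed simp

text \<open>As \<open>1 = 2 ^ 0\<close>, anything below \<open>1\<close> would be \<open>0\<close>
  or below \<open>0\<close>, and \<open>0\<close> is not a notation.\<close>

lemma not_less_one: "\<not> b <\<^sub>O 1"
  using less_power[of b 0] kleene_less_O[of b 1] kleene_less_O[of b 0] kleene_O_nonzero[of 0]
    kleene_O_nonzero[of b] by auto

text \<open>Incomparable notations exist in general, but not below a common one. By induction on
  \<open>a\<close>: below a limit, both notations lie below one term of the fundamental
  sequence.\<close>

lemma kleene_less_linear: "kleene_O a \<Longrightarrow> b <\<^sub>O a \<Longrightarrow> c <\<^sub>O a \<Longrightarrow> b = c \<or> b <\<^sub>O c \<or> c <\<^sub>O b"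
proof -
  have "(kleene_O a \<longrightarrow> (\<forall>b c. b <\<^sub>O a \<longrightarrow> c <\<^sub>O a \<longrightarrow> b = c \<or> b <\<^sub>O c \<or> c <\<^sub>O b)) \<and> (a <\<^sub>O d \<longrightarrow> True)" for d
  proof (rule kleene_O_kleene_less.induct, goal_cases)
    case 1
    show ?case using not_less_one by blast
  next
    case (2 a)
    then show ?case using less_power by metis
  next
    case (3 e s)
    show ?case
    proof (intro allI impI)
      fix b c assume "b <\<^sub>O 3 * 5 ^ e" "c <\<^sub>O 3 * 5 ^ e"
      then obtain m n y z where y: "phi e m y" "b \<le>\<^sub>O y" and z: "phi e n z" "c \<le>\<^sub>O z"
        by (meson less_limit_cases)
      with 3 have "y = s m" "z = s n" by (meson phi_unique)+
      moreover have inc: "\<And>n. s n <\<^sub>O s (Suc n)" using 3 by blast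
      \<comment> \<open>Going one term beyond the maximum makes the comparison strict even for
        \<open>b = s m\<close> or \<open>c = s n\<close>.\<close>
      have "s m <\<^sub>O s (Suc (max m n))" "s n <\<^sub>O s (Suc (max m n))"
        by (rule fundamental_sequence_mono[of s, OF inc], linarith)+
      moreover note this
      ultimately have "b <\<^sub>O s (Suc (max m n))" "c <\<^sub>O s (Suc (max m n))"
        using y z less_trans by metis+
      then show "b = c \<or> b <\<^sub>O c \<or> c <\<^sub>O b" using 3 by blast
    qed
  qed blast+
  then show "kleene_O a \<Longrightarrow> b <\<^sub>O a \<Longrightarrow> c <\<^sub>O a \<Longrightarrow> b = c \<or> b <\<^sub>O c \<or> c <\<^sub>O b" by blast
qed

lemma one_less:
  assumes "kleene_O a" "a \<noteq> 1"
  shows "1 <\<^sub>O a"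
proof -
  have "(kleene_O a \<longrightarrow> a \<noteq> 1 \<longrightarrow> 1 <\<^sub>O a) \<and> (a <\<^sub>O d \<longrightarrow> True)" for d
  proof (rule kleene_O_kleene_less.induct, goal_cases)
    case (2 a)
    then show ?case using less_succ[of a] less_trans by metis
  next
    case (3 e s)
    then have "s 0 <\<^sub>O 3 * 5 ^ e" by (intro less_limit) auto
    then show ?case using 3 less_trans by metis
  qed blast+
  with assms show ?thesis by blast
qed

text \<open>
  One step of a descent from \<open>y\<close>: the witness \<open>w\<close> names the next notation and, below a limit,
  the computation that yields it. Failed descents lead to \<open>0\<close>, which is not a notation.
\<close>

definition descend :: "nat \<Rightarrow> nat \<Rightarrow> nat" where
  "descend y w =
    (if y = 2 ^ p1 w \<or>
        y = 3 * 5 ^ p1 (p2 w) \<and> phi_within (p1 (p2 w)) (p1 (p2 (p2 w))) (p1 w) (p2 (p2 (p2 w)))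
     then p1 w else 0)"

lemma descend_sound:
  "kleene_O y \<Longrightarrow> foldl descend y ws = 0 \<or> foldl descend y ws \<le>\<^sub>O y"
proof (induction ws arbitrary: y)
  case (Cons w ws)
  have "descend y w = 0 \<or> descend y w <\<^sub>O y"
  proof (cases "y = 2 ^ p1 w")
    case True
    then show ?thesis using kleene_O_power[of "p1 w"] Cons.prems less_succ by (auto simp: descend_def)
  next
    case False
    show ?thesis
    proof (cases "descend y w = 0")
      case nz: False
      with False have y: "y = 3 * 5 ^ p1 (p2 w)" and ph: "phi (p1 (p2 w)) (p1 (p2 (p2 w))) (p1 w)"
        and d: "descend y w = p1 w"
        unfolding descend_def by (auto split: if_splits simp: phi_iff_within)
      from Cons.prems[unfolded y] kleene_O_limit obtain s where
        s: "\<forall>n. phi (p1 (p2 w)) n (s n) \<and> kleene_O (s n) \<and> s n <\<^sub>O s (Suc n)" by blast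
      have "p1 w = s (p1 (p2 (p2 w)))" using s ph phi_unique by blast
      then show ?thesis using less_limit[OF s] d y by metis
    qed simp
  qed
  then show ?case
  proof
    assume 0: "descend y w = 0"
    have "foldl descend 0 ws = 0" for ws by (induction ws) (auto simp: descend_def)
    with 0 show ?thesis by simp
  next
    assume "descend y w <\<^sub>O y"
    then show ?thesis using Cons.IH[of "descend y w"] kleene_less_O less_trans by (metis foldl_Cons)
  qed
qed simp

lemma descend_complete: "x <\<^sub>O y \<Longrightarrow> \<exists>ws. foldl descend y ws = x"
proof -
  have "(kleene_O x \<longrightarrow> True) \<and> (x <\<^sub>O y \<longrightarrow> (\<exists>ws. foldl descend y ws = x))"
  proof (rule kleene_O_kleene_less.induct, goal_cases)
    case (4 a)
    have "foldl descend (2 ^ a) [\<langle>a, 0\<rangle>] = a" by (simp add: descend_def)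
    then show ?case by blast
  next
    case (5 e s k)
    then obtain t where "phi_within e k (s k) t" using phi_iff_within by meson
    then have "foldl descend (3 * 5 ^ e) [\<langle>s k, \<langle>e, \<langle>k, t\<rangle>\<rangle>\<rangle>] = s k" by (simp add: descend_def)
    then show ?case by blast
  next
    case (6 a b c)
    then obtain ws vs where "foldl descend b ws = a" "foldl descend c vs = b" by blast
    then have "foldl descend c (vs @ ws) = a" by simp
    then show ?case by blast
  qed blast+
  then show "x <\<^sub>O y \<Longrightarrow> \<exists>ws. foldl descend y ws = x" by blast
qed

text \<open>The set of all notations is not c.e., but the notations below a given one are. This
  relation is c.e. on all numbers and agrees with \<open>\<le>\<^sub>O\<close> on notations.\<close>

definition le_ce :: "nat \<Rightarrow> nat \<Rightarrow> bool" where
  "le_ce x y \<longleftrightarrow> (\<exists>w. foldl descend y (list_decode w) = x)"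

lemma le_ce_iff: "kleene_O x \<Longrightarrow> kleene_O y \<Longrightarrow> le_ce x y \<longleftrightarrow> x \<le>\<^sub>O y"
proof -
  assume O: "kleene_O x" "kleene_O y"
  have "le_ce x y \<longleftrightarrow> (\<exists>ws. foldl descend y ws = x)"
    unfolding le_ce_def by (metis list_encode_inverse)
  moreover have "foldl descend y [] = y" by simp
  ultimately show ?thesis
    using descend_sound[OF O(2)] descend_complete[of x y] kleene_O_nonzero[OF O(1)] by metis
qed

lemma ce_le_ce [ce]:
  assumes "computable_fun f" "computable_fun g"
  shows "ce (\<lambda>n. le_ce (f n) (g n))"
  unfolding le_ce_def descend_def
  by (intro ce comp computable_compose[OF assms(1)] computable_compose[OF assms(2)])

text \<open>An embedding of the two-element order yields two different notations below
  \<open>a\<close>, and at most one of them is \<open>1\<close>.\<close>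

lemma dec_ordinal_2:
  assumes "natLeq_on 2 \<le>o ordinal_of a"
  shows "\<exists>d. d <\<^sub>O a \<and> d \<noteq> 1"
proof -
  from assms obtain f where f: "embed (natLeq_on 2) (ordinal_of a) f" and w: "Well_order (natLeq_on 2)"
    unfolding ordLeq_def by auto
  have F: "Field (natLeq_on 2) = {0, 1}" unfolding Field_natLeq_on by auto
  have "inj_on f {0, 1}" using embed_inj_on[OF w f] F by simp
  then have ne: "f 0 \<noteq> f 1" by (auto simp: inj_on_def)
  have "f ` {0, 1} \<subseteq> Field (ordinal_of a)" using embed_Field[OF f] F by simp
  then have "f 0 <\<^sub>O a" "f 1 <\<^sub>O a" by (auto simp: Field_def ordinal_of_def)
  with ne show ?thesis by metis
qed

section \<open>Isomorphism invariance\<close>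

lemma tm_val_cong: "(\<And>x. x \<in> tm_fv t \<Longrightarrow> v x = w x) \<Longrightarrow> tm_val A v t = tm_val A w t"
proof (induction t)
  case (Fn f ts)
  then have "map (tm_val A v) ts = map (tm_val A w) ts" by (intro map_cong) auto
  then show ?case by (simp only: tm_val.simps)
qed simp

lemma qf_sat_cong: "(\<And>x. x \<in> qf_fv \<theta> \<Longrightarrow> v x = w x) \<Longrightarrow> qf_sat A v \<theta> = qf_sat A w \<theta>"
proof (induction \<theta>)
  case (Rel R ts)
  then have "map (tm_val A v) ts = map (tm_val A w) ts" by (intro map_cong) (auto intro!: tm_val_cong)
  then show ?case by (simp only: qf_sat.simps)
next
  case (Eq s t)
  then show ?case using tm_val_cong[of s v w A] tm_val_cong[of t v w A] by simp
qed simp_all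

lemma sat_cong: "(\<And>x. x \<in> fv \<phi> \<Longrightarrow> v x = w x) \<Longrightarrow> sat A \<phi> v = sat A \<phi> w"
proof (induction \<phi> arbitrary: v w)
  case (Qf \<theta>)
  then show ?case using qf_sat_cong[of \<theta> v w A] by simp
next
  case (Neg \<phi>)
  then show ?case by (metis fv.simps(2) sat.simps(2))
next
  case (Conj I F)
  have "sat A (F i) v = sat A (F i) w" if "i \<in> I" for i
    using that Conj.prems by (intro Conj.IH) auto
  then show ?case by simp
next
  case (Disj I F)
  have "sat A (F i) v = sat A (F i) w" if "i \<in> I" for i
    using that Disj.prems by (intro Disj.IH) auto
  then show ?case by simp
next
  case (Ex x \<phi>)
  have "sat A \<phi> (v(x := c)) = sat A \<phi> (w(x := c))" for c
    using Ex.prems by (intro Ex.IH) auto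
  then show ?case by simp
next
  case (All x \<phi>)
  have "sat A \<phi> (v(x := c)) = sat A \<phi> (w(x := c))" for c
    using All.prems by (intro All.IH) auto
  then show ?case by simp
qed

lemma fv_Ex_tuple: "fv (Ex_tuple us \<psi>) = fv \<psi> - set us" "fm_wf L (Ex_tuple us \<psi>) \<longleftrightarrow> fm_wf L \<psi>"
  by (induction us) (auto simp: Ex_tuple_def)

lemma fv_All_tuple: "fv (All_tuple us \<psi>) = fv \<psi> - set us" "fm_wf L (All_tuple us \<psi>) \<longleftrightarrow> fm_wf L \<psi>"
  by (induction us) (auto simp: All_tuple_def)

lemma indexes_wf_fv: "indexes L k a xs i \<phi> \<Longrightarrow> fm_wf L \<phi> \<and> fv \<phi> \<subseteq> set xs"
proof (induction rule: indexes.induct)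
  case (Sigma a xs e F)
  have "fm_wf L (F p) \<and> fv (F p) \<subseteq> set xs" if "p \<in> W e" for p
  proof -
    from Sigma(4) that obtain us \<psi> where "F p = Ex_tuple us \<psi>" "fm_wf L \<psi>" "fv \<psi> \<subseteq> set (xs @ us)" by meson
    then show ?thesis by (auto simp: fv_Ex_tuple)
  qed
  then show ?case by auto
next
  case (Pi a xs e F)
  have "fm_wf L (F p) \<and> fv (F p) \<subseteq> set xs" if "p \<in> W e" for p
  proof -
    from Pi(4) that obtain us \<psi> where "F p = All_tuple us \<psi>" "fm_wf L \<psi>" "fv \<psi> \<subseteq> set (xs @ us)" by meson
    then show ?thesis by (auto simp: fv_All_tuple)
  qed
  then show ?case by auto
qed auto

lemma sat_index_cong:
  assumes "valid L k a xs i" "\<And>x. x \<in> set xs \<Longrightarrow> v x = w x"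
  shows "sat_index L A i v = sat_index L A i w"
proof -
  from assms(1) obtain \<phi> where \<phi>: "indexes L k a xs i \<phi>" by (auto simp: valid_def)
  then have "fv \<phi> \<subseteq> set xs" using indexes_wf_fv by blast
  then have "sat A \<phi> v = sat A \<phi> w" using assms(2) by (intro sat_cong) auto
  then show ?thesis by (simp add: sat_index_eq[OF \<phi>])
qed

context
  fixes L :: language and A B :: struct and h :: "nat \<Rightarrow> nat"
  assumes bij: "bij h"
    and rel: "\<And>R k xs. rel_arity L R = Some k \<Longrightarrow> length xs = k \<Longrightarrow> rel_int A R xs \<longleftrightarrow> rel_int B R (map h xs)"
    and func: "\<And>f k xs. fun_arity L f = Some k \<Longrightarrow> length xs = k \<Longrightarrow> h (fun_int A f xs) = fun_int B f (map h xs)"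
begin

lemma tm_val_isomorphism: "tm_wf L t \<Longrightarrow> h (tm_val A v t) = tm_val B (\<lambda>x. h (v x)) t"
proof (induction t)
  case (Fn f ts)
  then have "map (\<lambda>t. h (tm_val A v t)) ts = map (tm_val B (\<lambda>x. h (v x))) ts"
    by (intro map_cong) (auto simp: list_all_iff)
  from this[symmetric] show ?case
    unfolding tm_val.simps using func[of f "length ts" "map (tm_val A v) ts"] Fn.prems
    by (simp add: comp_def del: map_eq_conv)
qed simp

lemma qf_sat_isomorphism: "qf_wf L \<theta> \<Longrightarrow> qf_sat A v \<theta> = qf_sat B (\<lambda>x. h (v x)) \<theta>"
proof (induction \<theta>)
  case (Rel R ts)
  then have "map (\<lambda>t. h (tm_val A v t)) ts = map (tm_val B (\<lambda>x. h (v x))) ts"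
    by (intro map_cong) (auto simp: list_all_iff tm_val_isomorphism)
  from this[symmetric] show ?case
    unfolding qf_sat.simps using rel[of R "length ts" "map (tm_val A v) ts"] Rel.prems
    by (simp add: comp_def del: map_eq_conv)
next
  case (Eq s t)
  then show ?case using bij by (simp add: tm_val_isomorphism[symmetric] bij_def inj_eq)
qed simp_all

lemma sat_isomorphism: "fm_wf L \<phi> \<Longrightarrow> sat A \<phi> v = sat B \<phi> (\<lambda>x. h (v x))"
proof (induction \<phi> arbitrary: v)
  case (Qf \<theta>)
  then show ?case by (simp add: qf_sat_isomorphism)
next
  case (Ex x \<phi>)
  have eq: "(\<lambda>y. h ((v(x := c)) y)) = (\<lambda>y. h (v y))(x := h c)" for c by (auto simp: fun_eq_iff)
  have "(\<exists>c. P (h c)) \<longleftrightarrow> (\<exists>d. P d)" for P using bij by (metis bij_pointE)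
  then show ?case using Ex.prems unfolding sat.simps fm_wf.simps by (simp only: Ex.IH eq)
next
  case (All x \<phi>)
  have eq: "(\<lambda>y. h ((v(x := c)) y)) = (\<lambda>y. h (v y))(x := h c)" for c by (auto simp: fun_eq_iff)
  have "(\<forall>c. P (h c)) \<longleftrightarrow> (\<forall>d. P d)" for P using bij by (metis bij_pointE)
  then show ?case using All.prems unfolding sat.simps fm_wf.simps by (simp only: All.IH eq)
qed auto

end

lemma models_isomorphic:
  assumes "isomorphic L A B" "sentence L \<phi>" "models A \<phi>"
  shows "models B \<phi>"
proof -
  from assms(1) obtain h :: "nat \<Rightarrow> nat" where h: "bij h"
    "\<And>R k xs. rel_arity L R = Some k \<Longrightarrow> length xs = k \<Longrightarrow> rel_int A R xs \<longleftrightarrow> rel_int B R (map h xs)"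
    "\<And>f k xs. fun_arity L f = Some k \<Longrightarrow> length xs = k \<Longrightarrow> h (fun_int A f xs) = fun_int B f (map h xs)"
    unfolding isomorphic_def by metis
  have "sat B \<phi> v" for v
  proof -
    have "(\<lambda>x. h ((inv h \<circ> v) x)) = v" using h(1) by (auto simp: fun_eq_iff bij_def surj_f_inv_f)
    moreover have "sat A \<phi> (inv h \<circ> v)" using assms(3) by (simp add: models_def)
    ultimately show ?thesis
      using sat_isomorphism[of h L A B \<phi> "inv h \<circ> v", OF h] assms(2) by (simp add: sentence_def)
  qed
  then show ?thesis by (simp add: models_def)
qed

section \<open>Generic copies\<close>

lemma finite_support_nth0: "finite {x. nth0 l x \<noteq> 0}"
  by (rule finite_subset[of _ "{..<length l}"]) (auto simp: nth0_def)

text \<open>Valuations of finite support are coded by lists, so there are only countably many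
  requirements of the form (formula, valuation).\<close>

lemma nth0_representation:
  assumes "finite {x. \<tau> x \<noteq> 0}"
  shows "\<exists>l. \<tau> = nth0 l"
proof -
  from assms obtain N where N: "\<And>x. \<tau> x \<noteq> 0 \<Longrightarrow> x < N"
    using finite_nat_set_iff_bounded by auto
  have "\<tau> x = nth0 (map \<tau> [0..<N]) x" for x
    using N[of x] by (auto simp: nth0_def)
  then show ?thesis by blast
qed

text \<open>Instantiating a quantified tuple changes finitely many values, so it never leaves the
  countable set of valuations of the form \<open>nth0 l\<close>.\<close>

lemma nth0_modification:
  assumes "\<And>x. x \<notin> set us \<Longrightarrow> \<tau> x = nth0 l x"
  shows "\<exists>l'. \<tau> = nth0 l'"
proof (rule nth0_representation)
  have "{x. \<tau> x \<noteq> 0} \<subseteq> set us \<union> {x. nth0 l x \<noteq> 0}" using assms by auto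
  then show "finite {x. \<tau> x \<noteq> 0}" using finite_support_nth0 finite_subset by blast
qed

text \<open>The Rasiowa-Sikorski construction by dependent choice, meeting requirement
  \<open>n\<close> in step \<open>n\<close>.\<close>

lemma generic_sequence:
  assumes "C X0" and dense: "\<And>n X. C X \<Longrightarrow> \<exists>Y. C Y \<and> Y \<subseteq> X \<and> D n Y"
  obtains X :: "nat \<Rightarrow> 'c set" where
    "\<And>n. C (X n)" "\<And>m n. m \<le> n \<Longrightarrow> X n \<subseteq> X m" "\<And>n. D n (X (Suc n))"
proof -
  have "\<exists>X. \<forall>n. C (X n) \<and> (X (Suc n) \<subseteq> X n \<and> D n (X (Suc n)))"
    by (rule dependent_nat_choice) (use assms in blast)+
  then obtain X where X: "\<And>n. C (X n)" "\<And>n. X (Suc n) \<subseteq> X n" "\<And>n. D n (X (Suc n))" by blast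
  have "m \<le> n \<Longrightarrow> X n \<subseteq> X m" for m n
    using X(2) by (rule lift_Suc_antimono_le)
  with X that show ?thesis by blast
qed

text \<open>The intermediate \<open>c\<close> is the room for the final sentence, whose level must
  lie strictly above that of the condition and strictly below \<open>a\<close>.\<close>

definition low :: "nat \<Rightarrow> nat \<Rightarrow> bool" where
  "low a b \<longleftrightarrow> (\<exists>c. b <\<^sub>O c \<and> c <\<^sub>O a)"

text \<open>
  Conditions are sets of enumerations \<open>h\<close> of the universe of \<open>A\<close>, that is, of copies of \<open>A\<close>. The
  free variables of the defining formula stand for themselves as elements of the copy.
\<close>

definition condition :: "language \<Rightarrow> struct \<Rightarrow> nat \<Rightarrow> (nat \<Rightarrow> nat) set \<Rightarrow> bool" where
  "condition L A a X \<longleftrightarrow>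
    (\<exists>g ys p. low a g \<and> valid L Pi_pol g ys p \<and> X = {h. bij h \<and> sat_index L A p h})"

text \<open>Not being witnessed is a \<Pi> property for either polarity: the truth of a \<Pi>
  formula or the falsity of a \<Sigma> formula. The renaming turns the variable \<open>x\<close>
  into the element \<tau> x of the copy, used as a variable.\<close>

lemma condition_literal:
  assumes "valid L k b xs i" "low a b"
  shows "condition L A a {h. bij h \<and> \<not> witnessed L A k i (h \<circ> \<tau>)}"
proof -
  define ys where "ys = remdups (map \<tau> xs)"
  define p where "p = rename i ys (graph_list \<tau> xs) (if k = Pi_pol then 0 else 1)"
  have ys: "distinct ys" "\<And>x. x \<in> set xs \<Longrightarrow> lookup (graph_list \<tau> xs) x \<in> set ys"
    by (auto simp: ys_def)
  have "valid L Pi_pol b ys p"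
    using rename_valid[OF assms(1) ys] by (cases k) (simp_all add: p_def)
  moreover have "sat_index L A p h \<longleftrightarrow> \<not> witnessed L A k i (h \<circ> \<tau>)" for h
    using rename_sat[OF assms(1) ys, of h "h \<circ> \<tau>" A] by (cases k) (simp_all add: p_def witnessed_def)
  ultimately show ?thesis unfolding condition_def using assms(2) by blast
qed

lemma condition_qf:
  assumes "qf_wf L \<theta>" "qf_fv \<theta> \<subseteq> set xs" "low a 1"
  shows "condition L A a {h. bij h \<and> qf_sat A h \<theta>}"
proof -
  have "distinct (remdups xs)" "qf_fv \<theta> \<subseteq> set (remdups xs)" using assms(2) by auto
  note q = valid_qf[OF this(1) assms(1) this(2)]
  show ?thesis unfolding condition_def using q(1)[of Pi_pol] q(2)[of A Pi_pol] assms(3) by blast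
qed

lemma low_max:
  assumes "kleene_O a" "low a b" "low a c"
  shows "\<exists>g. low a g \<and> b \<le>\<^sub>O g \<and> c \<le>\<^sub>O g \<and> kleene_O g \<and> (g = 1 \<longrightarrow> b = 1 \<and> c = 1)"
proof -
  have lt: "b <\<^sub>O a" "c <\<^sub>O a" using assms(2,3) less_trans unfolding low_def by blast+
  from kleene_less_linear[OF assms(1) lt] show ?thesis
    using assms(2,3) lt kleene_less_O not_less_one by metis
qed

lemma valid_extend_tuple:
  assumes "valid L k b xs i" "distinct ys" "set xs \<subseteq> set ys"
  shows "\<exists>j. valid L k b ys j \<and> (\<forall>A v. sat_index L A j v \<longleftrightarrow> sat_index L A i v)"
proof -
  have look: "lookup (graph_list (\<lambda>x. x) xs) x \<in> set ys" if "x \<in> set xs" for x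
    using that assms(3) by auto
  have "sat_index L A (rename i ys (graph_list (\<lambda>x. x) xs) 0) v \<longleftrightarrow> sat_index L A i v" for A v
    by (rule rename_sat(1)[OF assms(1,2) look]) simp_all
  with rename_valid(1)[OF assms(1,2) look] show ?thesis by blast
qed

lemma condition_Int:
  assumes "kleene_O a" "condition L A a X" "condition L A a Y"
  shows "condition L A a (X \<inter> Y)"
proof -
  from assms(2) obtain b xs p where b: "low a b" "valid L Pi_pol b xs p" "X = {h. bij h \<and> sat_index L A p h}"
    unfolding condition_def by blast
  from assms(3) obtain c ys q where c: "low a c" "valid L Pi_pol c ys q" "Y = {h. bij h \<and> sat_index L A q h}"
    unfolding condition_def by blast
  define zs where "zs = remdups (xs @ ys)"
  have zs: "distinct zs" "set xs \<subseteq> set zs" "set ys \<subseteq> set zs" by (auto simp: zs_def)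
  from valid_extend_tuple[OF b(2) zs(1,2)] obtain p' where p':
    "valid L Pi_pol b zs p'" "\<And>A v. sat_index L A p' v \<longleftrightarrow> sat_index L A p v" by blast
  from valid_extend_tuple[OF c(2) zs(1,3)] obtain q' where q':
    "valid L Pi_pol c zs q'" "\<And>A v. sat_index L A q' v \<longleftrightarrow> sat_index L A q v" by blast
  from low_max[OF assms(1) b(1) c(1)] obtain g where g: "low a g" "b \<le>\<^sub>O g" "c \<le>\<^sub>O g" "kleene_O g"
    "g = 1 \<Longrightarrow> b = 1 \<and> c = 1" by blast
  from conj_exists[OF p'(1) q'(1) g(2-5)] obtain l where l: "valid L Pi_pol g zs l"
    "\<And>A v. sat_index L A l v \<longleftrightarrow> sat_index L A p' v \<and> sat_index L A q' v" by blast
  have "X \<inter> Y = {h. bij h \<and> sat_index L A l h}"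
    by (auto simp: b(3) c(3) l(2) p'(2) q'(2))
  with l(1) g(1) show ?thesis unfolding condition_def by blast
qed

section \<open>Requirements and their density\<close>

text \<open>A formula of level \<open>b < a\<close> need not be \<open>low\<close>, but the matrices
  below it are. So either no enumeration in \<open>X\<close> has a witness, or a particular witness
  is fixed for all of them.\<close>

definition decides_formula :: "language \<Rightarrow> struct \<Rightarrow> nat \<Rightarrow> nat \<Rightarrow> (nat \<Rightarrow> nat) \<Rightarrow> (nat \<Rightarrow> nat) set \<Rightarrow> bool" where
  "decides_formula L A a i \<tau> X \<longleftrightarrow> (\<forall>k b xs e. i = mk_index k b xs e \<and> valid L k b xs i \<and> b <\<^sub>O a \<and> b \<noteq> 1 \<longrightarrow>
    (\<forall>h\<in>X. \<not> witnessed L A k i (h \<circ> \<tau>)) \<or>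
    (\<exists>j us \<tau>'. \<langle>j, list_encode us\<rangle> \<in> W e \<and> (\<forall>x. x \<notin> set us \<longrightarrow> \<tau>' x = \<tau> x) \<and>
      (\<forall>h\<in>X. \<not> witnessed L A (dual k) j (h \<circ> \<tau>'))))"

definition decides_atoms :: "language \<Rightarrow> struct \<Rightarrow> nat \<Rightarrow> nat list \<Rightarrow> (nat \<Rightarrow> nat) set \<Rightarrow> bool" where
  "decides_atoms L A s cs X \<longleftrightarrow>
    (rel_arity L s = Some (length cs) \<longrightarrow>
      (\<forall>h\<in>X. rel_int A s (map h cs)) \<or> (\<forall>h\<in>X. \<not> rel_int A s (map h cs))) \<and>
    (fun_arity L s = Some (length cs) \<longrightarrow> (\<exists>d. \<forall>h\<in>X. fun_int A s (map h cs) = h d))"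

text \<open>If some enumeration in \<open>X\<close> has a witness, the witness is named by elements
  of the copy and imposed; otherwise \<open>X\<close> itself decides.\<close>

lemma dense_formula:
  assumes "kleene_O a" "condition L A a X" "X \<noteq> {}"
  shows "\<exists>Y. condition L A a Y \<and> Y \<noteq> {} \<and> Y \<subseteq> X \<and> decides_formula L A a i \<tau> Y"
proof (cases "\<exists>k b xs e. i = mk_index k b xs e \<and> valid L k b xs i \<and> b <\<^sub>O a \<and> b \<noteq> 1 \<and>
    (\<exists>h\<in>X. witnessed L A k i (h \<circ> \<tau>))")
  case False
  then have "decides_formula L A a i \<tau> X" unfolding decides_formula_def by blast
  with assms show ?thesis by blast
next
  case True
  then obtain k b xs e h where i: "i = mk_index k b xs e" "valid L k b xs i" "b <\<^sub>O a" "b \<noteq> 1"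
    and h: "h \<in> X" "witnessed L A k i (h \<circ> \<tau>)" by blast
  from witnessed_iff[OF i(2)[unfolded i(1)] i(4)] h(2) obtain j us w where
    j: "\<langle>j, list_encode us\<rangle> \<in> W e" "\<forall>x. x \<notin> set us \<longrightarrow> w x = (h \<circ> \<tau>) x" "\<not> witnessed L A (dual k) j w"
    unfolding i(1) by blast
  from assms(2) h(1) have bij: "bij h" by (auto simp: condition_def)
  \<comment> \<open>\<open>inv h\<close> turns the witnesses, elements of \<open>A\<close>, into
    elements of the copy.\<close>
  define \<tau>' where "\<tau>' x = (if x \<in> set us then inv h (w x) else \<tau> x)" for x
  have w: "h \<circ> \<tau>' = w"
    using j(2) bij by (auto simp: \<tau>'_def fun_eq_iff bij_def surj_f_inv_f)
  from valid_elem[OF i(2)[unfolded i(1)] i(4) j(1)] obtain c where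
    c: "c <\<^sub>O b" "valid L (dual k) c (xs @ us) j" by blast
  have "low a c" using c(1) i(3) unfolding low_def by blast
  define Y where "Y = X \<inter> {h. bij h \<and> \<not> witnessed L A (dual k) j (h \<circ> \<tau>')}"
  have "condition L A a Y"
    unfolding Y_def by (intro condition_Int[OF assms(1,2)] condition_literal[OF c(2) \<open>low a c\<close>])
  moreover have "h \<in> Y" using h(1) bij w j(3) by (simp add: Y_def)
  moreover have "\<forall>x. x \<notin> set us \<longrightarrow> \<tau>' x = \<tau> x" by (simp add: \<tau>'_def)
  then have "decides_formula L A a i \<tau> Y"
    unfolding decides_formula_def i(1) using j(1) by (auto simp: Y_def)
  ultimately show ?thesis unfolding Y_def by blast
qed

lemma dense_atoms:
  assumes "kleene_O a" "low a 1" "condition L A a X" "X \<noteq> {}"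
  shows "\<exists>Y. condition L A a Y \<and> Y \<noteq> {} \<and> Y \<subseteq> X \<and> decides_atoms L A s cs Y"
proof -
  have "\<exists>Y. condition L A a Y \<and> Y \<noteq> {} \<and> Y \<subseteq> X \<and> (rel_arity L s = Some (length cs) \<longrightarrow>
      (\<forall>h\<in>Y. rel_int A s (map h cs)) \<or> (\<forall>h\<in>Y. \<not> rel_int A s (map h cs)))"
  proof (cases "rel_arity L s = Some (length cs) \<and> (\<exists>h\<in>X. rel_int A s (map h cs))")
    case False
    with assms show ?thesis by blast
  next
    case True
    define \<theta> where "\<theta> = Rel s (map Var cs)"
    have \<theta>: "qf_wf L \<theta>" "qf_fv \<theta> \<subseteq> set cs" "\<And>h. qf_sat A h \<theta> \<longleftrightarrow> rel_int A s (map h cs)"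
      using True by (auto simp: \<theta>_def list_all_iff comp_def)
    have "condition L A a (X \<inter> {h. bij h \<and> qf_sat A h \<theta>})"
      by (intro condition_Int[OF assms(1,3)] condition_qf[OF \<theta>(1,2) assms(2)])
    moreover have "X \<inter> {h. bij h \<and> qf_sat A h \<theta>} \<noteq> {}"
      using True assms(3) \<theta>(3) by (auto simp: condition_def)
    ultimately show ?thesis using \<theta>(3) by blast
  qed
  then obtain Y where Y: "condition L A a Y" "Y \<noteq> {}" "Y \<subseteq> X" "rel_arity L s = Some (length cs) \<longrightarrow>
      (\<forall>h\<in>Y. rel_int A s (map h cs)) \<or> (\<forall>h\<in>Y. \<not> rel_int A s (map h cs))" by blast
  show ?thesis
  proof (cases "fun_arity L s = Some (length cs)")
    case False
    with Y show ?thesis unfolding decides_atoms_def by blast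
  next
    case True
    from Y(2) obtain h where h: "h \<in> Y" by blast
    with Y(1) have bij: "bij h" by (auto simp: condition_def)
    \<comment> \<open>The element of the copy that \<open>h\<close> maps to the value of the
      function.\<close>
    define d where "d = inv h (fun_int A s (map h cs))"
    define \<theta> where "\<theta> = Eq (Fn s (map Var cs)) (Var d)"
    have \<theta>: "qf_wf L \<theta>" "qf_fv \<theta> \<subseteq> set (d # cs)" "\<And>h. qf_sat A h \<theta> \<longleftrightarrow> fun_int A s (map h cs) = h d"
      using True by (auto simp: \<theta>_def list_all_iff comp_def)
    have "condition L A a (Y \<inter> {h. bij h \<and> qf_sat A h \<theta>})"
      by (intro condition_Int[OF assms(1) Y(1)] condition_qf[OF \<theta>(1,2) assms(2)])
    moreover have "h \<in> Y \<inter> {h. bij h \<and> qf_sat A h \<theta>}"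
      using h bij unfolding \<theta>(3) by (simp add: d_def bij_def surj_f_inv_f)
    moreover have "decides_atoms L A s cs (Y \<inter> {h. bij h \<and> qf_sat A h \<theta>})"
      unfolding decides_atoms_def using Y(4) \<theta>(3) by blast
    ultimately show ?thesis using Y(3) by blast
  qed
qed

text \<open>
  If no condition forces a disjunct of the \<open>\<Sigma>\<close> sentence, then a generic copy is a model of the \<open>\<Pi>\<close>
  sentence in which all these disjuncts fail.
\<close>

theorem isolating_condition:
  assumes O: "kleene_O a" and d: "d <\<^sub>O a" "d \<noteq> 1"
    and \<phi>: "valid L Pi_pol a [] (mk_index Pi_pol a [] e)" "\<And>v. sat_index L A (mk_index Pi_pol a [] e) v"
    and \<psi>: "valid L Sigma_pol a [] (mk_index Sigma_pol a [] f)"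
    and imp: "\<And>B v. sat_index L B (mk_index Pi_pol a [] e) v \<Longrightarrow> sat_index L B (mk_index Sigma_pol a [] f) v"
  shows "\<exists>j us \<tau> X. \<langle>j, list_encode us\<rangle> \<in> W f \<and> condition L A a X \<and> X \<noteq> {} \<and> (\<forall>h\<in>X. sat_index L A j (h \<circ> \<tau>))"
proof (rule ccontr)
  assume not_isolated: "\<not> ?thesis"
  have low1: "low a 1" using one_less[of d] d kleene_less_O unfolding low_def by blast
  have a1: "a \<noteq> 1" using d(1) not_less_one by blast
  \<comment> \<open>One number codes two requirements: its first part is read as an index and as a
    symbol, its second as a valuation and as an argument list.\<close>
  define D where "D n X \<longleftrightarrow> decides_formula L A a (p1 n) (nth0 (list_decode (p2 n))) X \<and>
    decides_atoms L A (p1 n) (list_decode (p2 n)) X" for n X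
  define C where "C X \<longleftrightarrow> condition L A a X \<and> X \<noteq> {}" for X
  \<comment> \<open>Atoms are decided first, and this must survive the refinement that decides the
    formula.\<close>
  have mono: "decides_atoms L A i cs Y" if X: "decides_atoms L A i cs X" and Y: "Y \<subseteq> X" for i cs X Y
    unfolding decides_atoms_def
  proof (intro conjI impI)
    assume "rel_arity L i = Some (length cs)"
    with X have "(\<forall>h\<in>X. rel_int A i (map h cs)) \<or> (\<forall>h\<in>X. \<not> rel_int A i (map h cs))"
      unfolding decides_atoms_def by blast
    with Y show "(\<forall>h\<in>Y. rel_int A i (map h cs)) \<or> (\<forall>h\<in>Y. \<not> rel_int A i (map h cs))" by blast
  next
    assume "fun_arity L i = Some (length cs)"
    with X obtain c where "\<forall>h\<in>X. fun_int A i (map h cs) = h c" unfolding decides_atoms_def by blast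
    with Y show "\<exists>d. \<forall>h\<in>Y. fun_int A i (map h cs) = h d" by blast
  qed
  have dense: "\<exists>Y. C Y \<and> Y \<subseteq> X \<and> D n Y" if "C X" for n X
  proof -
    from that dense_atoms[OF O low1] obtain Y where Y: "condition L A a Y" "Y \<noteq> {}" "Y \<subseteq> X"
      "decides_atoms L A (p1 n) (list_decode (p2 n)) Y" unfolding C_def by blast
    from dense_formula[OF O Y(1,2)] obtain Z where "condition L A a Z" "Z \<noteq> {}" "Z \<subseteq> Y"
      "decides_formula L A a (p1 n) (nth0 (list_decode (p2 n))) Z" by blast
    with Y mono[OF Y(4)] show ?thesis unfolding C_def D_def by blast
  qed
  have "C {h. bij h \<and> qf_sat A h Verum}"
    unfolding C_def using condition_qf[of L Verum "[]" a A] low1 bij_id by auto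
  then obtain X where
    X: "\<And>n. C (X n)" "\<And>m n. m \<le> n \<Longrightarrow> X n \<subseteq> X m" "\<And>n. D n (X (Suc n))"
    using generic_sequence[where C = C and D = D, OF _ dense] by metis
  have bij: "bij h" if "h \<in> X n" for h n using X(1)[of n] that by (auto simp: C_def condition_def)
  \<comment> \<open>Truth for all enumerations in some \<open>X n\<close>. These properties form a
    filter, which is proper because no \<open>X n\<close> is empty (\<open>ev_elim\<close>).\<close>
  define ev where "ev P \<longleftrightarrow> (\<exists>n. \<forall>h\<in>X n. P h)" for P
  have ev_conj: "ev (\<lambda>h. P h \<and> Q h)" if PQ: "ev P" "ev Q" for P Q
  proof -
    from PQ obtain m n where "\<forall>h\<in>X m. P h" "\<forall>h\<in>X n. Q h" unfolding ev_def by blast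
    then have "\<forall>h\<in>X (max m n). P h \<and> Q h" using X(2)[of m "max m n"] X(2)[of n "max m n"] by auto
    then show ?thesis unfolding ev_def by blast
  qed
  have ev_elim: "Q" if "ev P" "\<And>h. P h \<Longrightarrow> Q" for P Q
    using that X(1) unfolding ev_def C_def by blast
  have ev_mono: "ev Q" if "ev P" "\<And>h. bij h \<Longrightarrow> P h \<Longrightarrow> Q h" for P Q
    using that bij unfolding ev_def by blast
  have ev_ball: "ev (\<lambda>h. \<forall>s\<in>S. P s h)" if "finite S" "\<And>s. s \<in> S \<Longrightarrow> ev (P s)" for S :: "tm set" and P
    using that
  proof (induction S rule: finite_induct)
    case empty
    show ?case by (simp add: ev_def)
  next
    case (insert s S)
    then have "ev (P s)" "ev (\<lambda>h. \<forall>s\<in>S. P s h)" by simp_all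
    from ev_conj[OF this] show ?case by simp
  qed
  have D_formula: "\<exists>n. decides_formula L A a i (nth0 l) (X n)" for i l
    using X(3)[of "\<langle>i, list_encode l\<rangle>"] unfolding D_def by auto
  have D_atoms: "\<exists>n. decides_atoms L A s cs (X n)" for s cs
    using X(3)[of "\<langle>s, list_encode cs\<rangle>"] unfolding D_def by auto

  \<comment> \<open>The generic copy: the element \<open>c\<close> stands for the map taking
    \<open>h\<close> to \<open>h c\<close>, and relations and functions are read off the filter as
    in a reduced power.\<close>
  define B where "B = \<lparr>rel_int = (\<lambda>R cs. ev (\<lambda>h. rel_int A R (map h cs))),
    fun_int = (\<lambda>g cs. SOME c. ev (\<lambda>h. fun_int A g (map h cs) = h c))\<rparr>"
  have B_fun: "ev (\<lambda>h. fun_int A g (map h cs) = h (fun_int B g cs))"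
    if "fun_arity L g = Some (length cs)" for g cs
  proof -
    from D_atoms[of g cs] that have "\<exists>c. ev (\<lambda>h. fun_int A g (map h cs) = h c)"
      unfolding decides_atoms_def ev_def by blast
    then show ?thesis unfolding B_def by (simp add: someI_ex[of "\<lambda>c. ev (\<lambda>h. fun_int A g (map h cs) = h c)"])
  qed
  have B_rel: "ev (\<lambda>h. rel_int A R (map h cs) = rel_int B R cs)"
    if "rel_arity L R = Some (length cs)" for R cs
  proof -
    have "rel_int B R cs \<longleftrightarrow> ev (\<lambda>h. rel_int A R (map h cs))" by (simp add: B_def)
    moreover from D_atoms[of R cs] that have
      "ev (\<lambda>h. rel_int A R (map h cs)) \<or> ev (\<lambda>h. \<not> rel_int A R (map h cs))"
      unfolding decides_atoms_def ev_def by blast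
    moreover have "\<not> (ev (\<lambda>h. rel_int A R (map h cs)) \<and> ev (\<lambda>h. \<not> rel_int A R (map h cs)))"
      using ev_elim[OF ev_conj[of "\<lambda>h. rel_int A R (map h cs)" "\<lambda>h. \<not> rel_int A R (map h cs)"], of False] by blast
    ultimately show ?thesis by auto
  qed
  have B_tm: "ev (\<lambda>h. h (tm_val B \<tau> t) = tm_val A (h \<circ> \<tau>) t)" if "tm_wf L t" for t \<tau>
    using that
  proof (induction t)
    case (Var x)
    show ?case by (simp add: ev_def)
  next
    case (Fn g ts)
    have "ev (\<lambda>h. \<forall>t\<in>set ts. h (tm_val B \<tau> t) = tm_val A (h \<circ> \<tau>) t)"
    proof (rule ev_ball[OF finite_set])
      fix t assume t: "t \<in> set ts"
      with Fn.prems have "tm_wf L t" by (auto simp: list_all_iff)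
      with t show "ev (\<lambda>h. h (tm_val B \<tau> t) = tm_val A (h \<circ> \<tau>) t)" by (rule Fn.IH)
    qed
    moreover have "ev (\<lambda>h. fun_int A g (map h (map (tm_val B \<tau>) ts)) = h (fun_int B g (map (tm_val B \<tau>) ts)))"
      using Fn.prems by (intro B_fun) simp
    ultimately show ?case
    proof (rule ev_mono[OF ev_conj], elim conjE)
      fix h assume 1: "\<forall>t\<in>set ts. h (tm_val B \<tau> t) = tm_val A (h \<circ> \<tau>) t"
        and 2: "fun_int A g (map h (map (tm_val B \<tau>) ts)) = h (fun_int B g (map (tm_val B \<tau>) ts))"
      from 1 have "map h (map (tm_val B \<tau>) ts) = map (tm_val A (h \<circ> \<tau>)) ts" by simp
      with 2 show "h (tm_val B \<tau> (Fn g ts)) = tm_val A (h \<circ> \<tau>) (Fn g ts)"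
        by (simp only: tm_val.simps)
    qed
  qed
  have B_qf: "ev (\<lambda>h. qf_sat A (h \<circ> \<tau>) \<theta> = qf_sat B \<tau> \<theta>)" if "qf_wf L \<theta>" for \<theta> \<tau>
    using that
  proof (induction \<theta>)
    case Verum
    show ?case by (simp add: ev_def)
  next
    case (Rel R ts)
    have "ev (\<lambda>h. \<forall>t\<in>set ts. h (tm_val B \<tau> t) = tm_val A (h \<circ> \<tau>) t)"
      using Rel.prems by (intro ev_ball[OF finite_set] B_tm) (simp add: list_all_iff)
    moreover have "ev (\<lambda>h. rel_int A R (map h (map (tm_val B \<tau>) ts)) = rel_int B R (map (tm_val B \<tau>) ts))"
      using Rel.prems by (intro B_rel) simp
    ultimately show ?case
    proof (rule ev_mono[OF ev_conj], elim conjE)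
      fix h assume 1: "\<forall>t\<in>set ts. h (tm_val B \<tau> t) = tm_val A (h \<circ> \<tau>) t"
        and 2: "rel_int A R (map h (map (tm_val B \<tau>) ts)) = rel_int B R (map (tm_val B \<tau>) ts)"
      from 1 have "map h (map (tm_val B \<tau>) ts) = map (tm_val A (h \<circ> \<tau>)) ts" by simp
      with 2 show "qf_sat A (h \<circ> \<tau>) (Rel R ts) = qf_sat B \<tau> (Rel R ts)"
        by (simp only: qf_sat.simps)
    qed
  next
    case (Eq s t)
    then have "ev (\<lambda>h. h (tm_val B \<tau> s) = tm_val A (h \<circ> \<tau>) s)" "ev (\<lambda>h. h (tm_val B \<tau> t) = tm_val A (h \<circ> \<tau>) t)"
      by (auto intro: B_tm)
    then show ?case
    proof (rule ev_mono[OF ev_conj], elim conjE)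
      fix h assume "bij h" and 1: "h (tm_val B \<tau> s) = tm_val A (h \<circ> \<tau>) s" "h (tm_val B \<tau> t) = tm_val A (h \<circ> \<tau>) t"
      then show "qf_sat A (h \<circ> \<tau>) (Eq s t) = qf_sat B \<tau> (Eq s t)"
        using bij_is_inj[OF \<open>bij h\<close>] unfolding qf_sat.simps 1[symmetric] by (simp add: inj_eq)
    qed
  next
    case (QNeg \<theta>)
    have "ev (\<lambda>h. qf_sat A (h \<circ> \<tau>) \<theta> = qf_sat B \<tau> \<theta>)"
      using QNeg.prems unfolding qf_wf.simps by (rule QNeg.IH)
    then show ?case by (rule ev_mono) (simp only: qf_sat.simps)
  next
    case (QAnd \<theta> \<eta>)
    have "ev (\<lambda>h. qf_sat A (h \<circ> \<tau>) \<theta> = qf_sat B \<tau> \<theta>)" "ev (\<lambda>h. qf_sat A (h \<circ> \<tau>) \<eta> = qf_sat B \<tau> \<eta>)"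
      using QAnd.prems unfolding qf_wf.simps by (blast intro: QAnd.IH)+
    then show ?case by (rule ev_mono[OF ev_conj]) (simp only: qf_sat.simps)
  next
    case (QOr \<theta> \<eta>)
    have "ev (\<lambda>h. qf_sat A (h \<circ> \<tau>) \<theta> = qf_sat B \<tau> \<theta>)" "ev (\<lambda>h. qf_sat A (h \<circ> \<tau>) \<eta> = qf_sat B \<tau> \<eta>)"
      using QOr.prems unfolding qf_wf.simps by (blast intro: QOr.IH)+
    then show ?case by (rule ev_mono[OF ev_conj]) (simp only: qf_sat.simps)
  qed
  have B_qf_index: "ev (\<lambda>h. witnessed L A k i (h \<circ> \<tau>) = witnessed L B k i \<tau>)" if "valid L k 1 xs i" for k xs i \<tau>
  proof -
    from that obtain \<theta> where \<theta>: "i = mk_index k 1 xs (qf_code \<theta>)" "distinct xs" "qf_wf L \<theta>" "qf_fv \<theta> \<subseteq> set xs"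
      by (rule valid_qf_elim)
    show ?thesis using B_qf[OF \<theta>(3), of \<tau>]
      by (rule ev_mono) (simp only: \<theta>(1) witnessed_def valid_qf(2)[OF \<theta>(2-4)])
  qed
  \<comment> \<open>Where witnesses are excluded, every instance of the matrix fails to be
    one.\<close>
  have pass_down: "ev (\<lambda>h. witnessed L A (dual k) j (h \<circ> \<tau>'))"
    if "valid L k b xs (mk_index k b xs e)" "b \<noteq> 1" "ev (\<lambda>h. \<not> witnessed L A k (mk_index k b xs e) (h \<circ> \<tau>))"
      "\<langle>j, list_encode us\<rangle> \<in> W e" "\<forall>x. x \<notin> set us \<longrightarrow> \<tau>' x = \<tau> x" for k b xs e \<tau> \<tau>' j us
    using that(3)
  proof (rule ev_mono)
    fix h assume "\<not> witnessed L A k (mk_index k b xs e) (h \<circ> \<tau>)"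
    moreover have "\<forall>x. x \<notin> set us \<longrightarrow> (h \<circ> \<tau>') x = (h \<circ> \<tau>) x" using that(5) by simp
    ultimately show "witnessed L A (dual k) j (h \<circ> \<tau>')"
      unfolding witnessed_iff[OF that(1,2)] using that(4) by blast
  qed
  \<comment> \<open>The truth lemma for formulas below \<open>a\<close>. Excluded witnesses need
    only the induction hypothesis; the existence of a witness in \<open>B\<close> is where
    genericity enters, since the witness may depend on \<open>h\<close> until a requirement fixes
    it. Valuations are of the form \<open>nth0 l\<close> because requirements exist for these
    only.\<close>
  have truth: "(ev (\<lambda>h. \<not> witnessed L A k i (h \<circ> nth0 l)) \<longrightarrow> \<not> witnessed L B k i (nth0 l)) \<and>
      (ev (\<lambda>h. witnessed L A k i (h \<circ> nth0 l)) \<longrightarrow> witnessed L B k i (nth0 l))"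
    if "valid L k b xs i" "b <\<^sub>O a" for k b xs i l
    using that
  proof (induction arbitrary: l rule: valid_induct)
    case (qf k xs \<theta>)
    have eq: "ev (\<lambda>h. witnessed L A k (mk_index k 1 xs (qf_code \<theta>)) (h \<circ> nth0 l) =
        witnessed L B k (mk_index k 1 xs (qf_code \<theta>)) (nth0 l))"
      using valid_qf(1)[OF qf(1-3)] by (rule B_qf_index)
    show ?case
    proof (intro conjI impI)
      assume "ev (\<lambda>h. \<not> witnessed L A k (mk_index k 1 xs (qf_code \<theta>)) (h \<circ> nth0 l))"
      from ev_conj[OF eq this] show "\<not> witnessed L B k (mk_index k 1 xs (qf_code \<theta>)) (nth0 l)"
        by (rule ev_elim) blast
    next
      assume "ev (\<lambda>h. witnessed L A k (mk_index k 1 xs (qf_code \<theta>)) (h \<circ> nth0 l))"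
      from ev_conj[OF eq this] show "witnessed L B k (mk_index k 1 xs (qf_code \<theta>)) (nth0 l)"
        by (rule ev_elim) blast
    qed
  next
    case (step k b xs e)
    have IH: "(ev (\<lambda>h. \<not> witnessed L A (dual k) j (h \<circ> nth0 l)) \<longrightarrow> \<not> witnessed L B (dual k) j (nth0 l)) \<and>
      (ev (\<lambda>h. witnessed L A (dual k) j (h \<circ> nth0 l)) \<longrightarrow> witnessed L B (dual k) j (nth0 l))"
      if "\<langle>j, list_encode us\<rangle> \<in> W e" for j us l
    proof -
      from step(5)[OF that] obtain j' us' c where *: "\<langle>j, list_encode us\<rangle> = \<langle>j', list_encode us'\<rangle>" "c <\<^sub>O b"
        "\<And>l. c <\<^sub>O a \<Longrightarrow> (ev (\<lambda>h. \<not> witnessed L A (dual k) j' (h \<circ> nth0 l)) \<longrightarrow> \<not> witnessed L B (dual k) j' (nth0 l)) \<and>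
          (ev (\<lambda>h. witnessed L A (dual k) j' (h \<circ> nth0 l)) \<longrightarrow> witnessed L B (dual k) j' (nth0 l))" by blast
      from *(1) *(3)[OF less_trans[OF *(2) step(6)]] show ?thesis by simp
    qed
    show ?case
    proof (intro conjI impI notI)
      assume neg: "ev (\<lambda>h. \<not> witnessed L A k (mk_index k b xs e) (h \<circ> nth0 l))"
        and "witnessed L B k (mk_index k b xs e) (nth0 l)"
      then obtain j us \<tau>' where j: "\<langle>j, list_encode us\<rangle> \<in> W e" "\<forall>x. x \<notin> set us \<longrightarrow> \<tau>' x = nth0 l x"
        "\<not> witnessed L B (dual k) j \<tau>'" unfolding witnessed_iff[OF step(1,3)] by blast
      from nth0_modification[of us \<tau>' l] j(2) obtain l' where l': "\<tau>' = nth0 l'" by blast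
      from pass_down[OF step(1,3) neg j(1,2)] IH[OF j(1), of l'] j(3) show False unfolding l' by blast
    next
      assume pos: "ev (\<lambda>h. witnessed L A k (mk_index k b xs e) (h \<circ> nth0 l))"
      from D_formula obtain n where "decides_formula L A a (mk_index k b xs e) (nth0 l) (X n)" by blast
      with step(1,3,6) have "(\<forall>h\<in>X n. \<not> witnessed L A k (mk_index k b xs e) (h \<circ> nth0 l)) \<or>
        (\<exists>j us \<tau>'. \<langle>j, list_encode us\<rangle> \<in> W e \<and> (\<forall>x. x \<notin> set us \<longrightarrow> \<tau>' x = nth0 l x) \<and>
          (\<forall>h\<in>X n. \<not> witnessed L A (dual k) j (h \<circ> \<tau>')))" unfolding decides_formula_def by blast
      moreover have "\<not> (\<forall>h\<in>X n. \<not> witnessed L A k (mk_index k b xs e) (h \<circ> nth0 l))"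
      proof
        assume "\<forall>h\<in>X n. \<not> witnessed L A k (mk_index k b xs e) (h \<circ> nth0 l)"
        then have "ev (\<lambda>h. \<not> witnessed L A k (mk_index k b xs e) (h \<circ> nth0 l))" unfolding ev_def by blast
        from ev_conj[OF pos this] show False by (rule ev_elim) blast
      qed
      ultimately obtain j us \<tau>' where j: "\<langle>j, list_encode us\<rangle> \<in> W e" "\<forall>x. x \<notin> set us \<longrightarrow> \<tau>' x = nth0 l x"
        "ev (\<lambda>h. \<not> witnessed L A (dual k) j (h \<circ> \<tau>'))" unfolding ev_def by blast
      from nth0_modification[of us \<tau>' l] j(2) obtain l' where l': "\<tau>' = nth0 l'" by blast
      from IH[OF j(1), of l'] j(3) have "\<not> witnessed L B (dual k) j \<tau>'" unfolding l' by blast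
      with j(1,2) show "witnessed L B k (mk_index k b xs e) (nth0 l)"
        unfolding witnessed_iff[OF step(1,3)] by blast
    qed
  qed
  have elem: "\<exists>b. b <\<^sub>O a \<and> valid L (dual k) b us j" if "valid L k a [] (mk_index k a [] g)" "\<langle>j, list_encode us\<rangle> \<in> W g"
    for k g j us
    using valid_elem[OF that(1) a1 that(2)] by simp
  \<comment> \<open>The two sentences have level \<open>a\<close>, out of reach of
    \<open>truth\<close>; one level is unfolded by hand and \<open>truth\<close> applied to the
    matrix.\<close>
  have "sat_index L B (mk_index Pi_pol a [] e) (nth0 [])"
  proof (rule ccontr)
    assume "\<not> ?thesis"
    then have "witnessed L B Pi_pol (mk_index Pi_pol a [] e) (nth0 [])" by (simp add: witnessed_def)
    then obtain j us \<tau>' where j: "\<langle>j, list_encode us\<rangle> \<in> W e" "\<forall>x. x \<notin> set us \<longrightarrow> \<tau>' x = nth0 [] x"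
      "\<not> witnessed L B Sigma_pol j \<tau>'" unfolding witnessed_iff[OF \<phi>(1) a1] by auto
    from nth0_modification[of us \<tau>' "[]"] j(2) obtain l' where l': "\<tau>' = nth0 l'" by blast
    from elem[OF \<phi>(1) j(1)] obtain b where b: "b <\<^sub>O a" "valid L Sigma_pol b us j" by auto
    have "ev (\<lambda>h. \<not> witnessed L A Pi_pol (mk_index Pi_pol a [] e) (h \<circ> nth0 []))"
      using \<phi>(2) by (simp add: ev_def witnessed_def)
    from pass_down[OF \<phi>(1) a1 this j(1,2)] truth[OF b(2,1), of l'] j(3) show False by (simp add: l')
  qed
  then have "sat_index L B (mk_index Sigma_pol a [] f) (nth0 [])" by (rule imp)
  then have "witnessed L B Sigma_pol (mk_index Sigma_pol a [] f) (nth0 [])" by (simp add: witnessed_def)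
  then obtain j us \<tau>' where j: "\<langle>j, list_encode us\<rangle> \<in> W f" "\<forall>x. x \<notin> set us \<longrightarrow> \<tau>' x = nth0 [] x"
    "\<not> witnessed L B Pi_pol j \<tau>'" unfolding witnessed_iff[OF \<psi> a1] by auto
  from nth0_modification[of us \<tau>' "[]"] j(2) obtain l where l: "\<tau>' = nth0 l" by blast
  from elem[OF \<psi> j(1)] obtain b where b: "b <\<^sub>O a" "valid L Pi_pol b us j" by auto
  \<comment> \<open>The matrix of the disjunct true in \<open>B\<close> is decided: forced falsity
    contradicts \<open>truth\<close>, forced truth makes some \<open>X n\<close> an isolating
    condition.\<close>
  have "ev (\<lambda>h. \<not> witnessed L A Pi_pol j (h \<circ> \<tau>')) \<or> ev (\<lambda>h. witnessed L A Pi_pol j (h \<circ> \<tau>'))"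
  proof (cases "b = 1")
    case True
    have "ev (\<lambda>h. \<not> witnessed L A Pi_pol j (h \<circ> \<tau>'))"
      using B_qf_index[OF b(2)[unfolded True], of \<tau>'] by (rule ev_mono) (use j(3) in blast)
    then show ?thesis ..
  next
    case False
    from valid_elim[OF b(2) False] obtain g where g: "j = mk_index Pi_pol b us g" by metis
    from D_formula obtain n where "decides_formula L A a j (nth0 l) (X n)" by blast
    with b False g l have "(\<forall>h\<in>X n. \<not> witnessed L A Pi_pol j (h \<circ> \<tau>')) \<or>
      (\<exists>j2 vs \<sigma>. \<langle>j2, list_encode vs\<rangle> \<in> W g \<and> (\<forall>x. x \<notin> set vs \<longrightarrow> \<sigma> x = \<tau>' x) \<and>
        (\<forall>h\<in>X n. \<not> witnessed L A (dual Pi_pol) j2 (h \<circ> \<sigma>)))" unfolding decides_formula_def by blast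
    then show ?thesis
    proof
      assume "\<exists>j2 vs \<sigma>. \<langle>j2, list_encode vs\<rangle> \<in> W g \<and> (\<forall>x. x \<notin> set vs \<longrightarrow> \<sigma> x = \<tau>' x) \<and>
        (\<forall>h\<in>X n. \<not> witnessed L A (dual Pi_pol) j2 (h \<circ> \<sigma>))"
      then obtain j2 vs \<sigma> where *: "\<langle>j2, list_encode vs\<rangle> \<in> W g" "\<forall>x. x \<notin> set vs \<longrightarrow> \<sigma> x = \<tau>' x"
        "\<And>h. h \<in> X n \<Longrightarrow> \<not> witnessed L A (dual Pi_pol) j2 (h \<circ> \<sigma>)" by blast
      have "witnessed L A Pi_pol j (h \<circ> \<tau>')" if "h \<in> X n" for h
      proof -
        have "\<forall>x. x \<notin> set vs \<longrightarrow> (h \<circ> \<sigma>) x = (h \<circ> \<tau>') x" using *(2) by simp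
        then show ?thesis unfolding g witnessed_iff[OF b(2)[unfolded g] False] using *(1) *(3)[OF that] by blast
      qed
      then show ?thesis unfolding ev_def by blast
    qed (auto simp: ev_def)
  qed
  then show False
  proof
    assume "ev (\<lambda>h. witnessed L A Pi_pol j (h \<circ> \<tau>'))"
    with truth[OF b(2,1), of l] j(3) show False by (simp add: l)
  next
    assume "ev (\<lambda>h. \<not> witnessed L A Pi_pol j (h \<circ> \<tau>'))"
    then obtain n where "\<forall>h\<in>X n. sat_index L A j (h \<circ> \<tau>')" by (auto simp: ev_def witnessed_def)
    with not_isolated j(1) X(1)[of n] show False unfolding C_def by blast
  qed
qed

section \<open>The implication between a condition and a disjunct\<close>

text \<open>\<open>l\<close> is a conjunction of formulas \<forall>vs. \<chi>, so the implication is
  the conjunction of the \<forall>ys vs. (\<chi> \<or> \<not> p). The disjunction belongs at the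
  larger of \<open>g\<close> and the level of \<chi>. Comparing notations is only semi-decidable, so
  both comparisons are searched for and an index is enumerated at the level that turns out
  larger.\<close>

lemma implication_exists:
  assumes O: "kleene_O \<delta>" "\<delta> \<noteq> 1" and g: "g <\<^sub>O \<delta>"
    and p: "valid L Pi_pol g ys p" and l: "valid L Pi_pol \<delta> us l"
    and \<tau>: "\<And>x. x \<in> set us \<Longrightarrow> \<tau> x \<in> set ys"
  shows "\<exists>i. valid L Pi_pol \<delta> [] i \<and>
    (\<forall>A v. sat_index L A i v \<longleftrightarrow> (\<forall>w. sat_index L A p w \<longrightarrow> sat_index L A l (w \<circ> \<tau>)))"
proof -
  from valid_elim[OF l O(2)] obtain e where e: "l = mk_index Pi_pol \<delta> us e" by metis
  have dys: "distinct ys" using p by (rule valid_distinct)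
  define zs where "zs vs = ys @ fresh_vars ys vs" for vs
  define \<rho> where "\<rho> vs = fresh_pairs ys vs @ graph_list \<tau> us" for vs
  define ind where "ind m j vs =
    disj_index m (zs vs) (rename j (zs vs) (\<rho> vs) 0) (rename p (zs vs) (graph_list (\<lambda>x. x) ys) 1)" for m j vs
  define el where "el m q = \<langle>ind m (p1 q) (list_decode (p2 q)), list_encode (zs (list_decode (p2 q)))\<rangle>" for m q
  \<comment> \<open>The notation recorded in the index of the matrix.\<close>
  define lev where "lev q = p1 (p2 (p1 q))" for q
  \<comment> \<open>If both levels coincide, both alternatives enumerate the same index.\<close>
  have "ce (\<lambda>n. \<exists>q. q \<in> W e \<and> (le_ce g (lev q) \<and> n = el (lev q) q \<or> le_ce (lev q) g \<and> n = el g q))"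
    unfolding el_def ind_def \<rho>_def zs_def lev_def by (intro ce comp)
  from ce_imp_W[OF this] obtain e' where e': "\<And>n. n \<in> W e' \<longleftrightarrow>
      (\<exists>q. q \<in> W e \<and> (le_ce g (lev q) \<and> n = el (lev q) q \<or> le_ce (lev q) g \<and> n = el g q))" by blast
  have j: "\<exists>c. c <\<^sub>O \<delta> \<and> valid L Sigma_pol c (us @ vs) j \<and> lev \<langle>j, list_encode vs\<rangle> = c \<and>
      distinct vs \<and> set us \<inter> set vs = {}"
    if "\<langle>j, list_encode vs\<rangle> \<in> W e" for j vs
  proof -
    from valid_elem[OF l[unfolded e] O(2) that] obtain c where
      c: "c <\<^sub>O \<delta>" "valid L Sigma_pol c (us @ vs) j" by auto
    from c(2) obtain f where "j = mk_index Sigma_pol c (us @ vs) f"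
      by (cases "c = 1") (metis valid_qf_elim, metis valid_elim)
    then have "lev \<langle>j, list_encode vs\<rangle> = c" by (simp add: lev_def mk_index_def)
    with c valid_distinct[OF c(2)] show ?thesis by auto
  qed
  have ind: "valid L Sigma_pol m (zs vs) (ind m j vs) \<and>
      (\<forall>A w w'. (\<forall>x\<in>set us. w' x = w (\<tau> x)) \<longrightarrow> (\<forall>x\<in>set vs. w' x = w (lookup (\<rho> vs) x)) \<longrightarrow>
        sat_index L A (ind m j vs) w = (sat_index L A j w' \<or> \<not> sat_index L A p w))"
    if jW: "\<langle>j, list_encode vs\<rangle> \<in> W e" and m: "lev \<langle>j, list_encode vs\<rangle> \<le>\<^sub>O m" "g \<le>\<^sub>O m" "m <\<^sub>O \<delta>" for j vs m
  proof -
    from j[OF jW] obtain c where c: "c <\<^sub>O \<delta>" "valid L Sigma_pol c (us @ vs) j" "lev \<langle>j, list_encode vs\<rangle> = c"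
      and d: "distinct vs" "set us \<inter> set vs = {}" by blast
    have dz: "distinct (zs vs)" unfolding zs_def by (rule distinct_append_fresh[OF dys])
    have \<rho>_us: "lookup (\<rho> vs) x = \<tau> x" if "x \<in> set us" for x
      using that d(2) by (simp add: \<rho>_def lookup_fresh_notin disjoint_iff)
    have \<rho>_in: "lookup (\<rho> vs) x \<in> set (zs vs)" if "x \<in> set (us @ vs)" for x
    proof (cases "x \<in> set us")
      case True
      then show ?thesis using \<rho>_us \<tau> by (simp add: zs_def)
    next
      case False
      then show ?thesis using that lookup_fresh_in[OF d(1), of x ys "graph_list \<tau> us"]
        by (simp add: zs_def \<rho>_def)
    qed
    have id_in: "lookup (graph_list (\<lambda>x. x) ys) x \<in> set (zs vs)" if "x \<in> set ys" for x
      using that by (simp add: zs_def)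
    note v1 = rename_valid(1)[OF c(2) dz \<rho>_in]
    note v2 = rename_valid(2)[OF p dz id_in, unfolded dual.simps]
    have m1: "m = 1 \<Longrightarrow> c = 1 \<and> g = 1" using m c(3) not_less_one by auto
    have mO: "kleene_O m" using m(3) kleene_less_O by blast
    have dj: "valid L Sigma_pol m (zs vs) (ind m j vs)"
      "\<And>A w. sat_index L A (ind m j vs) w \<longleftrightarrow> sat_index L A (rename j (zs vs) (\<rho> vs) 0) w \<or>
        sat_index L A (rename p (zs vs) (graph_list (\<lambda>x. x) ys) 1) w"
      unfolding ind_def by (rule disj_correct[OF v1 v2 m(1)[unfolded c(3)] m(2) mO m1]; simp)+
    have "sat_index L A (ind m j vs) w = (sat_index L A j w' \<or> \<not> sat_index L A p w)"
      if "\<forall>x\<in>set us. w' x = w (\<tau> x)" "\<forall>x\<in>set vs. w' x = w (lookup (\<rho> vs) x)" for A w w'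
    proof -
      have "sat_index L A (rename j (zs vs) (\<rho> vs) 0) w = sat_index L A j w'"
        using that \<rho>_us by (intro rename_sat(1)[OF c(2) dz \<rho>_in]) auto
      moreover have "sat_index L A (rename p (zs vs) (graph_list (\<lambda>x. x) ys) 1) w = (\<not> sat_index L A p w)"
        by (rule rename_sat(2)[OF p dz id_in]) simp_all
      ultimately show ?thesis unfolding dj(2) by blast
    qed
    with dj(1) show ?thesis by blast
  qed
  have gO: "kleene_O g" using g kleene_less_O by blast
  have el: "\<exists>m j vs. lev \<langle>j, list_encode vs\<rangle> \<le>\<^sub>O m \<and> g \<le>\<^sub>O m \<and> m <\<^sub>O \<delta> \<and> \<langle>j, list_encode vs\<rangle> \<in> W e \<and>
      n = \<langle>ind m j vs, list_encode (zs vs)\<rangle>" if "n \<in> W e'" for n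
  proof -
    from that obtain q where q: "q \<in> W e"
      "le_ce g (lev q) \<and> n = el (lev q) q \<or> le_ce (lev q) g \<and> n = el g q" unfolding e' by blast
    obtain j vs where jv: "q = \<langle>j, list_encode vs\<rangle>"
      by (metis list_decode_inverse pair_p1_p2)
    from j q(1) jv obtain c where c: "c <\<^sub>O \<delta>" "lev q = c" by blast
    then have "kleene_O c" using kleene_less_O by blast
    with q(2) gO c(2) have "g \<le>\<^sub>O c \<and> n = el c q \<or> c \<le>\<^sub>O g \<and> n = el g q"
      using le_ce_iff by metis
    moreover have "el m q = \<langle>ind m j vs, list_encode (zs vs)\<rangle>" for m by (simp add: el_def jv)
    ultimately show ?thesis using q(1) c g unfolding jv by metis
  qed
  have el': "\<exists>m. lev \<langle>j, list_encode vs\<rangle> \<le>\<^sub>O m \<and> g \<le>\<^sub>O m \<and> m <\<^sub>O \<delta> \<and> \<langle>ind m j vs, list_encode (zs vs)\<rangle> \<in> W e'"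
    if jW: "\<langle>j, list_encode vs\<rangle> \<in> W e" for j vs
  proof -
    from j[OF jW] obtain c where c: "c <\<^sub>O \<delta>" "lev \<langle>j, list_encode vs\<rangle> = c" by blast
    have cO: "kleene_O c" using c(1) kleene_less_O by blast
    have "el m \<langle>j, list_encode vs\<rangle> = \<langle>ind m j vs, list_encode (zs vs)\<rangle>" for m by (simp add: el_def)
    \<comment> \<open>Linearity below \<delta> makes one of the two searches succeed, so no conjunct
      is lost.\<close>
    moreover have "g \<le>\<^sub>O c \<or> c \<le>\<^sub>O g" using kleene_less_linear[OF O(1) g c(1)] by blast
    ultimately show ?thesis unfolding e' using jW c g le_ce_iff[OF gO cO] le_ce_iff[OF cO gO] by metis
  qed
  have val: "valid L Pi_pol \<delta> [] (mk_index Pi_pol \<delta> [] e')"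
  proof (rule valid_intro[OF O])
    fix n assume "n \<in> W e'"
    from el[OF this] obtain m j vs where *: "lev \<langle>j, list_encode vs\<rangle> \<le>\<^sub>O m" "g \<le>\<^sub>O m" "m <\<^sub>O \<delta>"
      "\<langle>j, list_encode vs\<rangle> \<in> W e" "n = \<langle>ind m j vs, list_encode (zs vs)\<rangle>" by blast
    from ind[OF *(4,1,2,3)] *(3) show "elem_ok L Pi_pol \<delta> [] n"
      unfolding elem_ok_def *(5) by (metis append_Nil dual.simps(2))
  qed simp
  have "sat_index L A (mk_index Pi_pol \<delta> [] e') v \<longleftrightarrow> (\<forall>w. sat_index L A p w \<longrightarrow> sat_index L A l (w \<circ> \<tau>))" for A v
  proof
    assume sat: "sat_index L A (mk_index Pi_pol \<delta> [] e') v"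
    show "\<forall>w. sat_index L A p w \<longrightarrow> sat_index L A l (w \<circ> \<tau>)"
    proof (intro allI impI, rule ccontr)
      fix w assume w: "sat_index L A p w" and "\<not> sat_index L A l (w \<circ> \<tau>)"
      then have "witnessed L A Pi_pol l (w \<circ> \<tau>)" by (simp add: witnessed_def)
      then obtain j' vs w' where j': "\<langle>j', list_encode vs\<rangle> \<in> W e" "\<forall>x. x \<notin> set vs \<longrightarrow> w' x = (w \<circ> \<tau>) x"
        "\<not> sat_index L A j' w'"
        unfolding e witnessed_iff[OF l[unfolded e] O(2)] by (auto simp: witnessed_def)
      from j[OF j'(1)] have d: "distinct vs" "set us \<inter> set vs = {}" by auto
      from fresh_assignment[OF d(1), of ys w "graph_list \<tau> us" w'] obtain u where
        u: "\<forall>y. y \<notin> set (fresh_vars ys vs) \<longrightarrow> u y = w y" "\<forall>x\<in>set vs. u (lookup (\<rho> vs) x) = w' x"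
        unfolding \<rho>_def by blast
      have u_ys: "u y = w y" if "y \<in> set ys" for y using u(1) that fresh_vars_notin by blast
      from el'[OF j'(1)] obtain m where m: "lev \<langle>j', list_encode vs\<rangle> \<le>\<^sub>O m" "g \<le>\<^sub>O m" "m <\<^sub>O \<delta>"
        "\<langle>ind m j' vs, list_encode (zs vs)\<rangle> \<in> W e'" by blast
      have "sat_index L A p u" using sat_index_cong[OF p, of u w] u_ys w by simp
      moreover have "\<forall>x\<in>set us. w' x = u (\<tau> x)" using j'(2) d(2) u_ys \<tau> by (auto simp: disjoint_iff)
      ultimately have "\<not> sat_index L A (ind m j' vs) u"
        using ind[OF j'(1) m(1-3)] j'(3) u(2) by metis
      \<comment> \<open>The counterexample \<open>u\<close> is reset to \<open>v\<close> outside the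
        quantified tuple, as \<open>witnessed_iff\<close> demands.\<close>
      define u' where "u' x = (if x \<in> set (zs vs) then u x else v x)" for x
      have "\<not> sat_index L A (ind m j' vs) u'"
        using \<open>\<not> sat_index L A (ind m j' vs) u\<close>
          sat_index_cong[OF conjunct1[OF ind[OF j'(1) m(1-3)]], of u' u A] by (simp add: u'_def)
      moreover have "\<forall>x. x \<notin> set (zs vs) \<longrightarrow> u' x = v x" by (simp add: u'_def)
      ultimately have "witnessed L A Pi_pol (mk_index Pi_pol \<delta> [] e') v"
        unfolding witnessed_iff[OF val O(2)] using m(4) unfolding witnessed_def dual.simps by blast
      with sat show False by (simp add: witnessed_def)
    qed
  next
    assume imp: "\<forall>w. sat_index L A p w \<longrightarrow> sat_index L A l (w \<circ> \<tau>)"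
    show "sat_index L A (mk_index Pi_pol \<delta> [] e') v"
    proof (rule ccontr)
      assume "\<not> ?thesis"
      then have "witnessed L A Pi_pol (mk_index Pi_pol \<delta> [] e') v" by (simp add: witnessed_def)
      then obtain n ws w where n: "\<langle>n, list_encode ws\<rangle> \<in> W e'" "\<not> sat_index L A n w"
        unfolding witnessed_iff[OF val O(2)] by (auto simp: witnessed_def)
      from el[OF n(1)] obtain m j' vs where j': "lev \<langle>j', list_encode vs\<rangle> \<le>\<^sub>O m" "g \<le>\<^sub>O m" "m <\<^sub>O \<delta>"
        "\<langle>j', list_encode vs\<rangle> \<in> W e" "n = ind m j' vs" by auto
      from j[OF j'(4)] have d: "set us \<inter> set vs = {}" by auto
      define w' where "w' x = (if x \<in> set vs then w (lookup (\<rho> vs) x) else w (\<tau> x))" for x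
      have "\<forall>x\<in>set us. w' x = w (\<tau> x)" "\<forall>x\<in>set vs. w' x = w (lookup (\<rho> vs) x)"
        using d by (auto simp: w'_def)
      then have "\<not> sat_index L A j' w' \<and> sat_index L A p w"
        using ind[OF j'(4,1,2,3)] n(2) unfolding j'(5) by blast
      moreover from this imp have "\<not> witnessed L A Pi_pol l (w \<circ> \<tau>)" by (simp add: witnessed_def)
      moreover have "\<forall>x. x \<notin> set vs \<longrightarrow> w' x = (w \<circ> \<tau>) x" by (simp add: w'_def)
      ultimately show False
        unfolding e witnessed_iff[OF l[unfolded e] O(2)] using j'(4) unfolding witnessed_def dual.simps by blast
    qed
  qed
  with val show ?thesis by blast
qed

section \<open>Injective tuples and enumerations of the universe\<close>

primrec differs :: "nat \<Rightarrow> nat list \<Rightarrow> qf" where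
  "differs y [] = Verum"
| "differs y (z # zs) = QAnd (QNeg (Eq (Var y) (Var z))) (differs y zs)"

text \<open>Conditions only know bijective enumerations, whereas the final sentence quantifies over
  all tuples; this formula, added to p, bridges the gap.\<close>

primrec pairwise_distinct :: "nat list \<Rightarrow> qf" where
  "pairwise_distinct [] = Verum"
| "pairwise_distinct (y # ys) = QAnd (differs y ys) (pairwise_distinct ys)"

lemma differs: "qf_sat A v (differs y zs) \<longleftrightarrow> v y \<notin> v ` set zs" "qf_wf L (differs y zs)"
    "qf_fv (differs y zs) \<subseteq> insert y (set zs)"
  by (induction zs) auto

lemma pairwise_distinct: "qf_sat A v (pairwise_distinct ys) \<longleftrightarrow> distinct (map v ys)"
    "qf_wf L (pairwise_distinct ys)" "qf_fv (pairwise_distinct ys) \<subseteq> set ys"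
  using differs(3) by (induction ys) (auto simp: differs(1,2))

text \<open>The complements of a finite set and of its image are both infinite, hence in bijection.
  An injective tuple that realises p thus extends to an enumeration in the condition.\<close>

lemma extend_to_bij:
  assumes "finite S" "inj_on v S"
  shows "\<exists>h :: nat \<Rightarrow> nat. bij h \<and> (\<forall>y\<in>S. h y = v y)"
proof -
  have inf: "infinite (- S)" "infinite (- (v ` S))"
    using assms(1) by (simp_all add: Compl_eq_Diff_UNIV Diff_infinite_finite)
  define g where "g = enumerate (- (v ` S)) \<circ> inv_into UNIV (enumerate (- S))"
  have g: "bij_betw g (- S) (- (v ` S))"
    unfolding g_def using bij_enumerate[OF inf(1)] bij_enumerate[OF inf(2)]
    by (blast intro: bij_betw_trans bij_betw_inv_into)
  define h where "h y = (if y \<in> S then v y else g y)" for y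
  have "bij_betw h S (v ` S)" using assms(2) by (simp add: h_def bij_betw_def inj_on_def)
  moreover have "bij_betw h (- S) (- (v ` S))"
    using g bij_betw_cong[of "- S" h g] by (simp add: h_def)
  ultimately have "bij_betw h (S \<union> - S) (v ` S \<union> - (v ` S))"
    by (rule bij_betw_combine) simp
  then show ?thesis by (intro exI[of _ h]) (simp add: h_def)
qed

lemma isomorphic_refl: "isomorphic L A A"
  unfolding isomorphic_def by (rule exI[of _ id]) simp

lemma models_sentence_iff: "sentence L \<phi> \<Longrightarrow> models B \<phi> \<longleftrightarrow> sat B \<phi> v"
  unfolding models_def sentence_def using sat_cong[of \<phi>] by blast

lemma sat_And: "sat A (And \<phi> \<psi>) v \<longleftrightarrow> sat A \<phi> v \<and> sat A \<psi> v"
  by (auto simp: And_def)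

theorem theorem3p2:
  fixes L :: language and A :: struct and a :: nat
  assumes "computable_language L"
    and "kleene_O a" and "natLeq_on 2 \<le>o ordinal_of a"
    and "\<exists>\<phi>. scott_sentence L A \<phi> \<and> computable_Pi L a [] \<phi>"
    and "\<exists>\<phi>. scott_sentence L A \<phi> \<and> computable_Sigma L a [] \<phi>"
  shows "\<exists>b \<phi>. b <\<^sub>O a \<and> scott_sentence L A \<phi> \<and> computable_d_Sigma L b [] \<phi>"
proof -
  note O = assms(2)
  from dec_ordinal_2[OF assms(3)] obtain d where d: "d <\<^sub>O a" "d \<noteq> 1" by blast
  have a1: "a \<noteq> 1" using d(1) not_less_one by blast
  from assms(4) obtain \<phi> i where \<phi>: "scott_sentence L A \<phi>" "indexes L Pi_pol a [] i \<phi>"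
    unfolding computable_Pi_def by blast
  from assms(5) obtain \<psi> i' where \<psi>: "scott_sentence L A \<psi>" "indexes L Sigma_pol a [] i' \<psi>"
    unfolding computable_Sigma_def by blast
  have val: "valid L Pi_pol a [] i" "valid L Sigma_pol a [] i'" using \<phi>(2) \<psi>(2) by (auto simp: valid_def)
  from valid_elim[OF val(1) a1] obtain e where e: "i = mk_index Pi_pol a [] e" by metis
  from valid_elim[OF val(2) a1] obtain f where f: "i' = mk_index Sigma_pol a [] f" by metis
  have iso_\<phi>: "isomorphic L A B \<longleftrightarrow> sat_index L B i v" for B v
    using \<phi> models_sentence_iff[of L \<phi> B v] by (auto simp: scott_sentence_def sat_index_eq)
  have iso_\<psi>: "isomorphic L A B \<longleftrightarrow> sat_index L B i' v" for B v
    using \<psi> models_sentence_iff[of L \<psi> B v] by (auto simp: scott_sentence_def sat_index_eq)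
  have "\<exists>j us \<tau> X. \<langle>j, list_encode us\<rangle> \<in> W f \<and> condition L A a X \<and> X \<noteq> {} \<and> (\<forall>h\<in>X. sat_index L A j (h \<circ> \<tau>))"
  proof (rule isolating_condition[OF O d val(1)[unfolded e] _ val(2)[unfolded f]])
    show "sat_index L A (mk_index Pi_pol a [] e) v" for v
      using iso_\<phi>[of A v] isomorphic_refl unfolding e by blast
    show "sat_index L B (mk_index Pi_pol a [] e) v \<Longrightarrow> sat_index L B (mk_index Sigma_pol a [] f) v" for B v
      using iso_\<phi>[of B v] iso_\<psi>[of B v] unfolding e f by blast
  qed
  then obtain j us \<tau> X where j: "\<langle>j, list_encode us\<rangle> \<in> W f" and X: "condition L A a X" "X \<noteq> {}"
    "\<And>h. h \<in> X \<Longrightarrow> sat_index L A j (h \<circ> \<tau>)" by blast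
  from X(1) obtain g ys0 p0 where p0: "low a g" "valid L Pi_pol g ys0 p0"
    "X = {h. bij h \<and> sat_index L A p0 h}" unfolding condition_def by blast
  from valid_elem[OF val(2)[unfolded f] a1 j] obtain b where b: "b <\<^sub>O a" "valid L Pi_pol b us j" by auto

  from p0(1) obtain c where c: "g <\<^sub>O c" "c <\<^sub>O a" unfolding low_def by blast
  \<comment> \<open>The larger of \<open>b\<close> and \<open>c\<close>. Interposing
    \<open>c\<close> between \<open>g\<close> and \<open>a\<close> ensures \<open>g\<close> <
    \<delta> even when \<open>b\<close> does not exceed \<open>g\<close>.\<close>
  from kleene_less_linear[OF O b(1) c(2)] obtain \<delta> where \<delta>: "\<delta> <\<^sub>O a" "b \<le>\<^sub>O \<delta>" "c \<le>\<^sub>O \<delta>"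
    using b(1) c(2) by metis
  have g\<delta>: "g <\<^sub>O \<delta>" using \<delta>(3) c(1) less_trans by blast
  have \<delta>1: "\<delta> \<noteq> 1" using g\<delta> not_less_one by blast
  have \<delta>O: "kleene_O \<delta>" and gO: "kleene_O g" using g\<delta> kleene_less_O by blast+
  \<comment> \<open>Conjoining the disjunct with itself raises its level from \<open>b\<close> to
    \<delta>.\<close>
  from conj_exists[OF b(2,2) \<delta>(2,2) \<delta>O] \<delta>1 obtain l where l: "valid L Pi_pol \<delta> us l"
    "\<And>B v. sat_index L B l v \<longleftrightarrow> sat_index L B j v" by metis

  define ys where "ys = remdups (ys0 @ map \<tau> us)"
  have ys: "distinct ys" "set ys0 \<subseteq> set ys" "\<And>x. x \<in> set us \<Longrightarrow> \<tau> x \<in> set ys" by (auto simp: ys_def)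
  from valid_extend_tuple[OF p0(2) ys(1,2)] obtain p' where p': "valid L Pi_pol g ys p'"
    "\<And>B v. sat_index L B p' v \<longleftrightarrow> sat_index L B p0 v" by blast
  \<comment> \<open>Distinctness is quantifier-free and so can be added to p without raising its
    level \<open>g\<close>.\<close>
  note q1 = valid_qf(1)[OF ys(1) pairwise_distinct(2)[of L ys] pairwise_distinct(3), of Pi_pol]
    and q2 = valid_qf(2)[OF ys(1) pairwise_distinct(2)[of L ys] pairwise_distinct(3), of _ Pi_pol]
  have "1 \<le>\<^sub>O g" using one_less[OF gO] by blast
  from conj_exists[OF p'(1) q1 _ this gO] obtain p where p: "valid L Pi_pol g ys p"
    "\<And>B v. sat_index L B p v \<longleftrightarrow> sat_index L B p0 v \<and> distinct (map v ys)"
    unfolding p'(2) q2 pairwise_distinct(1) by blast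

  \<comment> \<open>A one-element c.e. set gives the \<Sigma> half, the existential closure of
    \<open>p\<close>.\<close>
  have "ce (\<lambda>n. n = \<langle>p, list_encode ys\<rangle>)" by (intro ce comp)
  from ce_imp_W[OF this] obtain e1 where e1: "\<And>n. n \<in> W e1 \<longleftrightarrow> n = \<langle>p, list_encode ys\<rangle>" by blast
  define i1 where "i1 = mk_index Sigma_pol \<delta> [] e1"
  have i1: "valid L Sigma_pol \<delta> [] i1"
    unfolding i1_def
  proof (rule valid_intro[OF \<delta>O \<delta>1])
    fix n assume "n \<in> W e1"
    with p(1) g\<delta> show "elem_ok L Sigma_pol \<delta> [] n"
      unfolding e1 elem_ok_def by (metis append_Nil dual.simps(1))
  qed simp
  have sat_i1: "sat_index L B i1 v \<longleftrightarrow> (\<exists>w. sat_index L B p w)" for B v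
  proof -
    have "(\<exists>w. (\<forall>x. x \<notin> set ys \<longrightarrow> w x = v x) \<and> sat_index L B p w) \<longleftrightarrow> (\<exists>w. sat_index L B p w)"
    proof
      assume "\<exists>w. sat_index L B p w"
      then obtain w where w: "sat_index L B p w" ..
      then have "sat_index L B p (\<lambda>x. if x \<in> set ys then w x else v x)"
        using sat_index_cong[OF p(1), of "\<lambda>x. if x \<in> set ys then w x else v x" w B] by simp
      then show "\<exists>w. (\<forall>x. x \<notin> set ys \<longrightarrow> w x = v x) \<and> sat_index L B p w"
        by (intro exI[of _ "\<lambda>x. if x \<in> set ys then w x else v x"]) simp
    qed blast
    then show ?thesis
      using witnessed_iff[OF i1[unfolded i1_def] \<delta>1, of B v]
      by (simp add: i1_def witnessed_def e1 list_encode_eq)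
  qed
  from implication_exists[where \<tau> = \<tau>, OF \<delta>O \<delta>1 g\<delta> p(1) l(1) ys(3)] obtain i2 where i2: "valid L Pi_pol \<delta> [] i2"
    "\<And>B v. sat_index L B i2 v \<longleftrightarrow> (\<forall>w. sat_index L B p w \<longrightarrow> sat_index L B j (w \<circ> \<tau>))"
    unfolding l(2) by blast

  from i1 obtain \<chi>1 where \<chi>1: "indexes L Sigma_pol \<delta> [] i1 \<chi>1" by (auto simp: valid_def)
  from i2(1) obtain \<chi>2 where \<chi>2: "indexes L Pi_pol \<delta> [] i2 \<chi>2" by (auto simp: valid_def)
  have sent: "sentence L (And \<chi>1 \<chi>2)"
    using indexes_wf_fv[OF \<chi>1] indexes_wf_fv[OF \<chi>2] by (auto simp: sentence_def And_def)
  have sat_\<chi>: "models B (And \<chi>1 \<chi>2) \<longleftrightarrow>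
      (\<exists>w. sat_index L B p w) \<and> (\<forall>w. sat_index L B p w \<longrightarrow> sat_index L B j (w \<circ> \<tau>))" for B
    by (simp add: models_def sat_And sat_index_eq[OF \<chi>1, symmetric] sat_index_eq[OF \<chi>2, symmetric] sat_i1 i2(2))
  have "models B (And \<chi>1 \<chi>2) \<Longrightarrow> isomorphic L A B" for B
  proof -
    assume "models B (And \<chi>1 \<chi>2)"
    \<comment> \<open>A realisation of \<open>p\<close> in \<open>B\<close> also realises the
      disjunct, so \<open>B\<close> satisfies the \<Sigma> Scott sentence.\<close>
    then obtain w where "sat_index L B j (w \<circ> \<tau>)" unfolding sat_\<chi> by blast
    then have "witnessed L B Sigma_pol i' (w \<circ> \<tau>)"
      unfolding f witnessed_iff[OF val(2)[unfolded f] a1] using j unfolding witnessed_def dual.simps by blast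
    then show "isomorphic L A B" unfolding iso_\<psi>[of B "w \<circ> \<tau>"] by (simp add: witnessed_def)
  qed
  moreover have "models A (And \<chi>1 \<chi>2)"
    unfolding sat_\<chi>
  proof (intro conjI allI impI)
    from X(2) obtain h where h: "h \<in> X" by blast
    then have "sat_index L A p0 h" "distinct (map h ys)"
      using ys(1) unfolding p0(3) by (auto simp: distinct_map bij_def inj_on_def)
    then show "\<exists>w. sat_index L A p w" unfolding p(2) by blast
  next
    fix w assume "sat_index L A p w"
    then have w: "sat_index L A p0 w" "inj_on w (set ys)" unfolding p(2) by (simp_all add: distinct_map)
    \<comment> \<open>The isolation property speaks of enumerations of the whole universe; it
      reaches \<open>w\<close> because both formulas see only the values on
      \<open>ys\<close>.\<close>
    from extend_to_bij[OF finite_set w(2)] obtain h where h: "bij h" "\<And>y. y \<in> set ys \<Longrightarrow> h y = w y" by blast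
    have "sat_index L A p0 h" using sat_index_cong[OF p0(2), of h w] h(2) ys(2) w(1) by auto
    with h(1) have "h \<in> X" by (simp add: p0(3))
    then have "sat_index L A j (h \<circ> \<tau>)" by (rule X(3))
    then show "sat_index L A j (w \<circ> \<tau>)"
      using sat_index_cong[OF b(2), of "w \<circ> \<tau>" "h \<circ> \<tau>"] h(2) ys(3) by simp
  qed
  ultimately have "scott_sentence L A (And \<chi>1 \<chi>2)"
    unfolding scott_sentence_def using sent models_isomorphic by blast
  moreover have "computable_d_Sigma L \<delta> [] (And \<chi>1 \<chi>2)"
    unfolding computable_d_Sigma_def computable_Sigma_def computable_Pi_def using \<chi>1 \<chi>2 by blast
  ultimately show ?thesis using \<delta>(1) by blast
qed

end
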